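(* Let $\mathcal{D}$ be a well generated triangulated category, let $\omega$ be a partial silting object in $\mathcal{D}$, and consider the associated recollement with outer terms $\omega^{\perp_{\mathbb{Z}}}$ and $\mathrm{Loc}(\omega)$, with functors $i^*, i_*, i^!$ (between $\omega^{\perp_{\mathbb{Z}}}$ and $\mathcal{D}$) and $j_!, j^*, j_*$ (between $\mathrm{Loc}(\omega)$ and $\mathcal{D}$), where $i_*$ and $j_!$ are the inclusions. Let $\sigma$ be a silting object in $\omega^{\perp_{\mathbb{Z}}}$. Assume that $j_*\omega$ has an $\mathrm{add}(i_*\sigma[1])$-preenvelope $\alpha\colon j_*\omega \to i_*\sigma^I[1]$ for a finite index set $I$, and that (1) the class $(i_*\sigma)^{\perp_{>0}}$ is closed under coproducts in $\mathcal{D}$; (2) $\mathrm{Hom}_{\mathcal{D}}(j_*\omega, i_*\sigma[k]) = 0$ for all integers $k \geq 2$; (3) $j_*\omega$ is a compact object in $\mathcal{D}$. Let $\tilde{\sigma}$ be the cocone of $\alpha$, so that there is a triangle $$i_*\sigma^I \to \tilde{\sigma} \to j_*\omega \xrightarrow{\alpha} i_*\sigma^I[1].$$ Then $\tilde{\sigma} \oplus i_*\sigma$ is a silting object in $\mathcal{D}$.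
   Context: Well generated is meant in the sense of Neeman/Krause: $\mathcal{D}$ has set-indexed coproducts and, for some regular cardinal $\alpha$, a set $\mathcal{S}$ of $\alpha$-small objects with $\mathcal{S}^{\perp_{\mathbb{Z}}}=0$ such that, for every set of maps $(g_\lambda)$ in $\mathcal{D}$, if $\mathrm{Hom}(S,g_\lambda)$ is surjective for all $\lambda$ and all $S\in\mathcal{S}$, then $\mathrm{Hom}(S,\coprod g_\lambda)$ is surjective for all $S\in\mathcal S$. For an object $X$ of a triangulated category $\mathcal{T}$ and a set $I$ of integers (written e.g. $>0$, $\le 0$, $\mathbb{Z}$), $X^{\perp_I}=\{Y\in\mathcal{T} : \mathrm{Hom}_{\mathcal{T}}(X,Y[i])=0 \text{ for all } i\in I\}$. $\mathrm{Loc}(\omega)$ is the smallest triangulated subcategory containing $\omega$ and closed under coproducts; $\mathrm{add}(X)$ is the closure of $X$ under finite coproducts and summands. An object $M$ is compact if $\mathrm{Hom}(M,-)$ commutes with coproducts. For an additive subcategory $\mathcal{X}$, a map $\alpha\colon M\to N$ is an $\mathcal{X}$-preenvelope if $N\in\mathcal{X}$ and $\mathrm{Hom}(\alpha,X)$ is surjective for every $X\in\mathcal{X}$. A torsion pair $(\mathcal{U},\mathcal{V})$ is a pair of full subcategories closed under summands with $\mathrm{Hom}(\mathcal{U},\mathcal{V})=0$ such that every object $X$ lies in a triangle $U\to X\to V\to U[1]$ with $U\in\mathcal{U}$, $V\in\mathcal{V}$; it is a t-structure if $\mathcal{U}$ is closed under positive shifts and extensions. An object $\sigma$ is silting if $(\sigma^{\perp_{>0}},\sigma^{\perp_{\le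 0}})$ is a t-structure. In a well generated triangulated category, $\omega$ is partial silting if $\omega\in\omega^{\perp_{>0}}$ and $\omega^{\perp_{>0}}$ is closed under coproducts; silting is equivalent to partial silting together with $\omega^{\perp_{\mathbb{Z}}}=0$. For $\omega$ partial silting, $\mathrm{Loc}(\omega)$ is smashing, $\omega$ is silting in $\mathrm{Loc}(\omega)$, both $\mathrm{Loc}(\omega)$ and $\omega^{\perp_{\mathbb Z}}$ are well generated, and there is a recollement $$\omega^{\perp_{\mathbb{Z}}} \xrightarrow{\ i_*\ } \mathcal{D} \xrightarrow{\ j^*\ } \mathrm{Loc}(\omega)$$ with $i_*$ the inclusion, $j_!\colon \mathrm{Loc}(\omega)\to\mathcal{D}$ the inclusion, and adjoint pairs $(i^*,i_* ),(i_*,i^!),(j_!,j^* ),(j^*,j_* )$, where $i_*,j_!,j_*$ are fully faithful and $i^!j_*=0$. *)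

theory Defs
  imports "HOL-Algebra.Product_Groups" "HOL-Algebra.FiniteProduct" "HOL-Library.Equipollence"
begin

section \<open>Small sets\<close>

text \<open>
  A triangulated category with set-indexed coproducts is a large category with small Hom sets, so
  the words ``set'' and ``class'' have to be kept apart. We do this relative to a Grothendieck
  universe, given up to bijection by a set \<open>U\<close> of inaccessible cardinality: a set of any type is
  \<^emph>\<open>small\<close> if its cardinality is strictly below that of \<open>U\<close>. Every small set is in bijection with
  a set of elements of the type \<open>'u\<close> of \<open>U\<close>, so that quantifying over small families amounts to
  quantifying over families indexed by small sets of type \<open>'u set\<close>.
\<close>

definition small :: "'u set \<Rightarrow> 'a set \<Rightarrow> bool" where
  "small U A \<longleftrightarrow> A \<prec> U"

definition universe :: "'u set \<Rightarrow> bool" where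
  "universe U \<longleftrightarrow>
     small U (UNIV :: nat set) \<and>
     (\<forall>A. A \<subseteq> U \<and> small U A \<longrightarrow> small U (Pow A)) \<and>
     (\<forall>I A. I \<subseteq> U \<and> small U I \<and> (\<forall>i\<in>I. A i \<subseteq> U \<and> small U (A i)) \<longrightarrow> small U (\<Union>i\<in>I. A i))"


section \<open>Categories with additive structure, shift and triangles\<close>

text \<open>
  The data of a (pre-)triangulated category. A triangle is recorded by its three morphisms
  \<open>X \<rightarrow> Y \<rightarrow> Z \<rightarrow> X[1]\<close>; \<open>Sh T n\<close> and \<open>ShA T n\<close> are the \<open>n\<close>-fold shift \<open>[n]\<close> on objects and on
  morphisms, for every integer \<open>n\<close>.
\<close>

record ('o, 'm) tricat =
  Ob :: "'o set"
  Arr :: "'m set"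
  Dom :: "'m \<Rightarrow> 'o"
  Cod :: "'m \<Rightarrow> 'o"
  Ide :: "'o \<Rightarrow> 'm"
  Cmp :: "'m \<Rightarrow> 'm \<Rightarrow> 'm" (infixr "\<cdot>\<index>" 70)
  Zero :: "'o \<Rightarrow> 'o \<Rightarrow> 'm"
  Add :: "'m \<Rightarrow> 'm \<Rightarrow> 'm"
  Sh :: "int \<Rightarrow> 'o \<Rightarrow> 'o"
  ShA :: "int \<Rightarrow> 'm \<Rightarrow> 'm"
  Tri :: "('m \<times> 'm \<times> 'm) set"

definition Hom :: "('o, 'm) tricat \<Rightarrow> 'o \<Rightarrow> 'o \<Rightarrow> 'm set" where
  "Hom T X Y = {f \<in> Arr T. Dom T f = X \<and> Cod T f = Y}"

definition hom_group :: "('o, 'm) tricat \<Rightarrow> 'o \<Rightarrow> 'o \<Rightarrow> 'm monoid" where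
  "hom_group T X Y = \<lparr>carrier = Hom T X Y, mult = Add T, one = Zero T X Y\<rparr>"

definition neg :: "('o, 'm) tricat \<Rightarrow> 'm \<Rightarrow> 'm" where
  "neg T f = inv\<^bsub>hom_group T (Dom T f) (Cod T f)\<^esub> f"

definition category :: "('o, 'm) tricat \<Rightarrow> bool" where
  "category T \<longleftrightarrow>
     (\<forall>f\<in>Arr T. Dom T f \<in> Ob T \<and> Cod T f \<in> Ob T) \<and>
     (\<forall>X\<in>Ob T. Ide T X \<in> Hom T X X) \<and>
     (\<forall>X Y Z. \<forall>f\<in>Hom T X Y. \<forall>g\<in>Hom T Y Z. g \<cdot>\<^bsub>T\<^esub> f \<in> Hom T X Z) \<and>
     (\<forall>X Y. \<forall>f\<in>Hom T X Y. f \<cdot>\<^bsub>T\<^esub> Ide T X = f \<and> Ide T Y \<cdot>\<^bsub>T\<^esub> f = f) \<and>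
     (\<forall>W X Y Z. \<forall>f\<in>Hom T W X. \<forall>g\<in>Hom T X Y. \<forall>h\<in>Hom T Y Z.
        h \<cdot>\<^bsub>T\<^esub> (g \<cdot>\<^bsub>T\<^esub> f) = (h \<cdot>\<^bsub>T\<^esub> g) \<cdot>\<^bsub>T\<^esub> f)"

definition locally_small :: "'u set \<Rightarrow> ('o, 'm) tricat \<Rightarrow> bool" where
  "locally_small U T \<longleftrightarrow> (\<forall>X\<in>Ob T. \<forall>Y\<in>Ob T. small U (Hom T X Y))"

definition is_iso :: "('o, 'm) tricat \<Rightarrow> 'o \<Rightarrow> 'o \<Rightarrow> 'm \<Rightarrow> bool" where
  "is_iso T X Y f \<longleftrightarrow> f \<in> Hom T X Y \<and>
     (\<exists>g\<in>Hom T Y X. g \<cdot>\<^bsub>T\<^esub> f = Ide T X \<and> f \<cdot>\<^bsub>T\<^esub> g = Ide T Y)"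

definition isomorphic :: "('o, 'm) tricat \<Rightarrow> 'o \<Rightarrow> 'o \<Rightarrow> bool" where
  "isomorphic T X Y \<longleftrightarrow> (\<exists>f. is_iso T X Y f)"

definition zero_object :: "('o, 'm) tricat \<Rightarrow> 'o \<Rightarrow> bool" where
  "zero_object T Z \<longleftrightarrow> Z \<in> Ob T \<and>
     (\<forall>X\<in>Ob T. (\<exists>!f. f \<in> Hom T Z X) \<and> (\<exists>!f. f \<in> Hom T X Z))"

definition is_coproduct ::
  "('o, 'm) tricat \<Rightarrow> 'i set \<Rightarrow> ('i \<Rightarrow> 'o) \<Rightarrow> 'o \<Rightarrow> ('i \<Rightarrow> 'm) \<Rightarrow> bool" where
  "is_coproduct T I A C \<iota> \<longleftrightarrow> C \<in> Ob T \<and> (\<forall>i\<in>I. A i \<in> Ob T \<and> \<iota> i \<in> Hom T (A i) C) \<and>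
     (\<forall>Z\<in>Ob T. \<forall>f. (\<forall>i\<in>I. f i \<in> Hom T (A i) Z) \<longrightarrow>
        (\<exists>!u. u \<in> Hom T C Z \<and> (\<forall>i\<in>I. u \<cdot>\<^bsub>T\<^esub> \<iota> i = f i)))"

definition is_direct_sum :: "('o, 'm) tricat \<Rightarrow> 'o \<Rightarrow> 'o \<Rightarrow> 'o \<Rightarrow> bool" where
  "is_direct_sum T X Y S \<longleftrightarrow> (\<exists>\<iota>. is_coproduct T (UNIV :: bool set) (case_bool X Y) S \<iota>)"

definition additive_category :: "('o, 'm) tricat \<Rightarrow> bool" where
  "additive_category T \<longleftrightarrow> category T \<and>
     (\<forall>X\<in>Ob T. \<forall>Y\<in>Ob T. comm_group (hom_group T X Y)) \<and>
     (\<forall>X Y Z. \<forall>f\<in>Hom T X Y. \<forall>f'\<in>Hom T X Y. \<forall>g\<in>Hom T Y Z. \<forall>g'\<in>Hom T Y Z.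
        g \<cdot>\<^bsub>T\<^esub> Add T f f' = Add T (g \<cdot>\<^bsub>T\<^esub> f) (g \<cdot>\<^bsub>T\<^esub> f') \<and>
        Add T g g' \<cdot>\<^bsub>T\<^esub> f = Add T (g \<cdot>\<^bsub>T\<^esub> f) (g' \<cdot>\<^bsub>T\<^esub> f)) \<and>
     (\<exists>Z. zero_object T Z) \<and>
     (\<forall>X\<in>Ob T. \<forall>Y\<in>Ob T. \<exists>S. is_direct_sum T X Y S)"

text \<open>
  The shift is a strict action of the integers by additive endofunctors; equivalently, \<open>[1]\<close> is an
  additive automorphism and \<open>[n]\<close> is its \<open>n\<close>-th power.
\<close>

definition shift_functor :: "('o, 'm) tricat \<Rightarrow> bool" where
  "shift_functor T \<longleftrightarrow>
     (\<forall>n. \<forall>X\<in>Ob T. Sh T n X \<in> Ob T \<and> ShA T n (Ide T X) = Ide T (Sh T n X)) \<and>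
     (\<forall>n X Y. \<forall>f\<in>Hom T X Y. ShA T n f \<in> Hom T (Sh T n X) (Sh T n Y)) \<and>
     (\<forall>n X Y Z. \<forall>f\<in>Hom T X Y. \<forall>g\<in>Hom T Y Z. ShA T n (g \<cdot>\<^bsub>T\<^esub> f) = ShA T n g \<cdot>\<^bsub>T\<^esub> ShA T n f) \<and>
     (\<forall>n X Y. \<forall>f\<in>Hom T X Y. \<forall>g\<in>Hom T X Y. ShA T n (Add T f g) = Add T (ShA T n f) (ShA T n g)) \<and>
     (\<forall>X\<in>Ob T. Sh T 0 X = X) \<and> (\<forall>f\<in>Arr T. ShA T 0 f = f) \<and>
     (\<forall>m n. \<forall>X\<in>Ob T. Sh T (m + n) X = Sh T m (Sh T n X)) \<and>
     (\<forall>m n. \<forall>f\<in>Arr T. ShA T (m + n) f = ShA T m (ShA T n f))"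

definition candidate_triangle ::
  "('o, 'm) tricat \<Rightarrow> 'o \<Rightarrow> 'o \<Rightarrow> 'o \<Rightarrow> 'm \<Rightarrow> 'm \<Rightarrow> 'm \<Rightarrow> bool" where
  "candidate_triangle T X Y Z f g h \<longleftrightarrow>
     X \<in> Ob T \<and> Y \<in> Ob T \<and> Z \<in> Ob T \<and>
     f \<in> Hom T X Y \<and> g \<in> Hom T Y Z \<and> h \<in> Hom T Z (Sh T 1 X)"

definition triangle ::
  "('o, 'm) tricat \<Rightarrow> 'o \<Rightarrow> 'o \<Rightarrow> 'o \<Rightarrow> 'm \<Rightarrow> 'm \<Rightarrow> 'm \<Rightarrow> bool" where
  "triangle T X Y Z f g h \<longleftrightarrow> candidate_triangle T X Y Z f g h \<and> (f, g, h) \<in> Tri T"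

definition triangulated_category :: "('o, 'm) tricat \<Rightarrow> bool" where
  "triangulated_category T \<longleftrightarrow> additive_category T \<and> shift_functor T \<and>
     (\<forall>(f, g, h)\<in>Tri T. \<exists>X Y Z. candidate_triangle T X Y Z f g h) \<and>
     \<comment> \<open>TR1\<close>
     (\<forall>X Y Z X' Y' Z' f g h f' g' h' a b c.
        triangle T X Y Z f g h \<and> candidate_triangle T X' Y' Z' f' g' h' \<and>
        is_iso T X X' a \<and> is_iso T Y Y' b \<and> is_iso T Z Z' c \<and>
        b \<cdot>\<^bsub>T\<^esub> f = f' \<cdot>\<^bsub>T\<^esub> a \<and> c \<cdot>\<^bsub>T\<^esub> g = g' \<cdot>\<^bsub>T\<^esub> b \<and> ShA T 1 a \<cdot>\<^bsub>T\<^esub> h = h' \<cdot>\<^bsub>T\<^esub> c \<longrightarrow>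
        triangle T X' Y' Z' f' g' h') \<and>
     (\<forall>X\<in>Ob T. \<forall>Z. zero_object T Z \<longrightarrow>
        triangle T X X Z (Ide T X) (Zero T X Z) (Zero T Z (Sh T 1 X))) \<and>
     (\<forall>X Y. \<forall>f\<in>Hom T X Y. \<exists>Z g h. triangle T X Y Z f g h) \<and>
     \<comment> \<open>TR2\<close>
     (\<forall>X Y Z f g h. candidate_triangle T X Y Z f g h \<longrightarrow>
        (triangle T X Y Z f g h \<longleftrightarrow> triangle T Y Z (Sh T 1 X) g h (neg T (ShA T 1 f)))) \<and>
     \<comment> \<open>TR3\<close>
     (\<forall>X Y Z X' Y' Z' f g h f' g' h'. \<forall>a\<in>Hom T X X'. \<forall>b\<in>Hom T Y Y'.
        triangle T X Y Z f g h \<and> triangle T X' Y' Z' f' g' h' \<and> b \<cdot>\<^bsub>T\<^esub> f = f' \<cdot>\<^bsub>T\<^esub> a \<longrightarrow>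
        (\<exists>c\<in>Hom T Z Z'. c \<cdot>\<^bsub>T\<^esub> g = g' \<cdot>\<^bsub>T\<^esub> b \<and> ShA T 1 a \<cdot>\<^bsub>T\<^esub> h = h' \<cdot>\<^bsub>T\<^esub> c)) \<and>
     \<comment> \<open>TR4, the octahedral axiom\<close>
     (\<forall>X Y Z X' Y' Z' f g f' f'' g' g'' h' h''.
        triangle T X Y Z' f f' f'' \<and> triangle T Y Z X' g g' g'' \<and>
        triangle T X Z Y' (g \<cdot>\<^bsub>T\<^esub> f) h' h'' \<longrightarrow>
        (\<exists>u v. triangle T Z' Y' X' u v (ShA T 1 f' \<cdot>\<^bsub>T\<^esub> g'') \<and>
           u \<cdot>\<^bsub>T\<^esub> f' = h' \<cdot>\<^bsub>T\<^esub> g \<and> v \<cdot>\<^bsub>T\<^esub> h' = g' \<and>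
           h'' \<cdot>\<^bsub>T\<^esub> u = f'' \<and> g'' \<cdot>\<^bsub>T\<^esub> v = ShA T 1 f \<cdot>\<^bsub>T\<^esub> h''))"

definition full_sub :: "('o, 'm) tricat \<Rightarrow> 'o set \<Rightarrow> ('o, 'm) tricat" where
  "full_sub T S =
     (let A = {f \<in> Arr T. Dom T f \<in> S \<and> Cod T f \<in> S}
      in T\<lparr>Ob := S, Arr := A, Tri := Tri T \<inter> (A \<times> A \<times> A)\<rparr>)"


section \<open>Well generated triangulated categories\<close>

definition has_coproducts :: "'u set \<Rightarrow> ('o, 'm) tricat \<Rightarrow> bool" where
  "has_coproducts U T \<longleftrightarrow>
     (\<forall>(I :: 'u set) A. small U I \<and> (\<forall>i\<in>I. A i \<in> Ob T) \<longrightarrow> (\<exists>C \<iota>. is_coproduct T I A C \<iota>))"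

definition closed_under_coproducts :: "'u set \<Rightarrow> ('o, 'm) tricat \<Rightarrow> 'o set \<Rightarrow> bool" where
  "closed_under_coproducts U T S \<longleftrightarrow>
     (\<forall>(I :: 'u set) A C \<iota>. small U I \<and> (\<forall>i\<in>I. A i \<in> S) \<and> is_coproduct T I A C \<iota> \<longrightarrow> C \<in> S)"

definition perp :: "('o, 'm) tricat \<Rightarrow> 'o \<Rightarrow> int set \<Rightarrow> 'o set" where
  "perp T X I = {Y \<in> Ob T. \<forall>i\<in>I. Hom T X (Sh T i Y) = {Zero T X (Sh T i Y)}}"

text \<open>
  \<open>X\<close> is \<open>\<alpha>\<close>-small if every morphism from \<open>X\<close> to a small coproduct factors through a
  subcoproduct with fewer than \<open>\<alpha>\<close> terms.
\<close>

definition alpha_small :: "'u set \<Rightarrow> ('o, 'm) tricat \<Rightarrow> 'u rel \<Rightarrow> 'o \<Rightarrow> bool" where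
  "alpha_small U T \<alpha> X \<longleftrightarrow> X \<in> Ob T \<and>
     (\<forall>(I :: 'u set) A C \<iota>. small U I \<and> is_coproduct T I A C \<iota> \<longrightarrow>
        (\<forall>f\<in>Hom T X C. \<exists>J C' \<iota>' g u. J \<subseteq> I \<and> (card_of J, \<alpha>) \<in> ordLess \<and>
           is_coproduct T J A C' \<iota>' \<and> g \<in> Hom T X C' \<and>
           u \<in> Hom T C' C \<and> (\<forall>j\<in>J. u \<cdot>\<^bsub>T\<^esub> \<iota>' j = \<iota> j) \<and> f = u \<cdot>\<^bsub>T\<^esub> g))"

definition hom_surj :: "('o, 'm) tricat \<Rightarrow> 'o \<Rightarrow> 'o \<Rightarrow> 'o \<Rightarrow> 'm \<Rightarrow> bool" where
  "hom_surj T X A B g \<longleftrightarrow> (\<lambda>f. g \<cdot>\<^bsub>T\<^esub> f) ` Hom T X A = Hom T X B"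

definition well_generated :: "'u set \<Rightarrow> ('o, 'm) tricat \<Rightarrow> bool" where
  "well_generated U T \<longleftrightarrow> triangulated_category T \<and> locally_small U T \<and> has_coproducts U T \<and>
     (\<exists>(\<alpha> :: 'u rel) S.
        Card_order \<alpha> \<and> infinite (Field \<alpha>) \<and> regularCard \<alpha> \<and> small U (Field \<alpha>) \<and>
        S \<subseteq> Ob T \<and> small U S \<and>
        (\<forall>X\<in>S. alpha_small U T \<alpha> X) \<and>
        (\<forall>Y. (\<forall>X\<in>S. Y \<in> perp T X UNIV) \<and> Y \<in> Ob T \<longrightarrow> zero_object T Y) \<and>
        (\<forall>(I :: 'u set) A B g C \<iota> E \<kappa> h.
           small U I \<and> (\<forall>i\<in>I. g i \<in> Hom T (A i) (B i)) \<and>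
           is_coproduct T I A C \<iota> \<and> is_coproduct T I B E \<kappa> \<and>
           h \<in> Hom T C E \<and> (\<forall>i\<in>I. h \<cdot>\<^bsub>T\<^esub> \<iota> i = \<kappa> i \<cdot>\<^bsub>T\<^esub> g i) \<and>
           (\<forall>i\<in>I. \<forall>X\<in>S. hom_surj T X (A i) (B i) (g i)) \<longrightarrow>
           (\<forall>X\<in>S. hom_surj T X C E h)))"

text \<open>The canonical map from \<open>\<Oplus>\<^sub>i Hom(M, A\<^sub>i)\<close> to \<open>Hom(M, \<Coprod>\<^sub>i A\<^sub>i)\<close> is an isomorphism.\<close>

definition compact_object :: "'u set \<Rightarrow> ('o, 'm) tricat \<Rightarrow> 'o \<Rightarrow> bool" where
  "compact_object U T M \<longleftrightarrow> M \<in> Ob T \<and>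
     (\<forall>(I :: 'u set) A C \<iota>. small U I \<and> is_coproduct T I A C \<iota> \<longrightarrow>
        (\<lambda>g. finprod (hom_group T M C) (\<lambda>i. \<iota> i \<cdot>\<^bsub>T\<^esub> g i) {i \<in> I. g i \<noteq> Zero T M (A i)})
          \<in> Group.iso (sum_group I (\<lambda>i. hom_group T M (A i))) (hom_group T M C))"

definition localizing :: "'u set \<Rightarrow> ('o, 'm) tricat \<Rightarrow> 'o set \<Rightarrow> bool" where
  "localizing U T S \<longleftrightarrow> S \<subseteq> Ob T \<and> S \<noteq> {} \<and>
     (\<forall>X\<in>S. \<forall>Y. isomorphic T X Y \<longrightarrow> Y \<in> S) \<and>
     (\<forall>n. \<forall>X\<in>S. Sh T n X \<in> S) \<and>
     (\<forall>X Y Z f g h. triangle T X Y Z f g h \<and> X \<in> S \<and> Y \<in> S \<longrightarrow> Z \<in> S) \<and>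
     closed_under_coproducts U T S"

definition Loc :: "'u set \<Rightarrow> ('o, 'm) tricat \<Rightarrow> 'o \<Rightarrow> 'o set" where
  "Loc U T X = \<Inter>{S. localizing U T S \<and> X \<in> S}"


section \<open>Summands and preenvelopes\<close>

definition summand :: "('o, 'm) tricat \<Rightarrow> 'o \<Rightarrow> 'o \<Rightarrow> bool" where
  "summand T X Y \<longleftrightarrow> (\<exists>X'. is_direct_sum T X X' Y)"

inductive_set add_closure :: "('o, 'm) tricat \<Rightarrow> 'o \<Rightarrow> 'o set" for T :: "('o, 'm) tricat" and X :: 'o
  where
    base: "X \<in> add_closure T X"
  | coproduct: "finite (I :: nat set) \<Longrightarrow> (\<And>i. i \<in> I \<Longrightarrow> A i \<in> add_closure T X) \<Longrightarrow>
      is_coproduct T I A C \<iota> \<Longrightarrow> C \<in> add_closure T X"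
  | summand: "Y \<in> add_closure T X \<Longrightarrow> summand T Z Y \<Longrightarrow> Z \<in> add_closure T X"

definition preenvelope :: "('o, 'm) tricat \<Rightarrow> 'o set \<Rightarrow> 'o \<Rightarrow> 'o \<Rightarrow> 'm \<Rightarrow> bool" where
  "preenvelope T \<X> M N \<alpha> \<longleftrightarrow> \<alpha> \<in> Hom T M N \<and> N \<in> \<X> \<and>
     (\<forall>X\<in>\<X>. (\<lambda>g. g \<cdot>\<^bsub>T\<^esub> \<alpha>) ` Hom T N X = Hom T M X)"


section \<open>t-structures and silting objects\<close>

definition torsion_pair :: "('o, 'm) tricat \<Rightarrow> 'o set \<Rightarrow> 'o set \<Rightarrow> bool" where
  "torsion_pair T \<U> \<V> \<longleftrightarrow> \<U> \<subseteq> Ob T \<and> \<V> \<subseteq> Ob T \<and>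
     (\<forall>X\<in>\<U>. \<forall>Z. summand T Z X \<longrightarrow> Z \<in> \<U>) \<and>
     (\<forall>X\<in>\<V>. \<forall>Z. summand T Z X \<longrightarrow> Z \<in> \<V>) \<and>
     (\<forall>X\<in>\<U>. \<forall>Y\<in>\<V>. Hom T X Y = {Zero T X Y}) \<and>
     (\<forall>X\<in>Ob T. \<exists>A\<in>\<U>. \<exists>B\<in>\<V>. \<exists>f g h. triangle T A X B f g h)"

definition t_structure :: "('o, 'm) tricat \<Rightarrow> 'o set \<Rightarrow> 'o set \<Rightarrow> bool" where
  "t_structure T \<U> \<V> \<longleftrightarrow> torsion_pair T \<U> \<V> \<and>
     (\<forall>X\<in>\<U>. \<forall>n>0. Sh T n X \<in> \<U>) \<and>
     (\<forall>X Y Z f g h. triangle T X Y Z f g h \<and> X \<in> \<U> \<and> Z \<in> \<U> \<longrightarrow> Y \<in> \<U>)"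

definition silting :: "('o, 'm) tricat \<Rightarrow> 'o \<Rightarrow> bool" where
  "silting T \<sigma> \<longleftrightarrow> \<sigma> \<in> Ob T \<and> t_structure T (perp T \<sigma> {0<..}) (perp T \<sigma> {..0})"

definition partial_silting :: "'u set \<Rightarrow> ('o, 'm) tricat \<Rightarrow> 'o \<Rightarrow> bool" where
  "partial_silting U T \<omega> \<longleftrightarrow> \<omega> \<in> perp T \<omega> {0<..} \<and> closed_under_coproducts U T (perp T \<omega> {0<..})"


section \<open>Triangle functors and recollements\<close>

record ('o1, 'm1, 'o2, 'm2) functr =
  fob :: "'o1 \<Rightarrow> 'o2"
  far :: "'m1 \<Rightarrow> 'm2"

definition inclusion :: "('o, 'm, 'o, 'm) functr" where
  "inclusion = \<lparr>fob = (\<lambda>X. X), far = (\<lambda>f. f)\<rparr>"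

definition is_functor ::
  "('o1, 'm1) tricat \<Rightarrow> ('o2, 'm2) tricat \<Rightarrow> ('o1, 'm1, 'o2, 'm2) functr \<Rightarrow> bool" where
  "is_functor A B F \<longleftrightarrow>
     (\<forall>X\<in>Ob A. fob F X \<in> Ob B \<and> far F (Ide A X) = Ide B (fob F X)) \<and>
     (\<forall>X Y. \<forall>f\<in>Hom A X Y. far F f \<in> Hom B (fob F X) (fob F Y)) \<and>
     (\<forall>X Y Z. \<forall>f\<in>Hom A X Y. \<forall>g\<in>Hom A Y Z. far F (g \<cdot>\<^bsub>A\<^esub> f) = far F g \<cdot>\<^bsub>B\<^esub> far F f)"

definition triangle_functor ::
  "('o1, 'm1) tricat \<Rightarrow> ('o2, 'm2) tricat \<Rightarrow> ('o1, 'm1, 'o2, 'm2) functr \<Rightarrow> bool" where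
  "triangle_functor A B F \<longleftrightarrow> is_functor A B F \<and>
     (\<forall>X Y. \<forall>f\<in>Hom A X Y. \<forall>g\<in>Hom A X Y. far F (Add A f g) = Add B (far F f) (far F g)) \<and>
     (\<exists>\<phi>. (\<forall>X\<in>Ob A. is_iso B (fob F (Sh A 1 X)) (Sh B 1 (fob F X)) (\<phi> X)) \<and>
        (\<forall>X Y. \<forall>f\<in>Hom A X Y. \<phi> Y \<cdot>\<^bsub>B\<^esub> far F (ShA A 1 f) = ShA B 1 (far F f) \<cdot>\<^bsub>B\<^esub> \<phi> X) \<and>
        (\<forall>X Y Z f g h. triangle A X Y Z f g h \<longrightarrow>
           triangle B (fob F X) (fob F Y) (fob F Z) (far F f) (far F g) (\<phi> X \<cdot>\<^bsub>B\<^esub> far F h)))"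

definition fully_faithful ::
  "('o1, 'm1) tricat \<Rightarrow> ('o2, 'm2) tricat \<Rightarrow> ('o1, 'm1, 'o2, 'm2) functr \<Rightarrow> bool" where
  "fully_faithful A B F \<longleftrightarrow>
     (\<forall>X\<in>Ob A. \<forall>Y\<in>Ob A. bij_betw (far F) (Hom A X Y) (Hom B (fob F X) (fob F Y)))"

text \<open>\<open>F : A \<rightarrow> B\<close> is left adjoint to \<open>G : B \<rightarrow> A\<close>.\<close>

definition adjoint_pair ::
  "('o1, 'm1) tricat \<Rightarrow> ('o2, 'm2) tricat \<Rightarrow> ('o1, 'm1, 'o2, 'm2) functr \<Rightarrow>
   ('o2, 'm2, 'o1, 'm1) functr \<Rightarrow> bool" where
  "adjoint_pair A B F G \<longleftrightarrow>
     (\<exists>\<Phi>. (\<forall>X\<in>Ob A. \<forall>Y\<in>Ob B. bij_betw (\<Phi> X Y) (Hom B (fob F X) Y) (Hom A X (fob G Y))) \<and>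
        (\<forall>X'\<in>Ob A. \<forall>X\<in>Ob A. \<forall>Y\<in>Ob B. \<forall>Y'\<in>Ob B.
           \<forall>a\<in>Hom A X' X. \<forall>b\<in>Hom B Y Y'. \<forall>h\<in>Hom B (fob F X) Y.
             \<Phi> X' Y' (b \<cdot>\<^bsub>B\<^esub> (h \<cdot>\<^bsub>B\<^esub> far F a)) = far G b \<cdot>\<^bsub>A\<^esub> (\<Phi> X Y h \<cdot>\<^bsub>A\<^esub> a)))"

text \<open>
  The functors are listed in the order \<open>i\<^sup>*, i\<^sub>*, i\<^sup>!, j\<^sub>!, j\<^sup>*, j\<^sub>*\<close>, for outer terms \<open>Y\<close> (left) and
  \<open>L\<close> (right).
\<close>

definition recollement ::
  "('o1, 'm1) tricat \<Rightarrow> ('o, 'm) tricat \<Rightarrow> ('o2, 'm2) tricat \<Rightarrow>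
   ('o, 'm, 'o1, 'm1) functr \<Rightarrow> ('o1, 'm1, 'o, 'm) functr \<Rightarrow> ('o, 'm, 'o1, 'm1) functr \<Rightarrow>
   ('o2, 'm2, 'o, 'm) functr \<Rightarrow> ('o, 'm, 'o2, 'm2) functr \<Rightarrow> ('o2, 'm2, 'o, 'm) functr \<Rightarrow> bool"
  where
  "recollement Y D L i_upstar i_lostar i_upshriek j_loshriek j_upstar j_lostar \<longleftrightarrow>
     triangle_functor D Y i_upstar \<and> triangle_functor Y D i_lostar \<and>
     triangle_functor D Y i_upshriek \<and> triangle_functor L D j_loshriek \<and>
     triangle_functor D L j_upstar \<and> triangle_functor L D j_lostar \<and>
     adjoint_pair D Y i_upstar i_lostar \<and> adjoint_pair Y D i_lostar i_upshriek \<and>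
     adjoint_pair L D j_loshriek j_upstar \<and> adjoint_pair D L j_upstar j_lostar \<and>
     fully_faithful Y D i_lostar \<and> fully_faithful L D j_loshriek \<and> fully_faithful L D j_lostar \<and>
     (\<forall>X\<in>Ob L. zero_object Y (fob i_upshriek (fob j_lostar X)))"

end

theory Submission
  imports Defs
begin

text \<open>
  The idea. An object \<open>G\<close> is silting as soon as it is partial silting and its orthogonal in all degrees
  is zero (\<open>silting_criterion\<close>), so the three properties are checked for \<open>S\<close>, the sum of \<open>\<sigma>'\<close> and \<open>\<sigma>\<close>.

  The criterion needs small coproducts and small Hom sets, but no compactness of \<open>G\<close>. Given \<open>X\<close>,
  one kills the maps from \<open>G\<close>, \<open>G[1]\<close>, \<open>G[2]\<close> and so on, one degree after the other, by passing to cones of precovers by coproducts of shifted copies of \<open>G\<close>, and takes the homotopy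
  colimit \<open>H\<close>. The cone of the map from the \<open>m\<close>-th term of the sequence to a later one lies in
  \<open>G\<^bsup>\<bottom>>0\<^esup>[m + 1]\<close>, a class closed under coproducts and extensions. Comparing the sequence with the one
  that stops at \<open>m\<close>, one finds that every map from \<open>G[k]\<close> to \<open>H\<close> with \<open>k \<le> m\<close> factors through the \<open>m\<close>-th
  term (\<open>hom_surj_H\<close>). So there are no such maps for \<open>k \<ge> 0\<close>. The same comparison for \<open>m = 0\<close> shows
  that the cocone of \<open>X \<rightarrow> H\<close> lies in \<open>G\<^bsup>\<bottom>>0\<^esup>\<close>, and also \<open>H\<close> does if \<open>X\<close> does. In the latter case \<open>H = 0\<close>,
  and since maps to an object of \<open>G\<^bsup>\<bottom>\<le>0\<^esup>\<close> extend along the sequence to \<open>H\<close>, there are no such maps from \<open>X\<close>.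

  Now let \<open>A = j\<^sub>*\<omega>\<close> and let \<open>B\<close> be the orthogonal of \<open>\<omega>\<close> in all degrees. From \<open>i\<^sup>!j\<^sub>* = 0\<close> there are no
  maps from \<open>B\<close> to \<open>A\<close>, and the adjunctions give a map \<open>\<omega> \<rightarrow> A\<close> with cone in \<open>B\<close>
  (\<open>adjoint_triple_unit\<close>, \<open>cone_in_perp\<close>); therefore \<open>Hom(A, A[k]) = Hom(\<omega>, \<omega>[k]) = 0\<close> for \<open>k > 0\<close>. With
  the vanishing of \<open>Hom(A, \<sigma>[k])\<close> for \<open>k \<ge> 2\<close> and the preenvelope property for \<open>k = 1\<close>, the triangle of
  \<open>\<sigma>'\<close> shows that \<open>S\<close> has no positive self-extensions. For the closure of \<open>S\<^bsup>\<bottom>>0\<^esup>\<close> under coproducts, a map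
  from \<open>\<sigma>'\<close> to a shifted coproduct vanishes on the sum of copies of \<open>\<sigma>\<close>, hence factors through \<open>A\<close>,
  and compactness of \<open>A\<close> reduces its vanishing to the single terms. Finally, if \<open>X\<close> is orthogonal to
  all shifts of \<open>S\<close>, then \<open>i\<^sup>!X\<close> is orthogonal to all shifts of \<open>\<sigma>\<close>, so it is zero and there are no maps
  from \<open>B\<close> to \<open>X\<close>. Then \<open>X\<close> is also orthogonal to the shifts of \<open>A\<close> and of \<open>\<omega>\<close>, whence \<open>X\<close> lies in \<open>B\<close> and
  is zero. The lemma \<open>silting_extension\<close> collects what follows from these facts about \<open>A\<close>, \<open>B\<close> and \<open>\<sigma>\<close>.
\<close>

section \<open>Calculus in a triangulated category\<close>

text \<open>
  Membership in a Hom set is unfolded into equations for domain and codomain (\<open>in_hom_iff\<close>), so that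
  the simplifier can check composability of morphisms by computing.
\<close>

locale triangulated =
  fixes T :: "('o, 'm) tricat" (structure)
  assumes triangulated: "triangulated_category T"
begin

abbreviation add (infixl "\<boxplus>" 65) where "f \<boxplus> g \<equiv> Add T f g"
abbreviation sub (infixl "\<boxminus>" 65) where "f \<boxminus> g \<equiv> Add T f (neg T g)"

lemma additive: "additive_category T" and shifts: "shift_functor T"
  using triangulated unfolding triangulated_category_def by blast+

lemma cat: "category T"
  using additive unfolding additive_category_def by blast

lemma in_hom_iff: "f \<in> Hom T X Y \<longleftrightarrow> f \<in> Arr T \<and> Dom T f = X \<and> Cod T f = Y"
  by (auto simp: Hom_def)

lemma dom_ob [simp]: "f \<in> Arr T \<Longrightarrow> Dom T f \<in> Ob T"
  and cod_ob [simp]: "f \<in> Arr T \<Longrightarrow> Cod T f \<in> Ob T"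
  using cat unfolding category_def by auto

lemma hom_ob: "f \<in> Hom T X Y \<Longrightarrow> X \<in> Ob T \<and> Y \<in> Ob T"
  by (auto simp: in_hom_iff)

lemma ide_hom: "X \<in> Ob T \<Longrightarrow> Ide T X \<in> Hom T X X"
  using cat unfolding category_def by blast

lemma ide_simps [simp]:
  assumes "X \<in> Ob T"
  shows "Ide T X \<in> Arr T" "Dom T (Ide T X) = X" "Cod T (Ide T X) = X"
  using ide_hom[OF assms] by (auto simp: in_hom_iff)

lemma comp_hom: "f \<in> Hom T X Y \<Longrightarrow> g \<in> Hom T Y Z \<Longrightarrow> g \<cdot> f \<in> Hom T X Z"
  using cat unfolding category_def by blast

lemma comp_simps [simp]:
  assumes "f \<in> Arr T" "g \<in> Arr T" "Dom T g = Cod T f"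
  shows "g \<cdot> f \<in> Arr T" "Dom T (g \<cdot> f) = Dom T f" "Cod T (g \<cdot> f) = Cod T g"
  using comp_hom[of f "Dom T f" "Cod T f" g "Cod T g"] assms by (auto simp: in_hom_iff)

lemma comp_ide [simp]: "f \<in> Arr T \<Longrightarrow> Dom T f = X \<Longrightarrow> f \<cdot> Ide T X = f"
  and ide_comp [simp]: "f \<in> Arr T \<Longrightarrow> Cod T f = X \<Longrightarrow> Ide T X \<cdot> f = f"
  using cat unfolding category_def by (auto simp: in_hom_iff)

lemma comp_assoc:
  assumes "f \<in> Arr T" "g \<in> Arr T" "h \<in> Arr T" "Dom T g = Cod T f" "Dom T h = Cod T g"
  shows "(h \<cdot> g) \<cdot> f = h \<cdot> (g \<cdot> f)"
proof -
  have "f \<in> Hom T (Dom T f) (Cod T f)" "g \<in> Hom T (Cod T f) (Cod T g)" "h \<in> Hom T (Cod T g) (Cod T h)"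
    using assms by (auto simp: in_hom_iff)
  then show ?thesis using cat unfolding category_def by metis
qed

lemma hom_comm_group: "X \<in> Ob T \<Longrightarrow> Y \<in> Ob T \<Longrightarrow> comm_group (hom_group T X Y)"
  using additive unfolding additive_category_def by blast

lemma zero_simps [simp]:
  assumes "X \<in> Ob T" "Y \<in> Ob T"
  shows "Zero T X Y \<in> Arr T" "Dom T (Zero T X Y) = X" "Cod T (Zero T X Y) = Y"
proof -
  interpret comm_group "hom_group T X Y" using hom_comm_group assms by blast
  show "Zero T X Y \<in> Arr T" "Dom T (Zero T X Y) = X" "Cod T (Zero T X Y) = Y"
    using one_closed by (auto simp: hom_group_def in_hom_iff)
qed

lemma add_simps [simp]:
  assumes "f \<in> Arr T" "g \<in> Arr T" "Dom T f = Dom T g" "Cod T f = Cod T g"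
  shows "f \<boxplus> g \<in> Arr T" "Dom T (f \<boxplus> g) = Dom T g" "Cod T (f \<boxplus> g) = Cod T g"
proof -
  interpret comm_group "hom_group T (Dom T g) (Cod T g)" using hom_comm_group assms by simp
  show "f \<boxplus> g \<in> Arr T" "Dom T (f \<boxplus> g) = Dom T g" "Cod T (f \<boxplus> g) = Cod T g"
    using m_closed[of f g] assms by (auto simp: hom_group_def in_hom_iff)
qed

lemma neg_simps [simp]:
  assumes "f \<in> Arr T"
  shows "neg T f \<in> Arr T" "Dom T (neg T f) = Dom T f" "Cod T (neg T f) = Cod T f"
proof -
  interpret comm_group "hom_group T (Dom T f) (Cod T f)" using hom_comm_group assms by simp
  show "neg T f \<in> Arr T" "Dom T (neg T f) = Dom T f" "Cod T (neg T f) = Cod T f"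
    using inv_closed[of f] assms by (auto simp: hom_group_def in_hom_iff neg_def)
qed

lemma add_zero [simp]:
  assumes "f \<in> Arr T" "Dom T f = X" "Cod T f = Y"
  shows "f \<boxplus> Zero T X Y = f" "Zero T X Y \<boxplus> f = f"
proof -
  interpret comm_group "hom_group T X Y" using hom_comm_group assms by auto
  show "f \<boxplus> Zero T X Y = f" "Zero T X Y \<boxplus> f = f"
    using r_one[of f] l_one[of f] assms by (auto simp: hom_group_def in_hom_iff)
qed

lemma add_comm:
  assumes "f \<in> Hom T X Y" "g \<in> Hom T X Y"
  shows "f \<boxplus> g = g \<boxplus> f"
proof -
  interpret comm_group "hom_group T X Y" using hom_comm_group hom_ob assms by auto
  show ?thesis using m_comm[of f g] assms by (auto simp: hom_group_def)
qed

lemma add_assoc: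
  assumes "f \<in> Hom T X Y" "g \<in> Hom T X Y" "h \<in> Hom T X Y"
  shows "(f \<boxplus> g) \<boxplus> h = f \<boxplus> (g \<boxplus> h)"
proof -
  interpret comm_group "hom_group T X Y" using hom_comm_group hom_ob assms by auto
  show ?thesis using m_assoc[of f g h] assms by (auto simp: hom_group_def)
qed

lemma sub_self [simp]:
  assumes "f \<in> Arr T"
  shows "f \<boxminus> f = Zero T (Dom T f) (Cod T f)"
proof -
  interpret comm_group "hom_group T (Dom T f) (Cod T f)" using hom_comm_group assms by simp
  show ?thesis using r_inv[of f] assms by (auto simp: hom_group_def in_hom_iff neg_def)
qed

lemma add_left_cancel:
  assumes "f \<in> Hom T X Y" "g \<in> Hom T X Y" "h \<in> Hom T X Y" "f \<boxplus> g = f \<boxplus> h"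
  shows "g = h"
proof -
  interpret comm_group "hom_group T X Y" using hom_comm_group hom_ob assms by auto
  show ?thesis using Units_l_cancel[of f g h] Units_eq assms by (auto simp: hom_group_def)
qed

lemma neg_hom: "f \<in> Hom T X Y \<Longrightarrow> neg T f \<in> Hom T X Y"
  and add_hom: "f \<in> Hom T X Y \<Longrightarrow> g \<in> Hom T X Y \<Longrightarrow> f \<boxplus> g \<in> Hom T X Y"
  by (auto simp: in_hom_iff)

lemma zero_hom: "X \<in> Ob T \<Longrightarrow> Y \<in> Ob T \<Longrightarrow> Zero T X Y \<in> Hom T X Y"
  by (auto simp: in_hom_iff)

lemma sub_eq_zeroD:
  assumes "f \<in> Hom T X Y" "g \<in> Hom T X Y" "f \<boxminus> g = Zero T X Y"
  shows "f = g"
proof -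
  have "neg T g \<boxplus> f = neg T g \<boxplus> g"
    using assms add_comm neg_hom sub_self[of g] by (metis in_hom_iff)
  then show ?thesis using add_left_cancel neg_hom assms by blast
qed

lemma add_sub_cancel:
  assumes "f \<in> Hom T X Y" "g \<in> Hom T X Y"
  shows "g \<boxplus> (f \<boxminus> g) = f"
proof -
  have "g \<boxplus> (f \<boxminus> g) = g \<boxplus> (neg T g \<boxplus> f)" using assms add_comm neg_hom by metis
  also have "\<dots> = (g \<boxminus> g) \<boxplus> f" using add_assoc[of g X Y "neg T g" f] assms neg_hom by auto
  also have "\<dots> = f" using assms by (simp add: in_hom_iff)
  finally show ?thesis .
qed

lemma comp_add:
  assumes "f \<in> Hom T X Y" "f' \<in> Hom T X Y" "g \<in> Hom T Y Z"
  shows "g \<cdot> (f \<boxplus> f') = g \<cdot> f \<boxplus> g \<cdot> f'"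
  using additive assms unfolding additive_category_def by blast

lemma add_comp:
  assumes "f \<in> Hom T X Y" "g \<in> Hom T Y Z" "g' \<in> Hom T Y Z"
  shows "(g \<boxplus> g') \<cdot> f = g \<cdot> f \<boxplus> g' \<cdot> f"
  using additive assms unfolding additive_category_def by blast

lemma comp_zero [simp]:
  assumes "g \<in> Arr T" "Dom T g = Y" "X \<in> Ob T"
  shows "g \<cdot> Zero T X Y = Zero T X (Cod T g)"
proof -
  let ?z = "Zero T X Y"
  have Y: "Y \<in> Ob T" using assms by auto
  then have "g \<cdot> ?z = g \<cdot> (?z \<boxplus> ?z)" using assms by simp
  also have "\<dots> = g \<cdot> ?z \<boxplus> g \<cdot> ?z"
    by (rule comp_add) (use assms Y in \<open>auto simp: in_hom_iff\<close>)
  finally have "g \<cdot> ?z \<boxplus> g \<cdot> ?z = g \<cdot> ?z \<boxplus> Zero T X (Cod T g)" using assms Y by simp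
  then show ?thesis
    by (rule add_left_cancel[rotated 3]) (use assms Y in \<open>auto simp: in_hom_iff\<close>)
qed

lemma zero_comp [simp]:
  assumes "f \<in> Arr T" "Cod T f = Y" "Z \<in> Ob T"
  shows "Zero T Y Z \<cdot> f = Zero T (Dom T f) Z"
proof -
  let ?z = "Zero T Y Z"
  have Y: "Y \<in> Ob T" using assms by auto
  then have "?z \<cdot> f = (?z \<boxplus> ?z) \<cdot> f" using assms by simp
  also have "\<dots> = ?z \<cdot> f \<boxplus> ?z \<cdot> f"
    by (rule add_comp) (use assms Y in \<open>auto simp: in_hom_iff\<close>)
  finally have "?z \<cdot> f \<boxplus> ?z \<cdot> f = ?z \<cdot> f \<boxplus> Zero T (Dom T f) Z" using assms Y by simp
  then show ?thesis
    by (rule add_left_cancel[rotated 3]) (use assms Y in \<open>auto simp: in_hom_iff\<close>)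
qed

lemma neg_unique:
  assumes "f \<in> Hom T X Y" "g \<in> Hom T X Y" "f \<boxplus> g = Zero T X Y"
  shows "g = neg T f"
proof -
  have "f \<boxplus> g = f \<boxminus> f" using assms by (simp add: in_hom_iff)
  then show ?thesis using add_left_cancel neg_hom assms by blast
qed

lemma comp_neg [simp]:
  assumes "f \<in> Arr T" "g \<in> Arr T" "Dom T g = Cod T f"
  shows "g \<cdot> neg T f = neg T (g \<cdot> f)"
  using assms
  by (intro neg_unique[of _ "Dom T f" "Cod T g"])
     (auto simp: in_hom_iff comp_add[of f "Dom T f" "Cod T f" "neg T f" g "Cod T g", symmetric])

lemma neg_comp [simp]:
  assumes "f \<in> Arr T" "g \<in> Arr T" "Dom T g = Cod T f"
  shows "neg T g \<cdot> f = neg T (g \<cdot> f)"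
  using assms
  by (intro neg_unique[of _ "Dom T f" "Cod T g"])
     (auto simp: in_hom_iff add_comp[of f "Dom T f" "Cod T f" g "Cod T g" "neg T g", symmetric])

lemma neg_neg [simp]: "f \<in> Arr T \<Longrightarrow> neg T (neg T f) = f"
  by (rule neg_unique[of _ "Dom T f" "Cod T f", symmetric])
     (auto simp: in_hom_iff add_comm[of "neg T f" "Dom T f" "Cod T f" f])

lemma neg_zero [simp]: "X \<in> Ob T \<Longrightarrow> Y \<in> Ob T \<Longrightarrow> neg T (Zero T X Y) = Zero T X Y"
  by (rule neg_unique[of _ X Y, symmetric]) (auto simp: in_hom_iff)

lemma sh_ob [simp]: "X \<in> Ob T \<Longrightarrow> Sh T n X \<in> Ob T"
  and sh_ide [simp]: "X \<in> Ob T \<Longrightarrow> ShA T n (Ide T X) = Ide T (Sh T n X)"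
  and sh_0 [simp]: "X \<in> Ob T \<Longrightarrow> Sh T 0 X = X"
  and sha_0 [simp]: "f \<in> Arr T \<Longrightarrow> ShA T 0 f = f"
  and sh_sh [simp]: "X \<in> Ob T \<Longrightarrow> Sh T m (Sh T n X) = Sh T (m + n) X"
  and sha_sha [simp]: "f \<in> Arr T \<Longrightarrow> ShA T m (ShA T n f) = ShA T (m + n) f"
  and sha_hom: "f \<in> Hom T X Y \<Longrightarrow> ShA T n f \<in> Hom T (Sh T n X) (Sh T n Y)"
  using shifts unfolding shift_functor_def by (metis)+

lemma sha_simps [simp]:
  assumes "f \<in> Arr T"
  shows "ShA T n f \<in> Arr T" "Dom T (ShA T n f) = Sh T n (Dom T f)" "Cod T (ShA T n f) = Sh T n (Cod T f)"
  using sha_hom[of f "Dom T f" "Cod T f"] assms by (auto simp: in_hom_iff)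

lemma sha_comp:
  assumes "f \<in> Arr T" "g \<in> Arr T" "Dom T g = Cod T f"
  shows "ShA T n (g \<cdot> f) = ShA T n g \<cdot> ShA T n f"
proof -
  have "f \<in> Hom T (Dom T f) (Cod T f)" "g \<in> Hom T (Cod T f) (Cod T g)"
    using assms by (auto simp: in_hom_iff)
  then show ?thesis using shifts unfolding shift_functor_def by metis
qed

lemma sha_add:
  assumes "f \<in> Hom T X Y" "g \<in> Hom T X Y"
  shows "ShA T n (f \<boxplus> g) = ShA T n f \<boxplus> ShA T n g"
  using shifts assms unfolding shift_functor_def by metis

lemma sha_zero [simp]:
  assumes "X \<in> Ob T" "Y \<in> Ob T"
  shows "ShA T n (Zero T X Y) = Zero T (Sh T n X) (Sh T n Y)"
proof -
  let ?z = "Zero T X Y"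
  have "ShA T n ?z \<boxplus> ShA T n ?z = ShA T n (?z \<boxplus> ?z)"
    by (rule sha_add[symmetric]) (use assms in \<open>auto simp: in_hom_iff\<close>)
  then have "ShA T n ?z \<boxplus> ShA T n ?z = ShA T n ?z \<boxplus> Zero T (Sh T n X) (Sh T n Y)"
    using assms by simp
  then show ?thesis
    by (rule add_left_cancel[rotated 3]) (use assms in \<open>auto simp: in_hom_iff\<close>)
qed

lemma sha_neg [simp]:
  assumes "f \<in> Arr T"
  shows "ShA T n (neg T f) = neg T (ShA T n f)"
  using assms
  by (intro neg_unique[of _ "Sh T n (Dom T f)" "Sh T n (Cod T f)"])
     (auto simp: in_hom_iff sha_add[of f "Dom T f" "Cod T f" "neg T f", symmetric])

lemma sha_inj:
  assumes "f \<in> Hom T X Y" "g \<in> Hom T X Y" "ShA T n f = ShA T n g"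
  shows "f = g"
proof -
  have "ShA T (- n) (ShA T n f) = ShA T (- n) (ShA T n g)" using assms(3) by simp
  then show ?thesis using assms(1,2) by (simp add: in_hom_iff)
qed

lemma sha_surj:
  assumes "f \<in> Hom T (Sh T n X) (Sh T n Y)" "X \<in> Ob T" "Y \<in> Ob T"
  obtains g where "g \<in> Hom T X Y" "f = ShA T n g"
proof
  show "ShA T (- n) f \<in> Hom T X Y" "f = ShA T n (ShA T (- n) f)"
    using assms by (auto simp: in_hom_iff)
qed

text \<open>
  \<open>X\<close> and \<open>Y\<close> are orthogonal if the group \<open>Hom(X, Y)\<close> vanishes; as the Hom set is nonempty only for
  objects, this includes that \<open>X\<close> and \<open>Y\<close> are objects (\<open>orth_ob\<close>).
\<close>

definition orth :: "'o \<Rightarrow> 'o \<Rightarrow> bool" where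
  "orth X Y \<longleftrightarrow> Hom T X Y = {Zero T X Y}"

lemma orthD: "orth X Y \<Longrightarrow> f \<in> Hom T X Y \<Longrightarrow> f = Zero T X Y"
  unfolding orth_def by blast

lemma orthI:
  assumes "X \<in> Ob T" "Y \<in> Ob T" "\<And>f. f \<in> Hom T X Y \<Longrightarrow> f = Zero T X Y"
  shows "orth X Y"
  unfolding orth_def using assms zero_hom by blast

lemma orth_ob: "orth X Y \<Longrightarrow> X \<in> Ob T \<and> Y \<in> Ob T"
  unfolding orth_def using hom_ob by blast

lemma orth_sh_sh:
  assumes "X \<in> Ob T" "Y \<in> Ob T" "orth (Sh T n X) (Sh T n Y)"
  shows "orth X Y"
proof (rule orthI)
  fix f assume f: "f \<in> Hom T X Y"
  have "ShA T n f = ShA T n (Zero T X Y)"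
    using orthD[OF assms(3) sha_hom[OF f]] assms by simp
  then show "f = Zero T X Y" using sha_inj f zero_hom assms by blast
qed (use assms in auto)

lemma orth_sh_iff:
  assumes "X \<in> Ob T" "Y \<in> Ob T"
  shows "orth (Sh T m X) (Sh T n Y) \<longleftrightarrow> orth (Sh T (m - n) X) Y"
  using orth_sh_sh[of "Sh T m X" "Sh T n Y" "- n"] orth_sh_sh[of "Sh T (m - n) X" Y n] assms
  by (auto simp: algebra_simps)

lemma orth_sh_right:
  assumes "X \<in> Ob T" "Y \<in> Ob T"
  shows "orth X (Sh T n Y) \<longleftrightarrow> orth (Sh T (- n) X) Y"
  using orth_sh_iff[of X Y 0 n] assms by simp

text \<open>
  It is often convenient to shift the first argument of Hom instead of the second; a triangle in the
  second argument can then be used as it stands.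
\<close>

lemma perp_iff: "X \<in> Ob T \<Longrightarrow> Y \<in> perp T X I \<longleftrightarrow> Y \<in> Ob T \<and> (\<forall>i\<in>I. orth (Sh T (- i) X) Y)"
  unfolding perp_def orth_def[symmetric] using orth_sh_right by auto

lemma zero_object_orth:
  assumes "zero_object T Z" "X \<in> Ob T"
  shows "orth Z X" "orth X Z"
  using assms zero_hom unfolding zero_object_def by (auto intro!: orthI)

lemma orth_self_zero_object:
  assumes "orth Z Z"
  shows "zero_object T Z"
proof -
  have Z: "Z \<in> Ob T" using orth_ob assms by blast
  have *: "Ide T Z = Zero T Z Z" using orthD[OF assms] ide_hom Z by blast
  have "f = Zero T Z X" if "f \<in> Hom T Z X" for f X
    using comp_ide[of f Z] that * hom_ob[OF that] by (auto simp: in_hom_iff)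
  moreover have "f = Zero T X Z" if "f \<in> Hom T X Z" for f X
    using ide_comp[of f Z] that * hom_ob[OF that] by (auto simp: in_hom_iff)
  ultimately show ?thesis using Z zero_hom unfolding zero_object_def by metis
qed

lemma ex_zero: obtains Z where "zero_object T Z"
  using additive unfolding additive_category_def by blast

lemma zero_object_sh:
  assumes "zero_object T Z"
  shows "zero_object T (Sh T n Z)"
proof -
  have Z: "Z \<in> Ob T" using assms unfolding zero_object_def by blast
  then have "orth (Sh T n Z) (Sh T n Z)"
    using zero_object_orth(1)[OF assms Z] orth_sh_iff[of Z Z n n] by simp
  then show ?thesis by (rule orth_self_zero_object)
qed

lemma triangle_hom:
  assumes "triangle T X Y Z f g h"
  shows "f \<in> Hom T X Y" "g \<in> Hom T Y Z" "h \<in> Hom T Z (Sh T 1 X)"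
    "X \<in> Ob T" "Y \<in> Ob T" "Z \<in> Ob T"
  using assms unfolding triangle_def candidate_triangle_def by auto

lemma rotate_iff:
  "candidate_triangle T X Y Z f g h \<Longrightarrow>
    triangle T X Y Z f g h \<longleftrightarrow> triangle T Y Z (Sh T 1 X) g h (neg T (ShA T 1 f))"
proof -
  have "\<forall>X Y Z f g h. candidate_triangle T X Y Z f g h \<longrightarrow>
    triangle T X Y Z f g h = triangle T Y Z (Sh T 1 X) g h (neg T (ShA T 1 f))"
    using triangulated unfolding triangulated_category_def by (elim conjE)
  then show "candidate_triangle T X Y Z f g h \<Longrightarrow>
    triangle T X Y Z f g h \<longleftrightarrow> triangle T Y Z (Sh T 1 X) g h (neg T (ShA T 1 f))" by blast
qed

lemma rotate:
  "triangle T X Y Z f g h \<Longrightarrow> triangle T Y Z (Sh T 1 X) g h (neg T (ShA T 1 f))"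
  using rotate_iff unfolding triangle_def by blast

lemma triangle_ide:
  "X \<in> Ob T \<Longrightarrow> zero_object T Z \<Longrightarrow>
    triangle T X X Z (Ide T X) (Zero T X Z) (Zero T Z (Sh T 1 X))"
proof -
  have "\<forall>X\<in>Ob T. \<forall>Z. zero_object T Z \<longrightarrow>
      triangle T X X Z (Ide T X) (Zero T X Z) (Zero T Z (Sh T 1 X))"
    using triangulated unfolding triangulated_category_def by (elim conjE)
  then show "X \<in> Ob T \<Longrightarrow> zero_object T Z \<Longrightarrow>
    triangle T X X Z (Ide T X) (Zero T X Z) (Zero T Z (Sh T 1 X))" by blast
qed

lemma ex_cone:
  assumes "f \<in> Hom T X Y"
  obtains Z g h where "triangle T X Y Z f g h"
proof -
  have "\<forall>X Y. \<forall>f\<in>Hom T X Y. \<exists>Z g h. triangle T X Y Z f g h"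
    using triangulated unfolding triangulated_category_def by (elim conjE)
  then show thesis using assms that by blast
qed

lemma TR3:
  assumes "triangle T X Y Z f g h" "triangle T X' Y' Z' f' g' h'"
    "a \<in> Hom T X X'" "b \<in> Hom T Y Y'" "b \<cdot> f = f' \<cdot> a"
  obtains c where "c \<in> Hom T Z Z'" "c \<cdot> g = g' \<cdot> b" "ShA T 1 a \<cdot> h = h' \<cdot> c"
proof -
  have "\<forall>X Y Z X' Y' Z' f g h f' g' h'. \<forall>a\<in>Hom T X X'. \<forall>b\<in>Hom T Y Y'.
        triangle T X Y Z f g h \<and> triangle T X' Y' Z' f' g' h' \<and> b \<cdot> f = f' \<cdot> a \<longrightarrow>
        (\<exists>c\<in>Hom T Z Z'. c \<cdot> g = g' \<cdot> b \<and> ShA T 1 a \<cdot> h = h' \<cdot> c)"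
    using triangulated unfolding triangulated_category_def by (elim conjE)
  then show thesis using assms that by blast
qed

lemma TR4:
  assumes "triangle T X Y Z' f f' f''" "triangle T Y Z X' g g' g''"
    "triangle T X Z Y' (g \<cdot> f) h' h''"
  obtains u v w where "triangle T Z' Y' X' u v w"
proof -
  have "\<forall>X Y Z X' Y' Z' f g f' f'' g' g'' h' h''.
        triangle T X Y Z' f f' f'' \<and> triangle T Y Z X' g g' g'' \<and>
        triangle T X Z Y' (g \<cdot> f) h' h'' \<longrightarrow>
        (\<exists>u v. triangle T Z' Y' X' u v (ShA T 1 f' \<cdot> g'') \<and>
           u \<cdot> f' = h' \<cdot> g \<and> v \<cdot> h' = g' \<and>
           h'' \<cdot> u = f'' \<and> g'' \<cdot> v = ShA T 1 f \<cdot> h'')"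
    using triangulated unfolding triangulated_category_def by (elim conjE)
  then show thesis using assms that by blast
qed

lemma triangle_comp_zero1:
  assumes t: "triangle T X Y Z f g h"
  shows "g \<cdot> f = Zero T X Z"
proof -
  note h = triangle_hom[OF t]
  obtain N where N: "zero_object T N" by (rule ex_zero)
  then have NO: "N \<in> Ob T" unfolding zero_object_def by blast
  have f: "f \<in> Hom T X Y" using h by blast
  have e: "f \<cdot> Ide T X = f \<cdot> Ide T X" ..
  obtain c where c: "c \<in> Hom T N Z" "c \<cdot> Zero T X N = g \<cdot> f"
    by (rule TR3[OF triangle_ide[OF h(4) N] t ide_hom[OF h(4)] f e])
  then show ?thesis using h NO by (simp add: in_hom_iff)
qed

lemma triangle_comp_zero2: "triangle T X Y Z f g h \<Longrightarrow> h \<cdot> g = Zero T Y (Sh T 1 X)"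
  using triangle_comp_zero1 rotate by blast

lemma triangle_comp_zero3:
  assumes "triangle T X Y Z f g h"
  shows "ShA T 1 f \<cdot> h = Zero T Z (Sh T 1 Y)"
proof -
  note h = triangle_hom[OF assms]
  have "neg T (ShA T 1 f) \<cdot> h = Zero T Z (Sh T 1 Y)"
    using triangle_comp_zero2 rotate assms by blast
  then have "neg T (ShA T 1 f \<cdot> h) = Zero T Z (Sh T 1 Y)" using h by (simp add: in_hom_iff)
  then have "neg T (neg T (ShA T 1 f \<cdot> h)) = neg T (Zero T Z (Sh T 1 Y))" by simp
  then show ?thesis using h by (simp add: in_hom_iff)
qed

text \<open>
  In a triangle each morphism is a weak cokernel of its predecessor and a weak kernel of its
  successor, that is, \<open>Hom(-, Q)\<close> and \<open>Hom(Q, -)\<close> are exact.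
\<close>

lemma weak_coker1:
  assumes t: "triangle T X Y Z f g h" and a: "a \<in> Hom T Y Q" "a \<cdot> f = Zero T X Q"
  obtains b where "b \<in> Hom T Z Q" "a = b \<cdot> g"
proof -
  note h = triangle_hom[OF t]
  have Q: "Q \<in> Ob T" using a hom_ob by blast
  obtain N where N: "zero_object T N" by (rule ex_zero)
  then have NO: "N \<in> Ob T" unfolding zero_object_def by blast
  \<comment> \<open>compare with the triangle \<open>0 \<rightarrow> Q \<rightarrow> Q \<rightarrow> 0\<close>\<close>
  have "triangle T Q Q (Sh T 1 N) (Ide T Q) (Zero T Q (Sh T 1 N)) (Zero T (Sh T 1 N) (Sh T 1 Q))"
    using triangle_ide[OF Q zero_object_sh[OF N]] .
  then have "triangle T N Q Q (Zero T N Q) (Ide T Q) (Zero T Q (Sh T 1 N))"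
    using NO Q by (subst rotate_iff) (auto simp: candidate_triangle_def in_hom_iff)
  then obtain b where "b \<in> Hom T Z Q" "b \<cdot> g = Ide T Q \<cdot> a"
    using TR3[OF t, of N Q Q "Zero T N Q" "Ide T Q" "Zero T Q (Sh T 1 N)" "Zero T X N" a] a h NO Q
    by (auto simp: in_hom_iff)
  then show thesis using that[of b] a by (auto simp: in_hom_iff)
qed

lemma weak_coker2:
  assumes t: "triangle T X Y Z f g h" and a: "a \<in> Hom T Z Q" "a \<cdot> g = Zero T Y Q"
  obtains b where "b \<in> Hom T (Sh T 1 X) Q" "a = b \<cdot> h"
  using weak_coker1[OF rotate[OF t]] a by blast

lemma weak_coker3:
  assumes t: "triangle T X Y Z f g h" and a: "a \<in> Hom T (Sh T 1 X) Q" "a \<cdot> h = Zero T Z Q"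
  obtains b where "b \<in> Hom T (Sh T 1 Y) Q" "a = b \<cdot> ShA T 1 f"
proof -
  note h = triangle_hom[OF t]
  obtain b where b: "b \<in> Hom T (Sh T 1 Y) Q" "a = b \<cdot> neg T (ShA T 1 f)"
    using weak_coker1[OF rotate[OF rotate[OF t]]] a by blast
  show thesis
    by (rule that[of "neg T b"]) (use b h in \<open>auto simp: in_hom_iff\<close>)
qed

lemma weak_ker1:
  assumes t: "triangle T X Y Z f g h" and a: "a \<in> Hom T Q Y" "g \<cdot> a = Zero T Q Z"
  obtains b where "b \<in> Hom T Q X" "a = f \<cdot> b"
proof -
  note h = triangle_hom[OF t]
  have Q: "Q \<in> Ob T" using a hom_ob by blast
  obtain N where N: "zero_object T N" by (rule ex_zero)
  then have NO: "N \<in> Ob T" unfolding zero_object_def by blast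
  \<comment> \<open>map the triangle \<open>Q \<rightarrow> 0 \<rightarrow> Q[1] \<rightarrow> Q[1]\<close> to the rotated triangle \<open>Y \<rightarrow> Z \<rightarrow> X[1] \<rightarrow> Y[1]\<close>\<close>
  obtain c where c: "c \<in> Hom T (Sh T 1 Q) (Sh T 1 X)"
    "ShA T 1 a \<cdot> neg T (ShA T 1 (Ide T Q)) = neg T (ShA T 1 f) \<cdot> c"
    using TR3[OF rotate[OF triangle_ide[OF Q N]] rotate[OF t], of a "Zero T N Z"] a h NO Q
    by (auto simp: in_hom_iff)
  then obtain b where b: "b \<in> Hom T Q X" "c = ShA T 1 b" using sha_surj Q h by blast
  have "neg T (ShA T 1 a) = neg T (ShA T 1 f \<cdot> ShA T 1 b)"
    using c b a h Q by (simp add: in_hom_iff)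
  then have "neg T (neg T (ShA T 1 a)) = neg T (neg T (ShA T 1 f \<cdot> ShA T 1 b))" by simp
  then have "ShA T 1 a = ShA T 1 (f \<cdot> b)" using a b h by (simp add: in_hom_iff sha_comp)
  then have "a = f \<cdot> b" using sha_inj[of a Q Y "f \<cdot> b"] a b h by (auto simp: in_hom_iff)
  then show thesis using that b by blast
qed

lemma weak_ker2:
  assumes t: "triangle T X Y Z f g h" and a: "a \<in> Hom T Q Z" "h \<cdot> a = Zero T Q (Sh T 1 X)"
  obtains b where "b \<in> Hom T Q Y" "a = g \<cdot> b"
  using weak_ker1[OF rotate[OF t]] a by blast

lemma weak_ker3:
  assumes t: "triangle T X Y Z f g h"
    and a: "a \<in> Hom T Q (Sh T 1 X)" "ShA T 1 f \<cdot> a = Zero T Q (Sh T 1 Y)"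
  obtains b where "b \<in> Hom T Q Z" "a = h \<cdot> b"
proof -
  note h = triangle_hom[OF t]
  have "neg T (ShA T 1 f) \<cdot> a = Zero T Q (Sh T 1 Y)"
    using a h hom_ob[OF a(1)] by (simp add: in_hom_iff)
  then show thesis using weak_ker1[OF rotate[OF rotate[OF t]]] a that by blast
qed

lemma orth_mid_right:
  assumes t: "triangle T X Y Z f g h" and "orth Q X" "orth Q Z"
  shows "orth Q Y"
proof (rule orthI)
  note h = triangle_hom[OF t]
  show "Q \<in> Ob T" "Y \<in> Ob T" using assms orth_ob h by auto
  fix a assume a: "a \<in> Hom T Q Y"
  have "g \<cdot> a = Zero T Q Z" using orthD[OF assms(3)] comp_hom a h by blast
  then obtain b where b: "b \<in> Hom T Q X" "a = f \<cdot> b" using weak_ker1[OF t a] by blast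
  have "b = Zero T Q X" using orthD assms(2) b by blast
  then show "a = Zero T Q Y" using b h \<open>Q \<in> Ob T\<close> by (simp add: in_hom_iff)
qed

lemma orth_mid_left:
  assumes t: "triangle T X Y Z f g h" and "orth X Q" "orth Z Q"
  shows "orth Y Q"
proof (rule orthI)
  note h = triangle_hom[OF t]
  show "Y \<in> Ob T" "Q \<in> Ob T" using assms orth_ob h by auto
  fix a assume a: "a \<in> Hom T Y Q"
  have "a \<cdot> f = Zero T X Q" using orthD[OF assms(2)] comp_hom a h by blast
  then obtain b where b: "b \<in> Hom T Z Q" "a = b \<cdot> g" using weak_coker1[OF t a] by blast
  have "b = Zero T Z Q" using orthD assms(3) b by blast
  then show "a = Zero T Y Q" using b h \<open>Q \<in> Ob T\<close> by (simp add: in_hom_iff)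
qed

lemma orth_cone_right: "triangle T X Y Z f g h \<Longrightarrow> orth Q Y \<Longrightarrow> orth Q (Sh T 1 X) \<Longrightarrow> orth Q Z"
  using orth_mid_right rotate by blast

lemma orth_cone_left: "triangle T X Y Z f g h \<Longrightarrow> orth Y Q \<Longrightarrow> orth (Sh T 1 X) Q \<Longrightarrow> orth Z Q"
  using orth_mid_left rotate by blast

lemma orth_retract_right:
  assumes "i \<in> Hom T X Y" "p \<in> Hom T Y X" "p \<cdot> i = Ide T X" "orth Q Y"
  shows "orth Q X"
proof (rule orthI)
  show o: "Q \<in> Ob T" "X \<in> Ob T" using assms orth_ob hom_ob by auto
  fix f assume f: "f \<in> Hom T Q X"
  have "f = p \<cdot> (i \<cdot> f)" using f assms comp_assoc[of f i p] by (simp add: in_hom_iff)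
  also have "i \<cdot> f = Zero T Q Y" using orthD[OF assms(4)] comp_hom f assms by blast
  finally show "f = Zero T Q X" using assms o by (simp add: in_hom_iff)
qed

lemma orth_retract_left:
  assumes "i \<in> Hom T X Y" "p \<in> Hom T Y X" "p \<cdot> i = Ide T X" "orth Y Q"
  shows "orth X Q"
proof (rule orthI)
  show o: "X \<in> Ob T" "Q \<in> Ob T" using assms orth_ob hom_ob by auto
  fix f assume f: "f \<in> Hom T X Q"
  have "f = (f \<cdot> p) \<cdot> i" using f assms comp_assoc[of i p f] by (simp add: in_hom_iff)
  also have "f \<cdot> p = Zero T Y Q" using orthD[OF assms(4)] comp_hom f assms by blast
  finally show "f = Zero T X Q" using assms o by (simp add: in_hom_iff)
qed

end

section \<open>Coproducts\<close>

lemma coproduct_inj: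
  "is_coproduct T I A C \<iota> \<Longrightarrow> i \<in> I \<Longrightarrow> \<iota> i \<in> Hom T (A i) C"
  and coproduct_ob: "is_coproduct T I A C \<iota> \<Longrightarrow> C \<in> Ob T"
  and coproduct_comp_ob: "is_coproduct T I A C \<iota> \<Longrightarrow> i \<in> I \<Longrightarrow> A i \<in> Ob T"
  unfolding is_coproduct_def by auto

lemma coproduct_induced:
  assumes "is_coproduct T I A C \<iota>" "Z \<in> Ob T" "\<And>i. i \<in> I \<Longrightarrow> f i \<in> Hom T (A i) Z"
  obtains u where "u \<in> Hom T C Z" "\<And>i. i \<in> I \<Longrightarrow> Cmp T u (\<iota> i) = f i"
  using assms unfolding is_coproduct_def by metis

lemma coproduct_reindex:
  assumes h: "bij_betw h J I" and c: "is_coproduct T I A C \<iota>"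
  shows "is_coproduct T J (A \<circ> h) C (\<iota> \<circ> h)"
  unfolding is_coproduct_def
proof (intro conjI ballI allI impI)
  have hI: "h j \<in> I" if "j \<in> J" for j using h that bij_betwE by blast
  show "(A \<circ> h) j \<in> Ob T" "(\<iota> \<circ> h) j \<in> Hom T ((A \<circ> h) j) C" if "j \<in> J" for j
    using c hI[OF that] unfolding is_coproduct_def by auto
  show "C \<in> Ob T" using c coproduct_ob by metis
  fix Z f assume Z: "Z \<in> Ob T" and f: "\<forall>j\<in>J. f j \<in> Hom T ((A \<circ> h) j) Z"
  let ?k = "the_inv_into J h"
  have k: "?k (h j) = j" if "j \<in> J" for j
    using h that unfolding bij_betw_def by (simp add: the_inv_into_f_f)
  have "\<forall>i\<in>I. \<exists>j\<in>J. i = h j" using h unfolding bij_betw_def by blast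
  then have "\<forall>i\<in>I. (f \<circ> ?k) i \<in> Hom T (A i) Z" using f k by fastforce
  then have "\<exists>!u. u \<in> Hom T C Z \<and> (\<forall>i\<in>I. Cmp T u (\<iota> i) = (f \<circ> ?k) i)"
    using c Z unfolding is_coproduct_def by blast
  moreover have "(\<forall>i\<in>I. Cmp T u (\<iota> i) = (f \<circ> ?k) i) \<longleftrightarrow>
      (\<forall>j\<in>J. Cmp T u ((\<iota> \<circ> h) j) = f j)" for u
    using k hI \<open>\<forall>i\<in>I. \<exists>j\<in>J. i = h j\<close> by fastforce
  ultimately show "\<exists>!u. u \<in> Hom T C Z \<and> (\<forall>j\<in>J. Cmp T u ((\<iota> \<circ> h) j) = f j)" by simp
qed

text \<open>
  Coproducts are provided only for families indexed by small sets over the type of the universe. As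
  every small set is in bijection with such a set, index sets of any type are possible.
\<close>

lemma small_reindex:
  fixes U :: "'u set"
  assumes "small U I"
  obtains J :: "'u set" and h where "small U J" "bij_betw h J I"
proof -
  from assms have "I \<lesssim> U" unfolding small_def lesspoll_def by blast
  then obtain k where k: "inj_on k I" "k ` I \<subseteq> U" unfolding lepoll_def by blast
  then have b: "bij_betw k I (k ` I)" by (simp add: bij_betw_def)
  then have e: "k ` I \<approx> I" using eqpoll_def eqpoll_sym by blast
  then have "small U (k ` I)"
    using assms unfolding small_def using eq_lesspoll_trans by blast
  then show thesis using that bij_betw_inv_into[OF b] by blast
qed

lemma has_coproducts_any:
  fixes U :: "'u set"
  assumes "has_coproducts U T" "small U I" "\<And>i. i \<in> I \<Longrightarrow> A i \<in> Ob T"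
  obtains C \<iota> where "is_coproduct T I A C \<iota>"
proof -
  obtain J :: "'u set" and h where J: "small U J" "bij_betw h J I"
    by (rule small_reindex[OF assms(2)])
  have "\<forall>j\<in>J. (A \<circ> h) j \<in> Ob T" using assms(3) bij_betwE[OF J(2)] by simp
  then obtain C \<iota> where c: "is_coproduct T J (A \<circ> h) C \<iota>"
    using assms(1) J(1) unfolding has_coproducts_def by blast
  let ?k = "the_inv_into J h"
  have "is_coproduct T I (A \<circ> h \<circ> ?k) C (\<iota> \<circ> ?k)"
    by (rule coproduct_reindex[OF bij_betw_the_inv_into[OF J(2)] c])
  moreover have "(A \<circ> h \<circ> ?k) i = A i" if "i \<in> I" for i
    using J(2) that unfolding bij_betw_def by (simp add: f_the_inv_into_f)
  ultimately have "is_coproduct T I A C (\<iota> \<circ> ?k)" unfolding is_coproduct_def by simp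
  then show thesis by (rule that)
qed

lemma closed_under_coproducts_any:
  fixes U :: "'u set"
  assumes "closed_under_coproducts U T S" "small U I" "\<And>i. i \<in> I \<Longrightarrow> A i \<in> S"
    "is_coproduct T I A C \<iota>"
  shows "C \<in> S"
proof -
  obtain J :: "'u set" and h where J: "small U J" "bij_betw h J I"
    by (rule small_reindex[OF assms(2)])
  have "is_coproduct T J (A \<circ> h) C (\<iota> \<circ> h)" by (rule coproduct_reindex[OF J(2) assms(4)])
  moreover have "\<forall>j\<in>J. (A \<circ> h) j \<in> S" using assms(3) bij_betwE[OF J(2)] by simp
  ultimately show ?thesis using assms(1) J(1) unfolding closed_under_coproducts_def by blast
qed

lemma hom_full_sub:
  assumes "X \<in> S" "Y \<in> S"
  shows "Hom (full_sub T S) X Y = Hom T X Y"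
  using assms unfolding Hom_def full_sub_def Let_def by auto

lemma full_sub_simps [simp]:
  "Ob (full_sub T S) = S" "Cmp (full_sub T S) = Cmp T" "Ide (full_sub T S) = Ide T"
  "Zero (full_sub T S) = Zero T" "Sh (full_sub T S) = Sh T"
  unfolding full_sub_def Let_def by auto

context triangulated
begin

lemma coproduct_ext:
  assumes "is_coproduct T I A C \<iota>" "u \<in> Hom T C Z" "v \<in> Hom T C Z"
    "\<And>i. i \<in> I \<Longrightarrow> u \<cdot> \<iota> i = v \<cdot> \<iota> i"
  shows "u = v"
proof -
  have "\<forall>Z\<in>Ob T. \<forall>f. (\<forall>i\<in>I. f i \<in> Hom T (A i) Z) \<longrightarrow>
        (\<exists>!u. u \<in> Hom T C Z \<and> (\<forall>i\<in>I. u \<cdot> \<iota> i = f i))"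
    using assms(1) unfolding is_coproduct_def by blast
  moreover have "\<forall>i\<in>I. u \<cdot> \<iota> i \<in> Hom T (A i) Z"
    using coproduct_inj[OF assms(1)] comp_hom assms(2) by blast
  moreover have "Z \<in> Ob T" using hom_ob assms(2) by blast
  ultimately have "\<exists>!w. w \<in> Hom T C Z \<and> (\<forall>i\<in>I. w \<cdot> \<iota> i = u \<cdot> \<iota> i)" by simp
  then show ?thesis using assms by metis
qed

lemma coproduct_zero:
  assumes "is_coproduct T I A C \<iota>" "u \<in> Hom T C Z"
    "\<And>i. i \<in> I \<Longrightarrow> u \<cdot> \<iota> i = Zero T (A i) Z"
  shows "u = Zero T C Z"
proof (rule coproduct_ext[OF assms(1,2)])
  show "Zero T C Z \<in> Hom T C Z" using zero_hom hom_ob assms(2) by blast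
  show "u \<cdot> \<iota> i = Zero T C Z \<cdot> \<iota> i" if "i \<in> I" for i
    using assms coproduct_inj[OF assms(1) that] that hom_ob[OF assms(2)] by (auto simp: in_hom_iff)
qed

lemma orth_coproduct:
  assumes "is_coproduct T I A C \<iota>" "V \<in> Ob T" "\<And>i. i \<in> I \<Longrightarrow> orth (A i) V"
  shows "orth C V"
proof (rule orthI)
  fix f assume f: "f \<in> Hom T C V"
  show "f = Zero T C V"
    by (rule coproduct_zero[OF assms(1) f])
      (use orthD[OF assms(3)] comp_hom f coproduct_inj[OF assms(1)] in blast)
qed (use assms coproduct_ob in auto)

lemma coproduct_shift:
  assumes c: "is_coproduct T I A C \<iota>"
  shows "is_coproduct T I (\<lambda>i. Sh T n (A i)) (Sh T n C) (\<lambda>i. ShA T n (\<iota> i))"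
  unfolding is_coproduct_def
proof (intro conjI ballI allI impI)
  note C = coproduct_ob[OF c] and Ai = coproduct_comp_ob[OF c] and \<iota> = coproduct_inj[OF c]
  show "Sh T n C \<in> Ob T" using C by simp
  show "Sh T n (A i) \<in> Ob T" "ShA T n (\<iota> i) \<in> Hom T (Sh T n (A i)) (Sh T n C)" if "i \<in> I" for i
    using Ai[OF that] sha_hom[OF \<iota>[OF that]] by auto
  fix Z f assume Z: "Z \<in> Ob T" and f: "\<forall>i\<in>I. f i \<in> Hom T (Sh T n (A i)) Z"
  show "\<exists>!u. u \<in> Hom T (Sh T n C) Z \<and> (\<forall>i\<in>I. u \<cdot> ShA T n (\<iota> i) = f i)"
  proof (rule ex_ex1I)
    have "ShA T (- n) (f i) \<in> Hom T (A i) (Sh T (- n) Z)" if "i \<in> I" for i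
      using sha_hom[of "f i" "Sh T n (A i)" Z "- n"] f that Ai[OF that] by simp
    then obtain u where u: "u \<in> Hom T C (Sh T (- n) Z)"
      "\<And>i. i \<in> I \<Longrightarrow> u \<cdot> \<iota> i = ShA T (- n) (f i)"
      using coproduct_induced[OF c, of "Sh T (- n) Z" "\<lambda>i. ShA T (- n) (f i)"] Z by auto
    have "ShA T n u \<cdot> ShA T n (\<iota> i) = f i" if "i \<in> I" for i
    proof -
      have "ShA T n u \<cdot> ShA T n (\<iota> i) = ShA T n (u \<cdot> \<iota> i)"
        using u(1) \<iota>[OF that] by (simp add: sha_comp in_hom_iff)
      also have "\<dots> = f i" using u(2) f that by (auto simp: in_hom_iff)
      finally show ?thesis .
    qed
    moreover have "ShA T n u \<in> Hom T (Sh T n C) Z" using sha_hom[OF u(1), of n] Z by simp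
    ultimately show "\<exists>u. u \<in> Hom T (Sh T n C) Z \<and> (\<forall>i\<in>I. u \<cdot> ShA T n (\<iota> i) = f i)" by blast
  next
    fix u v
    assume u: "u \<in> Hom T (Sh T n C) Z \<and> (\<forall>i\<in>I. u \<cdot> ShA T n (\<iota> i) = f i)"
      and v: "v \<in> Hom T (Sh T n C) Z \<and> (\<forall>i\<in>I. v \<cdot> ShA T n (\<iota> i) = f i)"
    have *: "\<exists>u'. u' \<in> Hom T C (Sh T (- n) Z) \<and> w = ShA T n u'"
      if "w \<in> Hom T (Sh T n C) Z" for w
      using sha_surj[of w n C "Sh T (- n) Z"] that C Z by auto
    obtain u' v' where uv: "u' \<in> Hom T C (Sh T (- n) Z)" "u = ShA T n u'"
       "v' \<in> Hom T C (Sh T (- n) Z)" "v = ShA T n v'" using * u v by blast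
    have "u' = v'"
    proof (rule coproduct_ext[OF c uv(1,3)])
      fix i assume i: "i \<in> I"
      have "ShA T n (u' \<cdot> \<iota> i) = ShA T n (v' \<cdot> \<iota> i)"
        using uv u v i \<iota>[OF i] by (simp add: in_hom_iff sha_comp)
      then show "u' \<cdot> \<iota> i = v' \<cdot> \<iota> i"
        by (rule sha_inj[OF comp_hom[OF \<iota>[OF i] uv(1)] comp_hom[OF \<iota>[OF i] uv(3)]])
    qed
    then show "u = v" using uv by simp
  qed
qed

lemma coproduct_retract:
  assumes c: "is_coproduct T I A C \<iota>" and i: "i \<in> I"
  obtains p where "p \<in> Hom T C (A i)" "p \<cdot> \<iota> i = Ide T (A i)"
proof -
  note Ai = coproduct_comp_ob[OF c]
  let ?f = "\<lambda>j. if j = i then Ide T (A i) else Zero T (A j) (A i)"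
  have "?f j \<in> Hom T (A j) (A i)" if "j \<in> I" for j
    using Ai[OF i] Ai[OF that] ide_hom zero_hom by auto
  then obtain p where "p \<in> Hom T C (A i)" "\<And>j. j \<in> I \<Longrightarrow> p \<cdot> \<iota> j = ?f j"
    using coproduct_induced[OF c Ai[OF i], of ?f] by blast
  then show thesis using that i by auto
qed

text \<open>
  The identity of a finite coproduct is the sum of the composites of projections and injections;
  hence it lies in every additively closed set \<open>N\<close> of endomorphisms that contains the endomorphisms
  factoring through an injection. The coproduct property is only needed for test objects in the full
  subcategory on \<open>S\<close>, and therefore a finite coproduct in the subcategory is one in \<open>T\<close>.
\<close>

lemma finite_coproduct_ide:
  assumes c: "is_coproduct (full_sub T S) I A C \<iota>" and S: "S \<subseteq> Ob T" and "finite I"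
  assumes zero: "\<And>g. g \<in> N \<Longrightarrow> g \<in> Hom T C C" "Zero T C C \<in> N"
    and add: "\<And>g h. g \<in> N \<Longrightarrow> h \<in> N \<Longrightarrow> g \<boxplus> h \<in> N"
    and comp: "\<And>i p. i \<in> I \<Longrightarrow> p \<in> Hom T C (A i) \<Longrightarrow> \<iota> i \<cdot> p \<in> N"
  shows "Ide T C \<in> N"
proof -
  have C: "C \<in> S" "C \<in> Ob T" using coproduct_ob[OF c] S by auto
  have Ai: "A i \<in> S" "A i \<in> Ob T" if "i \<in> I" for i using coproduct_comp_ob[OF c that] S by auto
  have \<iota>: "\<iota> i \<in> Hom T (A i) C" if "i \<in> I" for i
    using coproduct_inj[OF c that] hom_full_sub[of "A i" S C T] C Ai[OF that] by simp
  \<comment> \<open>\<open>e\<close> is the idempotent with image the subcoproduct over \<open>J\<close>\<close>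
  have "\<exists>e\<in>N. (\<forall>i\<in>J. e \<cdot> \<iota> i = \<iota> i) \<and> (\<forall>i\<in>I-J. e \<cdot> \<iota> i = Zero T (A i) C)"
    if "finite J" "J \<subseteq> I" for J
    using that
  proof (induction J rule: finite_induct)
    case empty
    show ?case using zero(2) \<iota> C by (intro bexI[of _ "Zero T C C"]) (auto simp: in_hom_iff)
  next
    case (insert j J)
    then obtain e where e: "e \<in> N" "\<And>i. i \<in> J \<Longrightarrow> e \<cdot> \<iota> i = \<iota> i"
       "\<And>i. i \<in> I - J \<Longrightarrow> e \<cdot> \<iota> i = Zero T (A i) C" by blast
    have j: "j \<in> I" using insert by simp
    let ?f = "\<lambda>i. if i = j then Ide T (A j) else Zero T (A i) (A j)"
    have "?f i \<in> Hom (full_sub T S) (A i) (A j)" if "i \<in> I" for i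
      using hom_full_sub[of "A i" S "A j" T] Ai[OF j] Ai[OF that] ide_hom zero_hom by auto
    then obtain p where p: "p \<in> Hom (full_sub T S) C (A j)" "\<And>i. i \<in> I \<Longrightarrow> p \<cdot> \<iota> i = ?f i"
      using coproduct_induced[OF c, of "A j" ?f] Ai[OF j] by auto
    then have pH: "p \<in> Hom T C (A j)" using hom_full_sub[of C S "A j" T] C Ai[OF j] by simp
    have jp: "\<iota> j \<cdot> p \<in> N" using comp j pH by blast
    have *: "(e \<boxplus> \<iota> j \<cdot> p) \<cdot> \<iota> i = e \<cdot> \<iota> i \<boxplus> \<iota> j \<cdot> (p \<cdot> \<iota> i)" if "i \<in> I" for i
      using add_comp[OF \<iota>[OF that] zero(1)[OF e(1)] zero(1)[OF jp]]
        comp_assoc[of "\<iota> i" p "\<iota> j"] \<iota>[OF that] \<iota>[OF j] pH by (simp add: in_hom_iff)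
    have "(e \<boxplus> \<iota> j \<cdot> p) \<cdot> \<iota> i = \<iota> i" if "i \<in> insert j J" for i
    proof -
      have i: "i \<in> I" using that insert by auto
      show ?thesis
        using *[OF i] p(2)[OF i] e(2,3)[of i] \<iota>[OF i] \<iota>[OF j] Ai[OF i] Ai[OF j] C j that insert(2)
        by (cases "i = j") (auto simp: in_hom_iff)
    qed
    moreover have "(e \<boxplus> \<iota> j \<cdot> p) \<cdot> \<iota> i = Zero T (A i) C" if "i \<in> I - insert j J" for i
    proof -
      have i: "i \<in> I" using that by auto
      show ?thesis
        using *[OF i] p(2)[OF i] e(3)[of i] \<iota>[OF i] \<iota>[OF j] Ai[OF i] Ai[OF j] C j that
        by (auto simp: in_hom_iff)
    qed
    ultimately show ?case using add[OF e(1) jp] by blast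
  qed
  from this[OF \<open>finite I\<close> subset_refl] obtain e where e: "e \<in> N" "\<And>i. i \<in> I \<Longrightarrow> e \<cdot> \<iota> i = \<iota> i"
    by blast
  have "\<forall>i\<in>I. \<iota> i \<in> Hom (full_sub T S) (A i) C" using coproduct_inj[OF c] by blast
  then have "\<exists>!u. u \<in> Hom (full_sub T S) C C \<and> (\<forall>i\<in>I. u \<cdot> \<iota> i = \<iota> i)"
    using c C unfolding is_coproduct_def by auto
  moreover have "Ide T C \<cdot> \<iota> i = \<iota> i" if "i \<in> I" for i using \<iota>[OF that] by (simp add: in_hom_iff)
  moreover have "e \<in> Hom (full_sub T S) C C" "Ide T C \<in> Hom (full_sub T S) C C"
    using hom_full_sub[of C S C T] C zero(1)[OF e(1)] ide_hom by auto
  ultimately have "e = Ide T C" using e(2) by blast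
  then show ?thesis using e(1) by simp
qed

lemma orth_finite_coproduct_right:
  assumes c: "is_coproduct (full_sub T S) I A C \<iota>" and S: "S \<subseteq> Ob T" and "finite I"
    and Q: "Q \<in> Ob T" and "\<And>i. i \<in> I \<Longrightarrow> orth Q (A i)"
  shows "orth Q C"
proof -
  have C: "C \<in> S" "C \<in> Ob T" using coproduct_ob[OF c] S by auto
  have Ai: "A i \<in> S" if "i \<in> I" for i using coproduct_comp_ob[OF c that] by simp
  have \<iota>: "\<iota> i \<in> Hom T (A i) C" if "i \<in> I" for i
    using coproduct_inj[OF c that] hom_full_sub[of "A i" S C T] C Ai[OF that] by simp
  let ?N = "{g \<in> Hom T C C. \<forall>f\<in>Hom T Q C. g \<cdot> f = Zero T Q C}"
  have "Ide T C \<in> ?N"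
  proof (rule finite_coproduct_ide[OF c S \<open>finite I\<close>])
    show "Zero T C C \<in> ?N" using C by (auto simp: in_hom_iff)
    show "g \<boxplus> h \<in> ?N" if "g \<in> ?N" "h \<in> ?N" for g h
      using that add_hom add_comp[of _ Q C g C h] C Q by (auto simp: in_hom_iff)
    show "\<iota> i \<cdot> p \<in> ?N" if i: "i \<in> I" and p: "p \<in> Hom T C (A i)" for i p
    proof -
      have "(\<iota> i \<cdot> p) \<cdot> f = Zero T Q C" if f: "f \<in> Hom T Q C" for f
      proof -
        have "p \<cdot> f = Zero T Q (A i)" using orthD[OF assms(5)[OF i]] comp_hom f p by blast
        then show ?thesis using \<iota>[OF i] p f comp_assoc[of f p "\<iota> i"] Q by (simp add: in_hom_iff)
      qed
      then show ?thesis using comp_hom[OF p \<iota>[OF i]] by blast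
    qed
  qed auto
  then show ?thesis using C Q by (intro orthI) (auto simp: in_hom_iff)
qed

lemma orth_finite_coproduct_left:
  assumes c: "is_coproduct (full_sub T S) I A C \<iota>" and S: "S \<subseteq> Ob T" and "finite I"
    and Q: "Q \<in> Ob T" and "\<And>i. i \<in> I \<Longrightarrow> orth (A i) Q"
  shows "orth C Q"
proof -
  have C: "C \<in> S" "C \<in> Ob T" using coproduct_ob[OF c] S by auto
  have Ai: "A i \<in> S" if "i \<in> I" for i using coproduct_comp_ob[OF c that] by simp
  have \<iota>: "\<iota> i \<in> Hom T (A i) C" if "i \<in> I" for i
    using coproduct_inj[OF c that] hom_full_sub[of "A i" S C T] C Ai[OF that] by simp
  let ?N = "{g \<in> Hom T C C. \<forall>f\<in>Hom T C Q. f \<cdot> g = Zero T C Q}"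
  have "Ide T C \<in> ?N"
  proof (rule finite_coproduct_ide[OF c S \<open>finite I\<close>])
    show "Zero T C C \<in> ?N" using C by (auto simp: in_hom_iff)
    show "g \<boxplus> h \<in> ?N" if "g \<in> ?N" "h \<in> ?N" for g h
      using that add_hom comp_add[of g C C h _ Q] C Q by (auto simp: in_hom_iff)
    show "\<iota> i \<cdot> p \<in> ?N" if i: "i \<in> I" and p: "p \<in> Hom T C (A i)" for i p
    proof -
      have "f \<cdot> (\<iota> i \<cdot> p) = Zero T C Q" if f: "f \<in> Hom T C Q" for f
      proof -
        have "f \<cdot> \<iota> i = Zero T (A i) Q" using orthD[OF assms(5)[OF i]] comp_hom f \<iota>[OF i] by blast
        then show ?thesis
          using \<iota>[OF i] p f comp_assoc[of p "\<iota> i" f] Q by (simp add: in_hom_iff)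
      qed
      then show ?thesis using comp_hom[OF p \<iota>[OF i]] by blast
    qed
  qed auto
  then show ?thesis using C Q by (intro orthI) (auto simp: in_hom_iff)
qed

text \<open>
  A coproduct of triangles is a triangle, in the form: the cone of a coproduct of morphisms is a
  coproduct of their cones.
\<close>

lemma coproduct_triangle:
  assumes t: "\<And>i. i \<in> I \<Longrightarrow> triangle T (A i) (B i) (Z i) (f i) (g i) (h i)"
    and ca: "is_coproduct T I A A' \<alpha>" and cb: "is_coproduct T I B B' \<beta>"
    and a: "a \<in> Hom T A' B'" "\<And>i. i \<in> I \<Longrightarrow> a \<cdot> \<alpha> i = \<beta> i \<cdot> f i"
    and tk: "triangle T A' B' K a k d"
  obtains \<kappa> where "is_coproduct T I Z K \<kappa>"
proof -
  note th = triangle_hom[OF t] and kh = triangle_hom[OF tk]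
  note \<alpha> = coproduct_inj[OF ca] and \<beta> = coproduct_inj[OF cb]
  have "\<exists>c. c \<in> Hom T (Z i) K \<and> c \<cdot> g i = k \<cdot> \<beta> i \<and> ShA T 1 (\<alpha> i) \<cdot> h i = d \<cdot> c" if "i \<in> I" for i
    using TR3[OF t[OF that] tk \<alpha>[OF that] \<beta>[OF that] a(2)[OF that, symmetric]] by metis
  then obtain \<kappa> where \<kappa>: "\<And>i. i \<in> I \<Longrightarrow> \<kappa> i \<in> Hom T (Z i) K"
    "\<And>i. i \<in> I \<Longrightarrow> \<kappa> i \<cdot> g i = k \<cdot> \<beta> i" "\<And>i. i \<in> I \<Longrightarrow> ShA T 1 (\<alpha> i) \<cdot> h i = d \<cdot> \<kappa> i" by metis
  have "is_coproduct T I Z K \<kappa>"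
    unfolding is_coproduct_def
  proof (intro conjI ballI allI impI)
    show "Z i \<in> Ob T" "\<kappa> i \<in> Hom T (Z i) K" if "i \<in> I" for i
      using kh th that \<kappa> by auto
    show "K \<in> Ob T" using kh by blast
    fix X z assume X: "X \<in> Ob T" and z: "\<forall>i\<in>I. z i \<in> Hom T (Z i) X"
    note ca1 = coproduct_shift[OF ca, of 1] and cb1 = coproduct_shift[OF cb, of 1]
    show "\<exists>!u. u \<in> Hom T K X \<and> (\<forall>i\<in>I. u \<cdot> \<kappa> i = z i)"
    proof (rule ex_ex1I)
      obtain v where v: "v \<in> Hom T B' X" "\<And>i. i \<in> I \<Longrightarrow> v \<cdot> \<beta> i = z i \<cdot> g i"
        using coproduct_induced[OF cb X, of "\<lambda>i. z i \<cdot> g i"] z th(2) comp_hom by metis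
      have va: "v \<cdot> a = Zero T A' X"
      proof (rule coproduct_zero[OF ca comp_hom[OF a(1) v(1)]])
        fix i assume i: "i \<in> I"
        have "(v \<cdot> a) \<cdot> \<alpha> i = v \<cdot> (a \<cdot> \<alpha> i)"
          using v(1) a(1) \<alpha>[OF i] by (simp add: in_hom_iff comp_assoc)
        also have "\<dots> = (v \<cdot> \<beta> i) \<cdot> f i"
          using v(1) a(2)[OF i] \<beta>[OF i] th(1)[OF i] by (simp add: in_hom_iff comp_assoc)
        also have "\<dots> = z i \<cdot> (g i \<cdot> f i)"
          using v(2)[OF i] z i th[OF i] by (auto simp: in_hom_iff comp_assoc)
        also have "\<dots> = Zero T (A i) X"
          using triangle_comp_zero1[OF t[OF i]] z i th[OF i] by (auto simp: in_hom_iff)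
        finally show "(v \<cdot> a) \<cdot> \<alpha> i = Zero T (A i) X" .
      qed
      obtain w where w: "w \<in> Hom T K X" "v = w \<cdot> k" using weak_coker1[OF tk v(1) va] .
      \<comment> \<open>\<open>w\<close> restricts to \<open>z i\<close> up to a map that factors through \<open>h i\<close>, and is corrected accordingly\<close>
      have "\<exists>s. s \<in> Hom T (Sh T 1 (A i)) X \<and> w \<cdot> \<kappa> i \<boxminus> z i = s \<cdot> h i" if i: "i \<in> I" for i
      proof -
        have zi: "z i \<in> Hom T (Z i) X" using z i by blast
        have wk: "w \<cdot> \<kappa> i \<in> Hom T (Z i) X" using w(1) \<kappa>(1)[OF i] comp_hom by blast
        have "(w \<cdot> \<kappa> i) \<cdot> g i = z i \<cdot> g i"
          using w \<kappa>[OF i] th[OF i] v(2)[OF i] kh \<beta>[OF i] by (auto simp: in_hom_iff comp_assoc)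
        then have "(w \<cdot> \<kappa> i \<boxminus> z i) \<cdot> g i = Zero T (B i) X"
          using add_comp[OF th(2)[OF i] wk neg_hom[OF zi]] zi wk th[OF i] by (auto simp: in_hom_iff)
        then show ?thesis
          using weak_coker2[OF t[OF i] add_hom[OF wk neg_hom[OF zi]]] by metis
      qed
      then obtain s where s: "\<And>i. i \<in> I \<Longrightarrow> s i \<in> Hom T (Sh T 1 (A i)) X"
        "\<And>i. i \<in> I \<Longrightarrow> w \<cdot> \<kappa> i \<boxminus> z i = s i \<cdot> h i" by metis
      obtain r where r: "r \<in> Hom T (Sh T 1 A') X" "\<And>i. i \<in> I \<Longrightarrow> r \<cdot> ShA T 1 (\<alpha> i) = s i"
        using coproduct_induced[OF ca1 X, of s] s(1) by blast
      have rd: "r \<cdot> d \<in> Hom T K X" using r(1) kh comp_hom by blast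
      have "(w \<boxminus> r \<cdot> d) \<cdot> \<kappa> i = z i" if i: "i \<in> I" for i
      proof -
        have zi: "z i \<in> Hom T (Z i) X" using z i by blast
        have wk: "w \<cdot> \<kappa> i \<in> Hom T (Z i) X" using w(1) \<kappa>(1)[OF i] comp_hom by blast
        have rk: "(r \<cdot> d) \<cdot> \<kappa> i \<in> Hom T (Z i) X" using rd \<kappa>(1)[OF i] comp_hom by blast
        have e: "(r \<cdot> d) \<cdot> \<kappa> i = w \<cdot> \<kappa> i \<boxminus> z i"
        proof -
          have "(r \<cdot> d) \<cdot> \<kappa> i = r \<cdot> (ShA T 1 (\<alpha> i) \<cdot> h i)"
            using r(1) kh \<kappa>[OF i] by (simp add: in_hom_iff comp_assoc)
          also have "\<dots> = s i \<cdot> h i"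
            using r \<alpha>[OF i] th[OF i] i by (simp add: in_hom_iff flip: comp_assoc)
          finally show ?thesis using s(2)[OF i] by simp
        qed
        have "(w \<boxminus> r \<cdot> d) \<cdot> \<kappa> i = w \<cdot> \<kappa> i \<boxminus> (r \<cdot> d) \<cdot> \<kappa> i"
          using add_comp[OF \<kappa>(1)[OF i] w(1) neg_hom[OF rd]] rd \<kappa>(1)[OF i] by (simp add: in_hom_iff)
        moreover have "z i \<boxplus> (r \<cdot> d) \<cdot> \<kappa> i = w \<cdot> \<kappa> i" unfolding e by (rule add_sub_cancel[OF wk zi])
        then have "(r \<cdot> d) \<cdot> \<kappa> i \<boxplus> (w \<cdot> \<kappa> i \<boxminus> (r \<cdot> d) \<cdot> \<kappa> i) = (r \<cdot> d) \<cdot> \<kappa> i \<boxplus> z i"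
          using add_sub_cancel[OF wk rk] add_comm[OF zi rk] by simp
        then have "w \<cdot> \<kappa> i \<boxminus> (r \<cdot> d) \<cdot> \<kappa> i = z i"
          using add_left_cancel[OF rk add_hom[OF wk neg_hom[OF rk]] zi] by blast
        ultimately show ?thesis by simp
      qed
      moreover have "w \<boxminus> r \<cdot> d \<in> Hom T K X" using add_hom[OF w(1) neg_hom[OF rd]] .
      ultimately show "\<exists>u. u \<in> Hom T K X \<and> (\<forall>i\<in>I. u \<cdot> \<kappa> i = z i)" by blast
    next
      fix u1 u2
      assume u1: "u1 \<in> Hom T K X \<and> (\<forall>i\<in>I. u1 \<cdot> \<kappa> i = z i)"
        and u2: "u2 \<in> Hom T K X \<and> (\<forall>i\<in>I. u2 \<cdot> \<kappa> i = z i)"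
      define u where "u = u1 \<boxminus> u2"
      have u: "u \<in> Hom T K X" unfolding u_def using u1 u2 add_hom neg_hom by blast
      have uk0: "u \<cdot> \<kappa> i = Zero T (Z i) X" if i: "i \<in> I" for i
      proof -
        have "u \<cdot> \<kappa> i = u1 \<cdot> \<kappa> i \<boxplus> neg T u2 \<cdot> \<kappa> i"
          unfolding u_def using u1 u2 add_comp[OF \<kappa>(1)[OF i] _ neg_hom] by blast
        also have "\<dots> = z i \<boxminus> z i" using u1 u2 i \<kappa>(1)[OF i] by (auto simp: in_hom_iff)
        finally show ?thesis using z i by (auto simp: in_hom_iff)
      qed
      have "u \<cdot> k = Zero T B' X"
      proof (rule coproduct_zero[OF cb comp_hom[OF kh(2) u]])
        fix i assume i: "i \<in> I"
        have "(u \<cdot> k) \<cdot> \<beta> i = (u \<cdot> \<kappa> i) \<cdot> g i"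
          using u kh \<beta>[OF i] \<kappa>[OF i] th[OF i] by (simp add: in_hom_iff comp_assoc)
        then show "(u \<cdot> k) \<cdot> \<beta> i = Zero T (B i) X"
          using uk0[OF i] th[OF i] X by (simp add: in_hom_iff)
      qed
      then obtain r where r: "r \<in> Hom T (Sh T 1 A') X" "u = r \<cdot> d" using weak_coker2[OF tk u] by blast
      have "\<exists>s. s \<in> Hom T (Sh T 1 (B i)) X \<and> r \<cdot> ShA T 1 (\<alpha> i) = s \<cdot> ShA T 1 (f i)"
        if i: "i \<in> I" for i
      proof -
        have ra: "r \<cdot> ShA T 1 (\<alpha> i) \<in> Hom T (Sh T 1 (A i)) X"
          using r(1) sha_hom[OF \<alpha>[OF i]] comp_hom by blast
        have "(r \<cdot> ShA T 1 (\<alpha> i)) \<cdot> h i = u \<cdot> \<kappa> i"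
          using r \<alpha>[OF i] th[OF i] kh \<kappa>[OF i] by (simp add: in_hom_iff comp_assoc)
        then have "(r \<cdot> ShA T 1 (\<alpha> i)) \<cdot> h i = Zero T (Z i) X" using uk0[OF i] by simp
        from weak_coker3[OF t[OF i] ra this] show ?thesis by metis
      qed
      then obtain s where s: "\<And>i. i \<in> I \<Longrightarrow> s i \<in> Hom T (Sh T 1 (B i)) X"
        "\<And>i. i \<in> I \<Longrightarrow> r \<cdot> ShA T 1 (\<alpha> i) = s i \<cdot> ShA T 1 (f i)" by metis
      obtain q where q: "q \<in> Hom T (Sh T 1 B') X" "\<And>i. i \<in> I \<Longrightarrow> q \<cdot> ShA T 1 (\<beta> i) = s i"
        using coproduct_induced[OF cb1 X, of s] s(1) by blast
      have "r = q \<cdot> ShA T 1 a"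
      proof (rule coproduct_ext[OF ca1 r(1) comp_hom[OF sha_hom[OF a(1)] q(1)]])
        fix i assume i: "i \<in> I"
        have "(q \<cdot> ShA T 1 a) \<cdot> ShA T 1 (\<alpha> i) = q \<cdot> ShA T 1 (a \<cdot> \<alpha> i)"
          using q(1) a(1) \<alpha>[OF i] by (simp add: in_hom_iff comp_assoc sha_comp)
        also have "\<dots> = (q \<cdot> ShA T 1 (\<beta> i)) \<cdot> ShA T 1 (f i)"
          unfolding a(2)[OF i] using q(1) \<beta>[OF i] th[OF i]
          by (simp add: in_hom_iff comp_assoc sha_comp)
        finally show "r \<cdot> ShA T 1 (\<alpha> i) = (q \<cdot> ShA T 1 a) \<cdot> ShA T 1 (\<alpha> i)"
          using q(2)[OF i] s(2)[OF i] by simp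
      qed
      then have "u = q \<cdot> (ShA T 1 a \<cdot> d)" using r q a kh by (simp add: in_hom_iff comp_assoc)
      then have "u = Zero T K X" using triangle_comp_zero3[OF tk] q kh by (simp add: in_hom_iff)
      then show "u1 = u2" using sub_eq_zeroD u1 u2 unfolding u_def by blast
    qed
  qed
  then show thesis by (rule that)
qed

section \<open>Telescopes\<close>

text \<open>
  The map \<open>p = 1 - shift\<close> on the coproduct \<open>C\<close> of a sequence \<open>X 0 \<rightarrow> X 1 \<rightarrow> X 2 \<rightarrow> \<dots>\<close>; the cone of \<open>p\<close> is
  the homotopy colimit of the sequence.
\<close>

definition telescope :: "(nat \<Rightarrow> 'o) \<Rightarrow> (nat \<Rightarrow> 'm) \<Rightarrow> 'o \<Rightarrow> (nat \<Rightarrow> 'm) \<Rightarrow> 'm \<Rightarrow> bool" where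
  "telescope X x C c p \<longleftrightarrow> is_coproduct T UNIV X C c \<and> p \<in> Hom T C C \<and>
     (\<forall>n. x n \<in> Hom T (X n) (X (Suc n)) \<and> p \<cdot> c n = c n \<boxminus> c (Suc n) \<cdot> x n)"

lemma telescopeD:
  assumes "telescope X x C c p"
  shows "is_coproduct T UNIV X C c" "p \<in> Hom T C C" "C \<in> Ob T" "X n \<in> Ob T"
    "x n \<in> Hom T (X n) (X (Suc n))" "c n \<in> Hom T (X n) C" "p \<cdot> c n = c n \<boxminus> c (Suc n) \<cdot> x n"
proof -
  show *: "is_coproduct T UNIV X C c" using assms unfolding telescope_def by blast
  show "p \<in> Hom T C C" "x n \<in> Hom T (X n) (X (Suc n))" "p \<cdot> c n = c n \<boxminus> c (Suc n) \<cdot> x n"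
    using assms unfolding telescope_def by blast+
  show "C \<in> Ob T" "X n \<in> Ob T" "c n \<in> Hom T (X n) C"
    using coproduct_ob[OF *] coproduct_comp_ob[OF *, of n] coproduct_inj[OF *, of n] by auto
qed

lemma ex_telescope:
  assumes c: "is_coproduct T UNIV X C c" and x: "\<And>n. x n \<in> Hom T (X n) (X (Suc n))"
  obtains p where "telescope X x C c p"
proof -
  have cH: "c n \<in> Hom T (X n) C" for n using coproduct_inj[OF c, of n] by simp
  have "c n \<boxminus> c (Suc n) \<cdot> x n \<in> Hom T (X n) C" for n
    using add_hom[OF cH neg_hom[OF comp_hom[OF x cH]]] .
  then obtain p where "p \<in> Hom T C C" "\<And>n. p \<cdot> c n = c n \<boxminus> c (Suc n) \<cdot> x n"
    using coproduct_induced[OF c coproduct_ob[OF c], of "\<lambda>n. c n \<boxminus> c (Suc n) \<cdot> x n"] by auto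
  then show thesis using that c x unfolding telescope_def by blast
qed

lemma telescope_comp:
  assumes t: "telescope X x C c p" and v: "v \<in> Hom T C V"
  shows "(v \<cdot> p) \<cdot> c n = v \<cdot> c n \<boxminus> (v \<cdot> c (Suc n)) \<cdot> x n"
proof -
  note h = telescopeD[OF t]
  have "(v \<cdot> p) \<cdot> c n = v \<cdot> (c n \<boxminus> c (Suc n) \<cdot> x n)"
    using comp_assoc[of "c n" p v] h(2,6,7) v by (simp add: in_hom_iff)
  also have "\<dots> = v \<cdot> c n \<boxplus> v \<cdot> neg T (c (Suc n) \<cdot> x n)"
    using comp_add[OF h(6) neg_hom[OF comp_hom[OF h(5) h(6)]] v] .
  also have "\<dots> = v \<cdot> c n \<boxminus> (v \<cdot> c (Suc n)) \<cdot> x n"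
    using v h(5,6)[of n] h(6)[of "Suc n"] by (simp add: in_hom_iff comp_assoc)
  finally show ?thesis .
qed

lemma telescope_cocone:
  assumes t: "telescope X x C c p" and v: "v \<in> Hom T C V"
  shows "v \<cdot> p = Zero T C V \<longleftrightarrow> (\<forall>n. (v \<cdot> c (Suc n)) \<cdot> x n = v \<cdot> c n)"
proof -
  note h = telescopeD[OF t]
  have vc: "v \<cdot> c n \<in> Hom T (X n) V" for n using comp_hom h(6) v by blast
  have vcx: "(v \<cdot> c (Suc n)) \<cdot> x n \<in> Hom T (X n) V" for n using comp_hom h(5) vc by blast
  have *: "(v \<cdot> p) \<cdot> c n = Zero T (X n) V \<longleftrightarrow> (v \<cdot> c (Suc n)) \<cdot> x n = v \<cdot> c n" for n
    using telescope_comp[OF t v, of n] sub_eq_zeroD[OF vc[of n] vcx[of n]] sub_self[of "v \<cdot> c n"]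
      vc[of n] by (auto simp: in_hom_iff)
  have "v \<cdot> p = Zero T C V \<longleftrightarrow> (\<forall>n. (v \<cdot> p) \<cdot> c n = Zero T (X n) V)"
    using coproduct_zero[OF h(1) comp_hom[OF h(2) v]] h(3,6) v hom_ob[OF v]
    by (auto simp: in_hom_iff)
  then show ?thesis using * by simp
qed

lemma telescope_map:
  assumes t: "telescope X x C c p" and t': "telescope E e C' c' p'"
    and a: "\<And>n. a n \<in> Hom T (E n) (X n)" "\<And>n. a (Suc n) \<cdot> e n = x n \<cdot> a n"
    and \<epsilon>: "\<epsilon> \<in> Hom T C' C" "\<And>n. \<epsilon> \<cdot> c' n = c n \<cdot> a n"
  shows "\<epsilon> \<cdot> p' = p \<cdot> \<epsilon>"
proof -
  note h = telescopeD[OF t] and h' = telescopeD[OF t']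
  show ?thesis
  proof (rule coproduct_ext[OF h'(1) comp_hom[OF h'(2) \<epsilon>(1)] comp_hom[OF \<epsilon>(1) h(2)]])
    fix n
    have "(p \<cdot> \<epsilon>) \<cdot> c' n = (p \<cdot> c n) \<cdot> a n"
      using h(2,6) h'(6)[of n] \<epsilon> a(1)[of n] by (simp add: in_hom_iff comp_assoc)
    also have "\<dots> = c n \<cdot> a n \<boxplus> neg T (c (Suc n) \<cdot> x n) \<cdot> a n"
      unfolding h(7) by (rule add_comp[OF a(1) h(6) neg_hom[OF comp_hom[OF h(5,6)]]])
    also have "\<dots> = c n \<cdot> a n \<boxminus> c (Suc n) \<cdot> (x n \<cdot> a n)"
      using h(5,6)[of n] h(6)[of "Suc n"] a(1)[of n] by (simp add: in_hom_iff comp_assoc)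
    also have "\<dots> = \<epsilon> \<cdot> c' n \<boxminus> (\<epsilon> \<cdot> c' (Suc n)) \<cdot> e n"
      using \<epsilon>(2) a h(6)[of "Suc n"] h'(5)[of n] a(1)[of "Suc n"]
      by (simp add: in_hom_iff comp_assoc flip: a(2))
    also have "\<dots> = (\<epsilon> \<cdot> p') \<cdot> c' n" using telescope_comp[OF t' \<epsilon>(1)] by simp
    finally show "(\<epsilon> \<cdot> p') \<cdot> c' n = (p \<cdot> \<epsilon>) \<cdot> c' n" by simp
  qed
qed

lemma shift_weak_ker:
  assumes t: "triangle T X Y Z f g h"
    and a: "a \<in> Hom T Q (Sh T 1 Y)" "ShA T 1 g \<cdot> a = Zero T Q (Sh T 1 Z)"
  obtains b where "b \<in> Hom T Q (Sh T 1 X)" "a = ShA T 1 f \<cdot> b"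
proof -
  note h = triangle_hom[OF t]
  obtain b where "b \<in> Hom T Q (Sh T 1 X)" "a = neg T (ShA T 1 f) \<cdot> b"
    using weak_ker3[OF rotate[OF t] a] .
  then show thesis using that[of "neg T b"] h neg_hom by (auto simp: in_hom_iff)
qed

text \<open>
  Let \<open>\<epsilon>\<close>, with cone \<open>K\<close>, be compatible with the telescope maps \<open>p'\<close> and \<open>p\<close> of two sequences. If there
  are no maps from \<open>Q\<close> to \<open>K\<close> and \<open>K[1]\<close> and \<open>p'\<close> is a split monomorphism, then every map from \<open>Q\<close> to
  the homotopy colimit of the second sequence comes from the coproduct of the first sequence.
\<close>

lemma telescope_surj:
  assumes tH: "triangle T C C H p q d" and tK: "triangle T C' C K \<epsilon> k l"
    and p': "p' \<in> Hom T C' C'" "\<epsilon> \<cdot> p' = p \<cdot> \<epsilon>"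
    and r: "r \<in> Hom T C' C'" "r \<cdot> p' = Ide T C'"
    and Q: "orth Q K" "orth Q (Sh T 1 K)" and f: "f \<in> Hom T Q H"
  obtains y where "y \<in> Hom T Q C'" "f = q \<cdot> (\<epsilon> \<cdot> y)"
proof -
  note hH = triangle_hom[OF tH] and hK = triangle_hom[OF tK]
  have QO: "Q \<in> Ob T" using hom_ob f by blast
  have df: "d \<cdot> f \<in> Hom T Q (Sh T 1 C)" using comp_hom f hH by blast
  have "ShA T 1 k \<cdot> (d \<cdot> f) = Zero T Q (Sh T 1 K)"
    using orthD[OF Q(2)] comp_hom df sha_hom hK by blast
  then obtain b where b: "b \<in> Hom T Q (Sh T 1 C')" "d \<cdot> f = ShA T 1 \<epsilon> \<cdot> b"
    using shift_weak_ker[OF tK df] by blast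
  let ?b' = "ShA T 1 p' \<cdot> b"
  have b': "?b' \<in> Hom T Q (Sh T 1 C')" using comp_hom b sha_hom p' by blast
  have "ShA T 1 \<epsilon> \<cdot> ?b' = ShA T 1 (\<epsilon> \<cdot> p') \<cdot> b"
    using b(1) p'(1) hK(1) by (simp add: in_hom_iff comp_assoc sha_comp)
  also have "\<dots> = ShA T 1 p \<cdot> (d \<cdot> f)"
    unfolding p'(2) using b p'(1) hK(1) hH(1) by (simp add: in_hom_iff comp_assoc sha_comp)
  also have "\<dots> = (ShA T 1 p \<cdot> d) \<cdot> f" using f hH by (simp add: in_hom_iff comp_assoc)
  also have "\<dots> = Zero T Q (Sh T 1 C)"
    using triangle_comp_zero3[OF tH] f hH by (simp add: in_hom_iff)
  finally obtain z where z: "z \<in> Hom T Q K" "?b' = l \<cdot> z" using weak_ker3[OF tK b'] by blast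
  have "z = Zero T Q K" using orthD Q z by blast
  then have "?b' = Zero T Q (Sh T 1 C')" using z hK QO by (simp add: in_hom_iff)
  then have "ShA T 1 r \<cdot> ?b' = Zero T Q (Sh T 1 C')" using r QO hK by (simp add: in_hom_iff)
  moreover have "ShA T 1 r \<cdot> ?b' = ShA T 1 (r \<cdot> p') \<cdot> b"
    using b(1) p'(1) r(1) by (simp add: in_hom_iff comp_assoc sha_comp)
  ultimately have "b = Zero T Q (Sh T 1 C')" using r(2) b(1) hK by (simp add: in_hom_iff)
  then have "d \<cdot> f = Zero T Q (Sh T 1 C)" using b QO hK by (simp add: in_hom_iff)
  then obtain w where w: "w \<in> Hom T Q C" "f = q \<cdot> w" using weak_ker2[OF tH f] by blast
  have "k \<cdot> w = Zero T Q K" using orthD[OF Q(1)] comp_hom w hK by blast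
  then obtain y where "y \<in> Hom T Q C'" "w = \<epsilon> \<cdot> y" using weak_ker1[OF tK w(1)] by blast
  then show thesis using that w by blast
qed

text \<open>
  If there are no maps from \<open>Q\<close> to \<open>K\<close> and \<open>K[-1]\<close>, then a map from \<open>Q\<close> to the coproduct of the first
  sequence that dies in the homotopy colimit of the second one already dies in that of the first.
\<close>

lemma telescope_inj:
  assumes tH: "triangle T C C H p q d" and tK: "triangle T C' C K \<epsilon> k l"
    and p': "p' \<in> Hom T C' C'" "\<epsilon> \<cdot> p' = p \<cdot> \<epsilon>"
    and Q: "orth Q K" "orth (Sh T 1 Q) K" and y: "y \<in> Hom T Q C'" "q \<cdot> (\<epsilon> \<cdot> y) = Zero T Q H"
  obtains z where "z \<in> Hom T Q C'" "y = p' \<cdot> z"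
proof -
  note hH = triangle_hom[OF tH] and hK = triangle_hom[OF tK]
  have QO: "Q \<in> Ob T" using hom_ob y by blast
  obtain w where w: "w \<in> Hom T Q C" "\<epsilon> \<cdot> y = p \<cdot> w"
    using weak_ker1[OF tH comp_hom[OF y(1) hK(1)] y(2)] by blast
  have "k \<cdot> w = Zero T Q K" using orthD[OF Q(1)] comp_hom w hK by blast
  then obtain z where z: "z \<in> Hom T Q C'" "w = \<epsilon> \<cdot> z" using weak_ker1[OF tK w(1)] by blast
  have pz: "p' \<cdot> z \<in> Hom T Q C'" using comp_hom z p' by blast
  let ?a = "y \<boxminus> p' \<cdot> z"
  have a: "?a \<in> Hom T Q C'" using add_hom[OF y(1) neg_hom[OF pz]] .
  have "\<epsilon> \<cdot> (p' \<cdot> z) = (p \<cdot> \<epsilon>) \<cdot> z"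
    using p' z(1) hK by (simp add: in_hom_iff flip: comp_assoc)
  then have "\<epsilon> \<cdot> (p' \<cdot> z) = \<epsilon> \<cdot> y"
    using w(2) z p' hK hH by (simp add: in_hom_iff comp_assoc)
  then have "\<epsilon> \<cdot> ?a = Zero T Q C"
    using comp_add[OF y(1) neg_hom[OF pz] hK(1)] y(1) pz hK(1) by (simp add: in_hom_iff)
  then have "ShA T 1 \<epsilon> \<cdot> ShA T 1 ?a = Zero T (Sh T 1 Q) (Sh T 1 C)"
    using a hK QO by (simp add: in_hom_iff flip: sha_comp)
  then obtain b where b: "b \<in> Hom T (Sh T 1 Q) K" "ShA T 1 ?a = l \<cdot> b"
    using weak_ker3[OF tK sha_hom[OF a]] by blast
  have "b = Zero T (Sh T 1 Q) K" using orthD Q b by blast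
  then have "ShA T 1 ?a = ShA T 1 (Zero T Q C')" using b hK QO by (simp add: in_hom_iff)
  then have "?a = Zero T Q C'" using sha_inj a zero_hom QO hK by blast
  then have "y = p' \<cdot> z" by (rule sub_eq_zeroD[OF y(1) pz])
  then show thesis using that z by blast
qed

text \<open>
  For a sequence that is constant from \<open>m\<close> on, the telescope map is a split monomorphism. A
  retraction with components \<open>\<rho> n\<close> has to satisfy \<open>\<rho> n = c n + \<rho> (n + 1) e n\<close>. This is solved upwards
  from \<open>\<rho> m = 0\<close>, where \<open>e n\<close> is the identity, and downwards by recursion.
\<close>

lemma telescope_split:
  assumes t: "telescope E e C c p"
    and m: "\<And>n. n \<ge> m \<Longrightarrow> E n = E m" "\<And>n. n \<ge> m \<Longrightarrow> e n = Ide T (E m)"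
  obtains r where "r \<in> Hom T C C" "r \<cdot> p = Ide T C"
proof -
  note h = telescopeD[OF t]
  define ok where "ok \<rho> n \<longleftrightarrow> \<rho> n \<in> Hom T (E n) C \<and> \<rho> (Suc n) \<in> Hom T (E (Suc n)) C \<and>
    \<rho> n = c n \<boxplus> \<rho> (Suc n) \<cdot> e n" for \<rho> n
  have "\<exists>\<rho>. \<forall>n. m \<le> n + j \<longrightarrow> ok \<rho> n" for j
  proof (induction j)
    case 0
    define R where "R = rec_nat (Zero T (E m) C) (\<lambda>d r. r \<boxminus> c (m + d))"
    have cm: "c (m + d) \<in> Hom T (E m) C" for d using h(6)[of "m + d"] m(1)[of "m + d"] by simp
    have R: "R (Suc d) = R d \<boxminus> c (m + d)" for d unfolding R_def by simp
    have RH: "R d \<in> Hom T (E m) C" for d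
    proof (induction d)
      case 0
      show ?case unfolding R_def using zero_hom h(3,4) by simp
    next
      case (Suc d)
      show ?case unfolding R using add_hom[OF Suc neg_hom[OF cm]] .
    qed
    have "ok (\<lambda>n. R (n - m)) n" if n: "m \<le> n" for n
    proof -
      have e: "Suc n - m = Suc (n - m)" using n by simp
      have "c (m + (n - m)) \<boxplus> (R (n - m) \<boxminus> c (m + (n - m))) = R (n - m)"
        by (rule add_sub_cancel[OF RH cm])
      moreover have "R (Suc (n - m)) \<cdot> Ide T (E m) = R (Suc (n - m))"
        using RH[of "Suc (n - m)"] by (simp add: in_hom_iff)
      moreover have "E n = E m" "E (Suc n) = E m" using m(1) n by (meson le_SucI order_refl)+
      moreover have "R (n - m) \<boxminus> c n \<in> Hom T (E m) C" using RH[of "Suc (n - m)"] n by (simp add: R)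
      ultimately show ?thesis using RH m(2) n unfolding ok_def e by (simp add: R)
    qed
    then show ?case by auto
  next
    case (Suc j)
    then obtain \<rho> where \<rho>: "\<And>n. m \<le> n + j \<Longrightarrow> ok \<rho> n" by blast
    show ?case
    proof (cases "j < m")
      case False
      then show ?thesis using \<rho> by (intro exI[of _ \<rho>]) auto
    next
      case True
      let ?n = "m - Suc j"
      let ?\<rho> = "\<rho>(?n := c ?n \<boxplus> \<rho> (Suc ?n) \<cdot> e ?n)"
      have "\<rho> (Suc ?n) \<in> Hom T (E (Suc ?n)) C" using \<rho>[of "Suc ?n"] True unfolding ok_def by auto
      then have n: "ok ?\<rho> ?n"
        unfolding ok_def using add_hom[OF h(6) comp_hom[OF h(5)]] by simp
      have "ok ?\<rho> n" if "m \<le> n + Suc j" for n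
      proof (cases "n = ?n")
        case True
        then show ?thesis using n by simp
      next
        case False
        then have "m \<le> n + j" "Suc n \<noteq> ?n" using that by auto
        then show ?thesis using \<rho>[of n] False unfolding ok_def by auto
      qed
      then show ?thesis by blast
    qed
  qed
  from this[of m] obtain \<rho> where "\<And>n. ok \<rho> n" by auto
  then have \<rho>: "\<rho> n \<in> Hom T (E n) C" "\<rho> n = c n \<boxplus> \<rho> (Suc n) \<cdot> e n" for n
    unfolding ok_def by blast+
  obtain r where r: "r \<in> Hom T C C" "\<And>n. r \<cdot> c n = \<rho> n"
    using coproduct_induced[OF h(1) h(3), of \<rho>] \<rho>(1) by auto
  have "r \<cdot> p = Ide T C"
  proof (rule coproduct_ext[OF h(1) comp_hom[OF h(2) r(1)] ide_hom[OF h(3)]])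
    fix n
    have re: "\<rho> (Suc n) \<cdot> e n \<in> Hom T (E n) C" using comp_hom[OF h(5) \<rho>(1)] .
    have "(r \<cdot> p) \<cdot> c n = \<rho> n \<boxminus> \<rho> (Suc n) \<cdot> e n" using telescope_comp[OF t r(1)] r(2) by simp
    moreover have "\<rho> (Suc n) \<cdot> e n \<boxplus> (\<rho> n \<boxminus> \<rho> (Suc n) \<cdot> e n) = \<rho> (Suc n) \<cdot> e n \<boxplus> c n"
      using add_sub_cancel[OF \<rho>(1) re] \<rho>(2)[of n] add_comm[OF re h(6)] by simp
    then have "\<rho> n \<boxminus> \<rho> (Suc n) \<cdot> e n = c n"
      using add_left_cancel[OF re add_hom[OF \<rho>(1) neg_hom[OF re]] h(6)] by blast
    ultimately show "(r \<cdot> p) \<cdot> c n = Ide T C \<cdot> c n" using h(6)[of n] by (simp add: in_hom_iff)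
  qed
  then show thesis using that r by blast
qed

text \<open>The composite \<open>X i \<rightarrow> X (i + d)\<close> of \<open>d\<close> consecutive maps of a sequence.\<close>

primrec chain :: "(nat \<Rightarrow> 'o) \<Rightarrow> (nat \<Rightarrow> 'm) \<Rightarrow> nat \<Rightarrow> nat \<Rightarrow> 'm" where
  "chain X x i 0 = Ide T (X i)"
| "chain X x i (Suc d) = x (i + d) \<cdot> chain X x i d"

lemma chain_hom:
  assumes "\<And>n. x n \<in> Hom T (X n) (X (Suc n))"
  shows "chain X x i d \<in> Hom T (X i) (X (i + d))"
proof (induction d)
  case 0
  show ?case using ide_hom hom_ob[OF assms] by simp
next
  case (Suc d)
  show ?case using comp_hom[OF Suc assms] by simp
qed

lemma chain_cocone:
  assumes x: "\<And>n. x n \<in> Hom T (X n) (X (Suc n))" and h: "\<And>n. h n \<in> Hom T (X n) H"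
    and hx: "\<And>n. h (Suc n) \<cdot> x n = h n"
  shows "h (i + d) \<cdot> chain X x i d = h i"
proof (induction d)
  case 0
  show ?case using h[of i] by (simp add: in_hom_iff)
next
  case (Suc d)
  have "h (i + Suc d) \<cdot> chain X x i (Suc d) = (h (Suc (i + d)) \<cdot> x (i + d)) \<cdot> chain X x i d"
    using comp_assoc[of "chain X x i d" "x (i + d)" "h (Suc (i + d))"] chain_hom[where X = X and x = x, OF x, of i d]
      x[of "i + d"] h[of "Suc (i + d)"] by (simp add: in_hom_iff)
  then show ?case using Suc hx by simp
qed

text \<open>
  By the octahedral axiom, the cone of a composite is an iterated extension of the cones of its
  factors.
\<close>

lemma chain_cone:
  assumes t: "\<And>n. n \<ge> i \<Longrightarrow> triangle T (X n) (X (Suc n)) (K n) (x n) (k n) (l n)"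
    and x: "\<And>n. x n \<in> Hom T (X n) (X (Suc n))"
    and K: "\<And>n. n \<ge> i \<Longrightarrow> K n \<in> W" and zero: "\<And>Z. zero_object T Z \<Longrightarrow> Z \<in> W"
    and ext: "\<And>A B Z u v w. triangle T A B Z u v w \<Longrightarrow> A \<in> W \<Longrightarrow> Z \<in> W \<Longrightarrow> B \<in> W"
  shows "\<exists>Z u v. triangle T (X i) (X (i + d)) Z (chain X x i d) u v \<and> Z \<in> W"
proof (induction d)
  case 0
  obtain N where "zero_object T N" by (rule ex_zero)
  then show ?case using triangle_ide[of "X i" N] zero hom_ob[OF x] by fastforce
next
  case (Suc d)
  then obtain Z u v where Z: "triangle T (X i) (X (i + d)) Z (chain X x i d) u v" "Z \<in> W" by blast
  have "chain X x i (Suc d) \<in> Hom T (X i) (X (Suc (i + d)))" using chain_hom[where X = X and x = x, OF x, of i "Suc d"] by simp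
  then obtain Z' u' v' where Z': "triangle T (X i) (X (Suc (i + d))) Z' (chain X x i (Suc d)) u' v'"
    by (rule ex_cone)
  have i: "i + d \<ge> i" by simp
  obtain a b w where "triangle T Z Z' (K (i + d)) a b w"
    using TR4[OF Z(1) t[OF i] Z'[unfolded chain.simps]] by blast
  then have "Z' \<in> W" using ext Z(2) K[OF i] by blast
  then show ?case using Z' by auto
qed

end

section \<open>The truncation triangle of a partial silting object\<close>

text \<open>
  The standard construction of an approximation by \<open>G\<close>: starting from \<open>X 0\<close>, step \<open>n\<close> kills the maps
  from \<open>G[n]\<close> by passing to the cone \<open>X (n + 1)\<close> of a \<open>G[n]\<close>-precover \<open>P n \<rightarrow> X n\<close>, where \<open>P n\<close> is a
  small coproduct of copies of \<open>G[n]\<close>. The object \<open>H\<close> is the homotopy colimit of the sequence.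
  The sets \<open>J n\<close> index the copies of \<open>G[n]\<close> in \<open>P n\<close>, with injections \<open>\<kappa> n\<close>.
\<close>

locale silting_tower = triangulated T
  for T :: "('o, 'm) tricat" (structure) +
  fixes U :: "'u set" and G :: 'o and J :: "nat \<Rightarrow> 'm set"
    and X P :: "nat \<Rightarrow> 'o" and \<kappa> :: "nat \<Rightarrow> 'm \<Rightarrow> 'm" and u x v :: "nat \<Rightarrow> 'm"
    and C H :: 'o and c :: "nat \<Rightarrow> 'm" and p q d :: 'm
  assumes small_nat: "small U (UNIV :: nat set)"
    and coproducts: "has_coproducts U T"
    and rigid: "G \<in> perp T G {0<..}"
    and closed: "closed_under_coproducts U T (perp T G {0<..})"
    and small_J: "\<And>n. small U (J n)"
    and P: "\<And>n. is_coproduct T (J n) (\<lambda>_. Sh T (int n) G) (P n) (\<kappa> n)"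
    and tri: "\<And>n. triangle T (P n) (X n) (X (Suc n)) (u n) (x n) (v n)"
    and cover: "\<And>n f. f \<in> Hom T (Sh T (int n) G) (X n) \<Longrightarrow>
      \<exists>y\<in>Hom T (Sh T (int n) G) (P n). f = u n \<cdot> y"
    and C: "telescope X x C c p"
    and H: "triangle T C C H p q d"
begin

lemma G: "G \<in> Ob T"
  using rigid unfolding perp_def by blast

text \<open>
  The class \<open>W a\<close> is the \<open>a\<close>-fold shift of \<open>perp T G {0<..}\<close>. It is closed under extensions and small
  coproducts and decreases in \<open>a\<close>; the object \<open>P n\<close> lies in \<open>W n\<close>.
\<close>

definition W :: "int \<Rightarrow> 'o set" where
  "W a = {Z \<in> Ob T. \<forall>k<a. orth (Sh T k G) Z}"

lemma W_shift: 
  assumes "Z \<in> Ob T"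
  shows "Sh T b Z \<in> W (a + b) \<longleftrightarrow> Z \<in> W a"
proof -
  have "(\<forall>k<a + b. orth (Sh T k G) (Sh T b Z)) \<longleftrightarrow> (\<forall>k<a + b. orth (Sh T (k - b) G) Z)"
    using orth_sh_iff G assms by simp
  also have "\<dots> \<longleftrightarrow> (\<forall>k<a. orth (Sh T k G) Z)"
    by (metis add_diff_cancel_right' diff_less_eq less_diff_eq diff_add_cancel)
  finally show ?thesis using assms unfolding W_def by simp
qed

lemma W_0: "W 0 = perp T G {0<..}"
proof -
  have "(\<forall>k<0. orth (Sh T k G) Z) \<longleftrightarrow> (\<forall>k\<in>{0<..}. orth (Sh T (- k) G) Z)" for Z
    by (metis greaterThan_iff minus_minus neg_0_less_iff_less neg_less_0_iff_less)
  then show ?thesis unfolding W_def using perp_iff[OF G] by blast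
qed

lemma W_coproduct:
  assumes "small U I" "\<And>i. i \<in> I \<Longrightarrow> A i \<in> W a" "is_coproduct T I A D \<iota>"
  shows "D \<in> W a"
proof -
  have D: "D \<in> Ob T" using assms coproduct_ob by metis
  have "Sh T (- a) D \<in> W 0" unfolding W_0
  proof (rule closed_under_coproducts_any[OF closed assms(1) _ coproduct_shift[OF assms(3)]])
    show "Sh T (- a) (A i) \<in> perp T G {0<..}" if "i \<in> I" for i
      using W_shift[of "A i" "- a" a] assms(2)[OF that] coproduct_comp_ob[OF assms(3) that]
      by (simp flip: W_0)
  qed
  then show ?thesis using W_shift[OF D, of "- a" a] by simp
qed

lemma W_ext:
  assumes "triangle T A B Z f g h" "A \<in> W a" "Z \<in> W a"
  shows "B \<in> W a"
  using orth_mid_right[OF assms(1)] triangle_hom[OF assms(1)] assms(2,3) unfolding W_def by blast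

lemma W_zero: "zero_object T Z \<Longrightarrow> Z \<in> W a"
  using zero_object_orth G unfolding W_def zero_object_def by auto

lemma P_W: "P n \<in> W (int n)"
proof (rule W_coproduct[OF small_J _ P])
  show "Sh T (int n) G \<in> W (int n)" using W_shift[OF G, of "int n" 0] rigid W_0 by simp
qed

lemma PS_W: "Sh T 1 (P n) \<in> W (1 + int n)"
  using P_W[of n] W_shift[of "P n" 1 "int n"] coproduct_ob[OF P] by (simp add: add.commute)

lemma X: "X n \<in> Ob T" and x: "x n \<in> Hom T (X n) (X (Suc n))" and u: "u n \<in> Hom T (P n) (X n)"
  using triangle_hom[OF tri] by blast+

lemma c: "c n \<in> Hom T (X n) C" and q: "q \<in> Hom T C H" and HO: "H \<in> Ob T"
  using telescopeD[OF C] triangle_hom[OF H] by blast+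

lemma qc: "q \<cdot> c n \<in> Hom T (X n) H"
  using comp_hom c q .

lemma cocone: "(q \<cdot> c (Suc n)) \<cdot> x n = q \<cdot> c n"
  using telescope_cocone[OF C q] triangle_comp_zero1[OF H] by blast

text \<open>
  Step \<open>n\<close> kills all maps from \<open>G[n]\<close>, and it creates no new maps from \<open>G[k]\<close> for \<open>0 \<le> k < n\<close> since
  \<open>P n [1]\<close> lies in \<open>W (n + 1)\<close>.
\<close>

lemma X_vanish: "\<forall>k. 0 \<le> k \<and> k < int n \<longrightarrow> orth (Sh T k G) (X n)"
proof (induction n)
  case (Suc n)
  show ?case
  proof (intro allI impI)
    fix k assume k: "0 \<le> k \<and> k < int (Suc n)"
    have P1: "orth (Sh T k G) (Sh T 1 (P n))" using PS_W[of n] k unfolding W_def by auto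
    show "orth (Sh T k G) (X (Suc n))"
    proof (cases "k = int n")
      case False
      then show ?thesis using orth_cone_right[OF tri] P1 Suc k by auto
    next
      case True
      show ?thesis
      proof (rule orthI)
        fix f assume f: "f \<in> Hom T (Sh T k G) (X (Suc n))"
        have "v n \<cdot> f = Zero T (Sh T k G) (Sh T 1 (P n))"
          using orthD[OF P1] comp_hom f triangle_hom[OF tri] by blast
        then obtain g where g: "g \<in> Hom T (Sh T k G) (X n)" "f = x n \<cdot> g"
          using weak_ker2[OF tri f] by blast
        then obtain y where "y \<in> Hom T (Sh T k G) (P n)" "g = u n \<cdot> y" using cover True by blast
        then have "f = (x n \<cdot> u n) \<cdot> y" using g x[of n] u[of n] by (simp add: in_hom_iff comp_assoc)
        then show "f = Zero T (Sh T k G) (X (Suc n))"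
          using triangle_comp_zero1[OF tri] X \<open>y \<in> _\<close> by (simp add: in_hom_iff)
      qed (use X G in auto)
    qed
  qed
qed auto

text \<open>
  The sequence \<open>E\<close> that agrees with \<open>X\<close> up to \<open>m\<close> and is constant from then on has homotopy colimit
  \<open>X m\<close>. The cones of the canonical maps \<open>E n \<rightarrow> X n\<close> are iterated extensions of the objects
  \<open>P i [1]\<close> with \<open>i \<ge> m\<close>, so that the cone \<open>K\<close> of the induced map of coproducts lies in \<open>W (m + 1)\<close>.
\<close>

lemma truncation:
  fixes m :: nat
  defines "E \<equiv> \<lambda>n. X (min n m)" and "e \<equiv> \<lambda>n. if n < m then x n else Ide T (X m)"
    and "a \<equiv> \<lambda>n. chain X x (min n m) (n - min n m)"
  obtains C' c' p' r \<epsilon> K k l where "telescope E e C' c' p'" "r \<in> Hom T C' C'" "r \<cdot> p' = Ide T C'"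
    "\<And>n. \<epsilon> \<cdot> c' n = c n \<cdot> a n" "\<epsilon> \<cdot> p' = p \<cdot> \<epsilon>"
    "triangle T C' C K \<epsilon> k l" "K \<in> W (int m + 1)"
proof -
  have EO: "E n \<in> Ob T" for n unfolding E_def using X .
  obtain C' c' where C': "is_coproduct T UNIV E C' c'"
    using has_coproducts_any[OF coproducts small_nat, of E] EO by blast
  have eH: "e n \<in> Hom T (E n) (E (Suc n))" for n
  proof (cases "n < m")
    case True
    then show ?thesis unfolding e_def E_def using x[of n] by (simp add: min_def)
  next
    case False
    then have "min n m = m" "min (Suc n) m = m" by auto
    then show ?thesis unfolding e_def E_def using False ide_hom X by simp
  qed
  obtain p' where t: "telescope E e C' c' p'" by (rule ex_telescope[OF C' eH])
  have "E n = E m" "e n = Ide T (E m)" if "n \<ge> m" for n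
    using that unfolding E_def e_def by auto
  then obtain r where r: "r \<in> Hom T C' C'" "r \<cdot> p' = Ide T C'" by (rule telescope_split[OF t])
  have aH: "a n \<in> Hom T (E n) (X n)" for n
    using chain_hom[where X = X and x = x, OF x, of "min n m" "n - min n m"]
    unfolding a_def E_def by simp
  have ae: "a (Suc n) \<cdot> e n = x n \<cdot> a n" for n
  proof (cases "n < m")
    case True
    then have "min n m = n" "min (Suc n) m = Suc n" by auto
    then show ?thesis using True x[of n] X unfolding a_def e_def by (simp add: in_hom_iff)
  next
    case False
    then have s: "min n m = m" "min (Suc n) m = m" "Suc n - m = Suc (n - m)" "m + (n - m) = n"
      by auto
    then have "a (Suc n) = x n \<cdot> a n" unfolding a_def by simp
    moreover have "a n \<in> Hom T (X m) (X n)" using aH[of n] s unfolding E_def by simp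
    ultimately show ?thesis using False x[of n] unfolding e_def by (simp add: in_hom_iff)
  qed
  have ca: "c n \<cdot> a n \<in> Hom T (E n) C" for n using comp_hom aH c .
  obtain \<epsilon> where \<epsilon>: "\<epsilon> \<in> Hom T C' C" "\<And>n. \<epsilon> \<cdot> c' n = c n \<cdot> a n"
    using coproduct_induced[OF C' telescopeD(3)[OF C], of "\<lambda>n. c n \<cdot> a n"] ca by auto
  obtain K k l where K: "triangle T C' C K \<epsilon> k l" using ex_cone[OF \<epsilon>(1)] .
  have "\<exists>Z g h. triangle T (E n) (X n) Z (a n) g h \<and> Z \<in> W (int m + 1)" for n
  proof -
    have "\<exists>Z g h. triangle T (X i) (X (i + (n - i))) Z (chain X x i (n - i)) g h \<and> Z \<in> W (int i + 1)"
      if "i = min n m" for i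
    proof (rule chain_cone[where X = X and x = x and K = "\<lambda>n. Sh T 1 (P n)", OF rotate[OF tri] x])
      show "Sh T 1 (P n) \<in> W (int i + 1)" if "n \<ge> i" for n
        using PS_W[of n] that unfolding W_def by auto
    qed (use W_zero W_ext in blast)+
    from this[OF refl] obtain Z g h where Z: "triangle T (E n) (X n) Z (a n) g h"
      "Z \<in> W (int (min n m) + 1)" unfolding E_def a_def by auto
    show ?thesis
    proof (cases "n \<le> m")
      case False
      then have "min n m = m" by simp
      then show ?thesis using Z by auto
    next
      case True
      then have an: "a n = Ide T (X n)" "E n = X n" unfolding a_def E_def by simp_all
      obtain N where "zero_object T N" by (rule ex_zero)
      then show ?thesis using triangle_ide[OF X] W_zero unfolding an by blast
    qed
  qed
  then obtain Z g h where Z: "\<And>n. triangle T (E n) (X n) (Z n) (a n) (g n) (h n)"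
    "\<And>n. Z n \<in> W (int m + 1)" by metis
  obtain z where "is_coproduct T UNIV Z K z"
    by (rule coproduct_triangle[OF Z(1) C' telescopeD(1)[OF C] \<epsilon> K])
  then have "K \<in> W (int m + 1)" using W_coproduct[OF small_nat] Z(2) by blast
  then show thesis using that t r \<epsilon>(2) telescope_map[OF C t aH ae \<epsilon>] K by blast
qed

text \<open>
  Consequently \<open>Hom(G[k], X m) \<rightarrow> Hom(G[k], H)\<close> is surjective for \<open>k \<le> m\<close>. No compactness of \<open>G\<close> is
  involved: the closure of \<open>W\<close> under coproducts takes its place.
\<close>

lemma hom_surj_H:
  assumes k: "k \<le> int m" and f: "f \<in> Hom T (Sh T k G) H"
  obtains y where "y \<in> Hom T (Sh T k G) (X m)" "f = (q \<cdot> c m) \<cdot> y"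
proof -
  let ?E = "\<lambda>n. X (min n m)" and ?a = "\<lambda>n. chain X x (min n m) (n - min n m)"
    and ?b = "\<lambda>n. chain X x (min n m) (m - min n m)"
    and ?e = "\<lambda>n. if n < m then x n else Ide T (X m)"
  obtain C' c' p' r \<epsilon> K k' l where tr: "telescope ?E ?e C' c' p'"
    "r \<in> Hom T C' C'" "r \<cdot> p' = Ide T C'" "\<And>n. \<epsilon> \<cdot> c' n = c n \<cdot> ?a n" "\<epsilon> \<cdot> p' = p \<cdot> \<epsilon>"
    and K: "triangle T C' C K \<epsilon> k' l" "K \<in> W (int m + 1)"
    by (rule truncation[of m]) blast
  note \<epsilon> = triangle_hom(1)[OF K(1)] and C' = telescopeD(1)[OF tr(1)] and c' = telescopeD(6)[OF tr(1)]
  have KO: "K \<in> Ob T" using triangle_hom[OF K(1)] by blast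
  have 1: "orth (Sh T k G) K" using K k unfolding W_def by auto
  have "orth (Sh T (k - 1) G) K" using K k unfolding W_def by auto
  then have 2: "orth (Sh T k G) (Sh T 1 K)" using orth_sh_iff[OF G KO, of k 1] by simp
  obtain y where y: "y \<in> Hom T (Sh T k G) C'" "f = q \<cdot> (\<epsilon> \<cdot> y)"
    by (rule telescope_surj[OF H K(1) telescopeD(2)[OF tr(1)] tr(5,2,3) 1 2 f])
  have b: "?b n \<in> Hom T (?E n) (X m)" for n
    using chain_hom[where X = X and x = x, OF x, of "min n m" "m - min n m"] by simp
  obtain s where s: "s \<in> Hom T C' (X m)" "\<And>n. s \<cdot> c' n = ?b n"
    using coproduct_induced[OF C' X, of ?b] b by auto
  have "q \<cdot> \<epsilon> = (q \<cdot> c m) \<cdot> s"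
  proof (rule coproduct_ext[OF C' comp_hom[OF \<epsilon> q] comp_hom[OF s(1) qc]])
    fix n
    have a: "?a n \<in> Hom T (?E n) (X n)"
      using chain_hom[where X = X and x = x, OF x, of "min n m" "n - min n m"] by simp
    have ch: "(q \<cdot> c (i + j)) \<cdot> chain X x i j = q \<cdot> c i" for i j
      by (rule chain_cocone[where h = "\<lambda>n. q \<cdot> c n", OF x qc cocone])
    have "(q \<cdot> \<epsilon>) \<cdot> c' n = q \<cdot> (\<epsilon> \<cdot> c' n)" using q \<epsilon> c'[of n] by (simp add: in_hom_iff comp_assoc)
    also have "\<dots> = (q \<cdot> c n) \<cdot> ?a n" unfolding tr(4) using q c[of n] a by (simp add: in_hom_iff comp_assoc)
    also have "\<dots> = q \<cdot> c (min n m)" using ch[of "min n m" "n - min n m"] by simp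
    also have "\<dots> = (q \<cdot> c m) \<cdot> ?b n" using ch[of "min n m" "m - min n m"] by simp
    also have "\<dots> = ((q \<cdot> c m) \<cdot> s) \<cdot> c' n"
      using s c'[of n] qc[of m] comp_assoc[of "c' n" s "q \<cdot> c m"] by (simp add: in_hom_iff)
    finally show "(q \<cdot> \<epsilon>) \<cdot> c' n = ((q \<cdot> c m) \<cdot> s) \<cdot> c' n" .
  qed
  moreover have "f = (q \<cdot> \<epsilon>) \<cdot> y" using y \<epsilon> q by (simp add: in_hom_iff comp_assoc)
  ultimately have "f = (q \<cdot> c m) \<cdot> (s \<cdot> y)"
    using s(1) y(1) qc[of m] comp_assoc[of y s "q \<cdot> c m"] by (simp add: in_hom_iff)
  then show thesis using that comp_hom[OF y(1) s(1)] by blast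
qed

lemma hom_inj_H:
  assumes k: "k < 0" and y: "y \<in> Hom T (Sh T k G) (X 0)" "(q \<cdot> c 0) \<cdot> y = Zero T (Sh T k G) H"
  shows "y = Zero T (Sh T k G) (X 0)"
proof -
  have nm: "min n 0 = 0" for n :: nat by simp
  \<comment> \<open>the truncation for \<open>m = 0\<close> is the constant sequence \<open>X 0\<close>, with \<open>s\<close> below as codiagonal\<close>
  let ?E = "\<lambda>n. X 0" and ?e = "\<lambda>n. Ide T (X 0)" and ?a = "chain X x 0"
  obtain C' c' p' r \<epsilon> K k' l where tr: "telescope ?E ?e C' c' p'"
    "r \<in> Hom T C' C'" "r \<cdot> p' = Ide T C'" "\<And>n. \<epsilon> \<cdot> c' n = c n \<cdot> ?a n" "\<epsilon> \<cdot> p' = p \<cdot> \<epsilon>"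
    and K: "triangle T C' C K \<epsilon> k' l" "K \<in> W 1"
    using truncation[of 0] by (simp add: nm) metis
  note \<epsilon> = triangle_hom(1)[OF K(1)] and C' = telescopeD(1)[OF tr(1)] and c' = telescopeD(6)[OF tr(1)]
  have KO: "K \<in> Ob T" using triangle_hom[OF K(1)] by blast
  have 1: "orth (Sh T k G) K" "orth (Sh T 1 (Sh T k G)) K" using K k G unfolding W_def by auto
  have cy: "c' 0 \<cdot> y \<in> Hom T (Sh T k G) C'" using comp_hom y c' by blast
  have "\<epsilon> \<cdot> (c' 0 \<cdot> y) = (\<epsilon> \<cdot> c' 0) \<cdot> y" using \<epsilon> c'[of 0] y by (simp add: in_hom_iff comp_assoc)
  then have "q \<cdot> (\<epsilon> \<cdot> (c' 0 \<cdot> y)) = Zero T (Sh T k G) H"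
    unfolding tr(4) using y q c[of 0] by (simp add: in_hom_iff comp_assoc)
  then obtain z where z: "z \<in> Hom T (Sh T k G) C'" "c' 0 \<cdot> y = p' \<cdot> z"
    using telescope_inj[OF H K(1) telescopeD(2)[OF tr(1)] tr(5) 1 cy] by blast
  obtain s where s: "s \<in> Hom T C' (X 0)" "\<And>n. s \<cdot> c' n = Ide T (X 0)"
    using coproduct_induced[OF C' X, of "\<lambda>_. Ide T (X 0)"] ide_hom[OF X] by auto
  have sp: "s \<cdot> p' = Zero T C' (X 0)" using telescope_cocone[OF tr(1) s(1)] s(2) X by simp
  have "y = s \<cdot> (p' \<cdot> z)"
    unfolding z(2)[symmetric] using s(1) s(2)[of 0] y(1) c'[of 0]
    by (simp add: in_hom_iff flip: comp_assoc)
  also have "\<dots> = (s \<cdot> p') \<cdot> z"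
    using s z telescopeD(2)[OF tr(1)] by (simp add: in_hom_iff comp_assoc)
  also have "\<dots> = Zero T (Sh T k G) (X 0)" unfolding sp using z X by (simp add: in_hom_iff)
  finally show ?thesis .
qed

lemma H_nonpos: "H \<in> perp T G {..0}"
proof -
  have "orth (Sh T (- i) G) H" if "i \<le> 0" for i
  proof (rule orthI)
    fix f assume f: "f \<in> Hom T (Sh T (- i) G) H"
    define m where "m = Suc (nat (- i))"
    have m: "- i < int m" unfolding m_def using that by auto
    then obtain y where y: "y \<in> Hom T (Sh T (- i) G) (X m)" "f = (q \<cdot> c m) \<cdot> y"
      using hom_surj_H[OF _ f, of m] by auto
    have "y = Zero T (Sh T (- i) G) (X m)" using orthD[OF _ y(1)] X_vanish[of m] m that by auto
    then show "f = Zero T (Sh T (- i) G) H" using y qc[of m] G by (simp add: in_hom_iff)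
  qed (use G HO in auto)
  then show ?thesis using perp_iff[OF G] HO by simp
qed

lemma cocone_pos:
  assumes t: "triangle T A (X 0) H f (q \<cdot> c 0) g"
  shows "A \<in> perp T G {0<..}"
proof -
  note h = triangle_hom[OF t]
  have "A \<in> W 0"
    unfolding W_def
  proof (intro CollectI conjI allI impI)
    show "A \<in> Ob T" using h by blast
    fix k :: int assume k: "k < 0"
    show "orth (Sh T k G) A"
    proof (rule orthI)
      fix b assume b: "b \<in> Hom T (Sh T k G) A"
      have fb: "f \<cdot> b \<in> Hom T (Sh T k G) (X 0)" using comp_hom b h by blast
      have "(q \<cdot> c 0) \<cdot> (f \<cdot> b) = ((q \<cdot> c 0) \<cdot> f) \<cdot> b"
        using qc[of 0] b h comp_assoc[of b f "q \<cdot> c 0"] by (simp add: in_hom_iff)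
      then have "(q \<cdot> c 0) \<cdot> (f \<cdot> b) = Zero T (Sh T k G) H"
        using triangle_comp_zero1[OF t] b h by (simp add: in_hom_iff)
      from hom_inj_H[OF k fb this] have fb0: "f \<cdot> b = Zero T (Sh T k G) (X 0)" .
      have b1: "ShA T 1 b \<in> Hom T (Sh T (k + 1) G) (Sh T 1 A)"
        using sha_hom[OF b, of 1] G by (simp add: add.commute)
      have "ShA T 1 f \<cdot> ShA T 1 b = ShA T 1 (f \<cdot> b)" using b h by (simp add: in_hom_iff sha_comp)
      then have "ShA T 1 f \<cdot> ShA T 1 b = Zero T (Sh T (k + 1) G) (Sh T 1 (X 0))"
        unfolding fb0 using G X by (simp add: add.commute)
      then obtain w where w: "w \<in> Hom T (Sh T (k + 1) G) H" "ShA T 1 b = g \<cdot> w"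
        using weak_ker3[OF t b1] by blast
      obtain y where y: "y \<in> Hom T (Sh T (k + 1) G) (X 0)" "w = (q \<cdot> c 0) \<cdot> y"
        using hom_surj_H[of "k + 1" 0, OF _ w(1)] k by auto
      have "ShA T 1 b = (g \<cdot> (q \<cdot> c 0)) \<cdot> y"
        using w y qc[of 0] h comp_assoc[of y "q \<cdot> c 0" g] by (simp add: in_hom_iff)
      then have "ShA T 1 b = ShA T 1 (Zero T (Sh T k G) A)"
        using triangle_comp_zero2[OF t] y G h by (simp add: in_hom_iff add.commute)
      then show "b = Zero T (Sh T k G) A" using sha_inj b zero_hom G h sh_ob by blast
    qed (use G h in auto)
  qed
  then show ?thesis using W_0 by simp
qed

lemma H_pos:
  assumes "X 0 \<in> perp T G {0<..}"
  shows "H \<in> perp T G {0<..}"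
proof -
  have "H \<in> W 0"
    unfolding W_def
  proof (intro CollectI conjI allI impI)
    fix k :: int assume k: "k < 0"
    show "orth (Sh T k G) H"
    proof (rule orthI)
      fix f assume f: "f \<in> Hom T (Sh T k G) H"
      obtain y where y: "y \<in> Hom T (Sh T k G) (X 0)" "f = (q \<cdot> c 0) \<cdot> y"
        using hom_surj_H[of k 0, OF _ f] k by auto
      have "orth (Sh T k G) (X 0)" using assms k unfolding W_0[symmetric] W_def by blast
      then have "y = Zero T (Sh T k G) (X 0)" using orthD y(1) by blast
      then show "f = Zero T (Sh T k G) H" using y qc[of 0] G by (simp add: in_hom_iff)
    qed (use G HO in auto)
  qed (rule HO)
  then show ?thesis using W_0 by simp
qed

text \<open>All \<open>Hom(P n, V)\<close> vanish, so maps to \<open>V\<close> extend along the sequence.\<close>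

lemma extend_to_H:
  assumes V: "V \<in> perp T G {..0}" and f: "f \<in> Hom T (X 0) V"
  obtains w where "w \<in> Hom T H V" "f = w \<cdot> (q \<cdot> c 0)"
proof -
  have VO: "V \<in> Ob T" using V unfolding perp_def by blast
  have "orth (Sh T (int n) G) V" for n
    using V perp_iff[OF G] by (metis atMost_iff minus_minus neg_le_0_iff_le of_nat_0_le_iff)
  then have PV: "orth (P n) V" for n using orth_coproduct[OF P VO] by blast
  have "\<exists>F. \<forall>n. (F n \<in> Hom T (X n) V \<and> (n = 0 \<longrightarrow> F n = f)) \<and> F (Suc n) \<cdot> x n = F n"
  proof (rule dependent_nat_choice)
    show "\<exists>g. g \<in> Hom T (X 0) V \<and> (0 = 0 \<longrightarrow> g = f)" using f by blast
    fix g n assume g: "g \<in> Hom T (X n) V \<and> (n = 0 \<longrightarrow> g = f)"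
    then have "g \<cdot> u n = Zero T (P n) V" using orthD[OF PV] comp_hom u by blast
    then show "\<exists>h. (h \<in> Hom T (X (Suc n)) V \<and> (Suc n = 0 \<longrightarrow> h = f)) \<and> h \<cdot> x n = g"
      using weak_coker1[OF tri[of n], of g V] g by (metis nat.distinct(1))
  qed
  then obtain F where F: "\<And>n. F n \<in> Hom T (X n) V" "F 0 = f" "\<And>n. F (Suc n) \<cdot> x n = F n" by blast
  obtain w where w: "w \<in> Hom T C V" "\<And>n. w \<cdot> c n = F n"
    using coproduct_induced[OF telescopeD(1)[OF C] VO, of F] F(1) by auto
  have "w \<cdot> p = Zero T C V" using telescope_cocone[OF C w(1)] w(2) F(3) by simp
  then obtain w' where w': "w' \<in> Hom T H V" "w = w' \<cdot> q" using weak_coker1[OF H w(1)] by blast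
  have "f = w' \<cdot> (q \<cdot> c 0)"
    using w(2)[of 0] w' F(2) q c[of 0] by (simp add: in_hom_iff comp_assoc)
  then show thesis using that w'(1) by blast
qed

end

context triangulated
begin

lemma ex_approximation:
  assumes "universe U" "locally_small U T" "has_coproducts U T"
    and rigid: "G \<in> perp T G {0<..}" and cl: "closed_under_coproducts U T (perp T G {0<..})"
    and M: "M \<in> Ob T"
  obtains A H f g h where "triangle T A M H f g h" "A \<in> perp T G {0<..}" "H \<in> perp T G {..0}"
    "M \<in> perp T G {0<..} \<Longrightarrow> H \<in> perp T G {0<..}"
    "\<And>V b. V \<in> perp T G {..0} \<Longrightarrow> b \<in> Hom T M V \<Longrightarrow> \<exists>w\<in>Hom T H V. b = w \<cdot> g"
proof -
  have G: "G \<in> Ob T" using rigid unfolding perp_def by blast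
  have nat: "small U (UNIV :: nat set)" using assms(1) unfolding universe_def by blast
  define step where "step n A B \<longleftrightarrow> (\<exists>J P \<kappa> u x v. small U (J :: 'm set) \<and>
      is_coproduct T J (\<lambda>_. Sh T (int n) G) P \<kappa> \<and> triangle T P A B u x v \<and>
      (\<forall>f\<in>Hom T (Sh T (int n) G) A. \<exists>y\<in>Hom T (Sh T (int n) G) P. f = u \<cdot> y))" for n A B
  have ex_step: "\<exists>B. B \<in> Ob T \<and> step n A B" if A: "A \<in> Ob T" for n A
  proof -
    let ?Q = "Sh T (int n) G"
    \<comment> \<open>the precover is the coproduct over all morphisms from \<open>G[n]\<close> to \<open>A\<close>\<close>
    let ?J = "Hom T ?Q A"
    have J: "small U ?J" using assms(2) A G unfolding locally_small_def by simp
    obtain P \<kappa> where P: "is_coproduct T ?J (\<lambda>_. ?Q) P \<kappa>"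
      using has_coproducts_any[OF assms(3) J, of "\<lambda>_. ?Q"] G by auto
    obtain u where u: "u \<in> Hom T P A" "\<And>f. f \<in> ?J \<Longrightarrow> u \<cdot> \<kappa> f = f"
      using coproduct_induced[OF P A, of "\<lambda>f. f"] by auto
    obtain B x v where B: "triangle T P A B u x v" using ex_cone[OF u(1)] .
    have "\<forall>f\<in>?J. \<exists>y\<in>Hom T ?Q P. f = u \<cdot> y" using u(2) coproduct_inj[OF P] by metis
    then show ?thesis using J P B triangle_hom[OF B] unfolding step_def by blast
  qed
  have "\<exists>X. \<forall>n. (X n \<in> Ob T \<and> (n = 0 \<longrightarrow> X n = M)) \<and> step n (X n) (X (Suc n))"
    by (rule dependent_nat_choice) (use M ex_step in auto)
  then obtain X where X0: "X 0 = M" and step: "\<And>n. step n (X n) (X (Suc n))" by blast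
  obtain J P \<kappa> u x v where st: "\<And>n. small U (J n :: 'm set)"
    "\<And>n. is_coproduct T (J n) (\<lambda>_. Sh T (int n) G) (P n) (\<kappa> n)"
    "\<And>n. triangle T (P n) (X n) (X (Suc n)) (u n) (x n) (v n)"
    "\<And>n. \<forall>f\<in>Hom T (Sh T (int n) G) (X n). \<exists>y\<in>Hom T (Sh T (int n) G) (P n). f = u n \<cdot> y"
    using step unfolding step_def by metis
  have "X n \<in> Ob T" for n using triangle_hom[OF st(3)] by blast
  then obtain C c where C: "is_coproduct T UNIV X C c"
    using has_coproducts_any[OF assms(3) nat, of X] by blast
  obtain p where p: "telescope X x C c p" using ex_telescope[OF C triangle_hom(2)[OF st(3)]] .
  obtain H q d where H: "triangle T C C H p q d" using ex_cone[OF telescopeD(2)[OF p]] .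
  interpret silting_tower T U G J X P \<kappa> u x v C H c p q d
    by unfold_locales (use nat assms(3) rigid cl st p H in auto)
  obtain Z a b where Z: "triangle T (X 0) H Z (q \<cdot> c 0) a b" using ex_cone[OF qc] .
  \<comment> \<open>the cocone of \<open>X 0 \<rightarrow> H\<close> is the cone, shifted by \<open>-1\<close>\<close>
  note z = triangle_hom[OF Z]
  define f where "f = neg T (ShA T (- 1) b)"
  have f: "f \<in> Hom T (Sh T (- 1) Z) (X 0)"
    unfolding f_def using neg_hom[OF sha_hom[OF z(3), of "- 1"]] X by (simp add: z(4))
  have a: "a \<in> Hom T H (Sh T 1 (Sh T (- 1) Z))" using z by simp
  have t: "triangle T (Sh T (- 1) Z) (X 0) H f (q \<cdot> c 0) a"
  proof (subst rotate_iff)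
    show "candidate_triangle T (Sh T (- 1) Z) (X 0) H f (q \<cdot> c 0) a"
      unfolding candidate_triangle_def using f a z by auto
    have "neg T (ShA T 1 f) = b" unfolding f_def using z by (auto simp: in_hom_iff)
    then show "triangle T (X 0) H (Sh T 1 (Sh T (- 1) Z)) (q \<cdot> c 0) a (neg T (ShA T 1 f))"
      using Z z by simp
  qed
  show thesis
  proof (rule that[OF t[unfolded X0] cocone_pos[OF t] H_nonpos])
    show "H \<in> perp T G {0<..}" if "M \<in> perp T G {0<..}" using H_pos that X0 by simp
    show "\<exists>w\<in>Hom T H V. b = w \<cdot> (q \<cdot> c 0)" if "V \<in> perp T G {..0}" "b \<in> Hom T M V" for V b
      using extend_to_H[of V b] that X0 by blast
  qed
qed

text \<open>
  A partial silting object \<open>G\<close> whose orthogonal in all degrees is zero is silting. Vanishing of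
  \<open>Hom(M, V)\<close> for \<open>M\<close> in the aisle and \<open>V\<close> in the coaisle holds because every map \<open>M \<rightarrow> V\<close> factors through
  the homotopy colimit \<open>H\<close> for \<open>M\<close>, which lies in both classes and hence is zero.
\<close>

theorem silting_criterion:
  assumes "universe U" "locally_small U T" "has_coproducts U T"
    and rigid: "G \<in> perp T G {0<..}" and cl: "closed_under_coproducts U T (perp T G {0<..})"
    and gen: "\<And>Z. Z \<in> perp T G UNIV \<Longrightarrow> zero_object T Z"
  shows "silting T G"
proof -
  have G: "G \<in> Ob T" using rigid unfolding perp_def by blast
  have summand: "Z \<in> perp T G I" if X: "X \<in> perp T G I" and sm: "summand T Z X" for X Z I
  proof -
    obtain X' \<iota> where c: "is_coproduct T (UNIV :: bool set) (case_bool Z X') X \<iota>"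
      using sm unfolding summand_def is_direct_sum_def by blast
    obtain r where r: "r \<in> Hom T X Z" "r \<cdot> \<iota> True = Ide T Z"
      using coproduct_retract[OF c, of True] by auto
    have "\<iota> True \<in> Hom T Z X" using coproduct_inj[OF c, of True] by simp
    then show ?thesis
      using X orth_retract_right[OF _ r] hom_ob[OF r(1)] unfolding perp_iff[OF G] by blast
  qed
  have orth_perp: "Hom T M V = {Zero T M V}" if M: "M \<in> perp T G {0<..}" and V: "V \<in> perp T G {..0}" for M V
  proof -
    have MO: "M \<in> Ob T" "V \<in> Ob T" using M V unfolding perp_def by blast+
    obtain A H f g h where t: "triangle T A M H f g h" "H \<in> perp T G {..0}" "H \<in> perp T G {0<..}"
      "\<And>b. b \<in> Hom T M V \<Longrightarrow> \<exists>w\<in>Hom T H V. b = w \<cdot> g"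
      using ex_approximation[OF assms(1-5) MO(1)] M V by metis
    have "H \<in> perp T G UNIV" using t(2,3) unfolding perp_def by force
    then have z: "zero_object T H" by (rule gen)
    have "orth M V"
    proof (rule orthI[OF MO])
      fix b assume "b \<in> Hom T M V"
      then obtain w where w: "w \<in> Hom T H V" "b = w \<cdot> g" using t(4) by blast
      have "w = Zero T H V" using zero_object_orth(1)[OF z MO(2)] orthD w by blast
      then show "b = Zero T M V" using w triangle_hom[OF t(1)] MO by (simp add: in_hom_iff)
    qed
    then show ?thesis unfolding orth_def .
  qed
  have "torsion_pair T (perp T G {0<..}) (perp T G {..0})"
    unfolding torsion_pair_def
  proof (intro conjI ballI allI impI)
    show "perp T G {0<..} \<subseteq> Ob T" "perp T G {..0} \<subseteq> Ob T" unfolding perp_def by auto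
    show "\<exists>A\<in>perp T G {0<..}. \<exists>B\<in>perp T G {..0}. \<exists>f g h. triangle T A X B f g h"
      if "X \<in> Ob T" for X using ex_approximation[OF assms(1-5) that] by metis
  qed (use summand orth_perp in blast)+
  moreover have "Sh T n X \<in> perp T G {0<..}" if "X \<in> perp T G {0<..}" "n > 0" for n X
    using that unfolding perp_def by auto
  moreover have "Y \<in> perp T G {0<..}"
    if "triangle T X Y Z f g h" "X \<in> perp T G {0<..}" "Z \<in> perp T G {0<..}" for X Y Z f g h
    using that orth_mid_right[OF that(1)] triangle_hom[OF that(1)] unfolding perp_iff[OF G] by blast
  ultimately show ?thesis using G unfolding silting_def t_structure_def by blast
qed

section \<open>The extension of a silting object\<close>

lemma perp_iff_sh: "Y \<in> perp T X I \<longleftrightarrow> Y \<in> Ob T \<and> (\<forall>i\<in>I. orth X (Sh T i Y))"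
  unfolding perp_def orth_def by blast

lemma full_sub_Ob: "full_sub T (Ob T) = T"
proof -
  have A: "{f \<in> Arr T. Dom T f \<in> Ob T \<and> Cod T f \<in> Ob T} = Arr T" by auto
  have "\<forall>(f, g, h)\<in>Tri T. \<exists>X Y Z. candidate_triangle T X Y Z f g h"
    using triangulated unfolding triangulated_category_def by (elim conjE)
  then have "Tri T \<inter> (Arr T \<times> Arr T \<times> Arr T) = Tri T"
    unfolding candidate_triangle_def in_hom_iff by auto
  then show ?thesis unfolding full_sub_def Let_def A by simp
qed

lemma direct_sumD:
  assumes "is_direct_sum T X Y S"
  shows "orth X Q \<Longrightarrow> orth Y Q \<Longrightarrow> orth S Q" "orth Q X \<Longrightarrow> orth Q Y \<Longrightarrow> orth Q S"
    "orth S Q \<Longrightarrow> orth X Q" "orth S Q \<Longrightarrow> orth Y Q" "X \<in> Ob T" "Y \<in> Ob T" "S \<in> Ob T"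
proof -
  obtain \<iota> where c: "is_coproduct T (UNIV :: bool set) (case_bool X Y) S \<iota>"
    using assms unfolding is_direct_sum_def by blast
  show "orth S Q" if "orth X Q" "orth Y Q"
    using orth_coproduct[OF c] orth_ob that by (simp split: bool.split)
  show "orth Q S" if "orth Q X" "orth Q Y"
    using orth_finite_coproduct_right[of "Ob T", unfolded full_sub_Ob, OF c] orth_ob that
    by (simp split: bool.split)
  have r: "orth (case_bool X Y i) Q" if "orth S Q" for i
  proof -
    obtain p where "p \<in> Hom T S (case_bool X Y i)" "p \<cdot> \<iota> i = Ide T (case_bool X Y i)"
      using coproduct_retract[OF c, of i] by blast
    then show ?thesis using orth_retract_left that coproduct_inj[OF c, of i] by blast
  qed
  show "orth S Q \<Longrightarrow> orth X Q" "orth S Q \<Longrightarrow> orth Y Q" using r[of True] r[of False] by simp_all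
  show "X \<in> Ob T" "Y \<in> Ob T" "S \<in> Ob T"
    using coproduct_comp_ob[OF c, of True] coproduct_comp_ob[OF c, of False] coproduct_ob[OF c]
    by simp_all
qed

text \<open>
  A map from a compact object to a coproduct is a finite sum of maps through the injections; it is
  killed by \<open>g\<close> if all maps to the terms of the coproduct are.
\<close>

lemma compact_zero:
  fixes U :: "'u set" and I :: "'u set"
  assumes M: "compact_object U T M" and I: "small U I" and c: "is_coproduct T I A C \<iota>"
    and g: "g \<in> Hom T Q M" and z: "\<And>i b. i \<in> I \<Longrightarrow> b \<in> Hom T M (A i) \<Longrightarrow> b \<cdot> g = Zero T Q (A i)"
    and f: "f \<in> Hom T M C"
  shows "f \<cdot> g = Zero T Q C"
proof -
  have QO: "Q \<in> Ob T" and MO: "M \<in> Ob T" and CO: "C \<in> Ob T" using hom_ob g f by blast+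
  interpret G: comm_group "hom_group T M C" using hom_comm_group MO CO .
  let ?F = "\<lambda>b. finprod (hom_group T M C) (\<lambda>i. \<iota> i \<cdot> b i) {i \<in> I. b i \<noteq> Zero T M (A i)}"
  have "?F \<in> Group.iso (sum_group I (\<lambda>i. hom_group T M (A i))) (hom_group T M C)"
    using M I c unfolding compact_object_def by blast
  then have "?F ` carrier (sum_group I (\<lambda>i. hom_group T M (A i))) = carrier (hom_group T M C)"
    unfolding Group.iso_def bij_betw_def by blast
  moreover have "f \<in> carrier (hom_group T M C)" using f unfolding hom_group_def by simp
  ultimately obtain b where b: "b \<in> carrier (sum_group I (\<lambda>i. hom_group T M (A i)))" "f = ?F b"
    by blast
  then have bH: "b i \<in> Hom T M (A i)" if "i \<in> I" for i
  proof -
    have "Group.group (hom_group T M (A j))" if "j \<in> I" for j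
      using hom_comm_group[OF MO coproduct_comp_ob[OF c that]] comm_group.axioms(2) by blast
    then have "b \<in> (\<Pi>\<^sub>E i\<in>I. carrier (hom_group T M (A i)))"
      using b(1) carrier_sum_group[of I "\<lambda>i. hom_group T M (A i)"] by simp
    then show ?thesis using that unfolding hom_group_def by auto
  qed
  let ?N = "{h \<in> Hom T M C. h \<cdot> g = Zero T Q C}"
  have tm: "\<iota> i \<cdot> b i \<in> ?N" if "i \<in> I" for i
  proof -
    have "(\<iota> i \<cdot> b i) \<cdot> g = \<iota> i \<cdot> (b i \<cdot> g)"
      using coproduct_inj[OF c that] bH[OF that] g by (simp add: in_hom_iff comp_assoc)
    then show ?thesis
      using z[OF that bH[OF that]] comp_hom[OF bH[OF that] coproduct_inj[OF c that]]
        coproduct_inj[OF c that] QO by (simp add: in_hom_iff)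
  qed
  have one: "\<one>\<^bsub>hom_group T M C\<^esub> \<in> ?N"
    using MO CO g by (simp add: hom_group_def in_hom_iff)
  have fin: "finprod (hom_group T M C) (\<lambda>i. \<iota> i \<cdot> b i) F \<in> ?N" if "finite F" "F \<subseteq> I" for F
    using that
  proof (induction F rule: finite_induct)
    case empty
    then show ?case using one by simp
  next
    case (insert i F)
    let ?h = "finprod (hom_group T M C) (\<lambda>i. \<iota> i \<cdot> b i) F"
    have h: "?h \<in> ?N" and t: "\<iota> i \<cdot> b i \<in> ?N" using insert tm by auto
    have "(\<lambda>i. \<iota> i \<cdot> b i) \<in> F \<rightarrow> carrier (hom_group T M C)"
      using tm insert unfolding hom_group_def by auto
    moreover have "\<iota> i \<cdot> b i \<in> carrier (hom_group T M C)" using t unfolding hom_group_def by simp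
    ultimately have "finprod (hom_group T M C) (\<lambda>i. \<iota> i \<cdot> b i) (insert i F) = \<iota> i \<cdot> b i \<boxplus> ?h"
      using G.finprod_insert[OF insert(1,2)] by (simp add: hom_group_def)
    moreover have "\<iota> i \<cdot> b i \<boxplus> ?h \<in> ?N"
      using add_hom add_comp[OF g, of "\<iota> i \<cdot> b i" C ?h] t h QO CO by simp
    ultimately show ?case by simp
  qed
  have "f \<in> ?N"
  proof (cases "finite {i \<in> I. b i \<noteq> Zero T M (A i)}")
    case True
    then show ?thesis unfolding b(2) by (intro fin) auto
  next
    case False
    show ?thesis unfolding b(2) G.finprod_infinite[OF False] by (rule one)
  qed
  then show ?thesis by blast
qed

lemma orth_cocone_left:
  assumes t: "triangle T X Y Z f g h" and "orth Y Q" "orth Z (Sh T 1 Q)"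
  shows "orth X Q"
proof -
  note h = triangle_hom[OF t]
  have Q: "Q \<in> Ob T" using assms orth_ob by blast
  have "orth (Sh T 1 X) (Sh T 1 Q)"
    by (rule orth_mid_left[OF rotate[OF rotate[OF t]] assms(3)])
      (use assms(2) orth_sh_iff[of Y Q 1 1] h Q in simp)
  then show ?thesis using orth_sh_sh h Q by blast
qed

lemma perp_UNIV_sh:
  assumes "X \<in> Ob T" "Z \<in> perp T X UNIV"
  shows "Sh T n Z \<in> perp T X UNIV"
  using assms unfolding perp_iff_sh by auto

text \<open>
  The heart of the argument, free of functors. In the application \<open>A\<close> is \<open>j\<^sub>*\<omega>\<close>. What is used about
  the recollement is that \<open>A\<close> receives no maps from the orthogonal of \<open>\<omega>\<close>, that \<open>\<omega>\<close> and \<open>A\<close> differ by an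
  object \<open>Z\<close> of that orthogonal, and that an object orthogonal to all shifts of \<open>\<sigma>\<close> is orthogonal to
  all of it.
\<close>

lemma silting_extension:
  fixes U :: "'u set"
  assumes U: "universe U" and ls: "locally_small U T" and hc: "has_coproducts U T"
    and w: "\<omega> \<in> perp T \<omega> {0<..}"
    and A: "\<And>Z. Z \<in> perp T \<omega> UNIV \<Longrightarrow> orth Z A"
    and tA: "triangle T \<omega> A Z u z v" and Z: "Z \<in> perp T \<omega> UNIV"
    and s: "\<sigma> \<in> perp T \<omega> UNIV" "\<sigma> \<in> perp T \<sigma> {0<..}"
    and gen: "\<And>X B. X \<in> perp T \<sigma> UNIV \<Longrightarrow> B \<in> perp T \<omega> UNIV \<Longrightarrow> orth B X"
    and fin: "finite I" "is_coproduct (full_sub T (perp T \<omega> UNIV)) I (\<lambda>_. \<sigma>) \<sigma>I \<iota>"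
    and pre: "\<And>b. b \<in> Hom T A (Sh T 1 \<sigma>) \<Longrightarrow> \<exists>c\<in>Hom T (Sh T 1 \<sigma>I) (Sh T 1 \<sigma>). b = c \<cdot> \<alpha>"
    and cl: "closed_under_coproducts U T (perp T \<sigma> {0<..})"
    and van: "\<And>k. k \<ge> 2 \<Longrightarrow> orth A (Sh T k \<sigma>)"
    and comp: "compact_object U T A"
    and t: "triangle T \<sigma>I \<sigma>' A f g \<alpha>" and S: "is_direct_sum T \<sigma>' \<sigma> S"
  shows "silting T S"
proof -
  note tAh = triangle_hom[OF tA] and th = triangle_hom[OF t] and So = direct_sumD(5-7)[OF S]
  note PY = perp_UNIV_sh[OF tAh(4)]
  have sub: "perp T \<omega> UNIV \<subseteq> Ob T" unfolding perp_def by blast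
  have ss: "orth \<sigma> (Sh T k \<sigma>)" if "k > 0" for k using s(2) that unfolding perp_iff_sh by auto
  have sI: "\<sigma>I \<in> perp T \<omega> UNIV" using coproduct_ob[OF fin(2)] by simp
  have Ash: "orth B (Sh T k A)" if "B \<in> perp T \<omega> UNIV" for B k
    using A[OF PY[OF that]] orth_sh_right[of B A k] th that sub by auto
  have sIleft: "orth \<sigma>I Q" if "orth \<sigma> Q" for Q
    using orth_finite_coproduct_left[OF fin(2) sub fin(1)] that orth_ob by blast
  have sIright: "orth Q \<sigma>I" if "orth Q \<sigma>" for Q
    using orth_finite_coproduct_right[OF fin(2) sub fin(1)] that orth_ob by blast
  have sIsh: "orth Q (Sh T k \<sigma>I)" if "orth Q (Sh T k \<sigma>)" "Q \<in> Ob T" for Q k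
    using sIright[of "Sh T (- k) Q"] that orth_sh_right[of Q _ k] So th by simp
  have mid: "orth Q (Sh T k Y)" if "triangle T X Y Z f g h" "orth Q (Sh T k X)" "orth Q (Sh T k Z)" "Q \<in> Ob T"
    for Q k X Y Z f g h
    using orth_mid_right[OF that(1), of "Sh T (- k) Q"] that orth_sh_right[of Q _ k]
      triangle_hom[OF that(1)] by simp
  have AA: "orth A (Sh T k A)" if "k > 0" for k
  proof (rule orth_mid_left[OF tA _ Ash[OF Z]])
    have "orth \<omega> (Sh T k Z)" using Z unfolding perp_iff_sh by simp
    moreover have "orth \<omega> (Sh T k \<omega>)" using w that unfolding perp_iff_sh by simp
    ultimately show "orth \<omega> (Sh T k A)" using mid[OF tA] tAh by blast
  qed
  have s_s': "orth \<sigma> (Sh T k \<sigma>')" if "k > 0" for k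
    using mid[OF t sIsh[OF ss[OF that] So(2)] Ash[OF s(1)] So(2)] .
  have s'_s: "orth \<sigma>' (Sh T k \<sigma>)" if k: "k > 0" for k
  proof (cases "k = 1")
    case False
    then show ?thesis using orth_mid_left[OF t sIleft[OF ss[OF k]] van] k by simp
  next
    case True
    \<comment> \<open>this is the degree for which \<open>\<alpha>\<close> has to be a preenvelope\<close>
    have "orth \<sigma>' (Sh T 1 \<sigma>)"
    proof (rule orthI)
      fix b assume b: "b \<in> Hom T \<sigma>' (Sh T 1 \<sigma>)"
      have "b \<cdot> f = Zero T \<sigma>I (Sh T 1 \<sigma>)" using orthD[OF sIleft[OF ss[of 1]]] comp_hom th(1) b by simp
      then obtain b' where b': "b' \<in> Hom T A (Sh T 1 \<sigma>)" "b = b' \<cdot> g" using weak_coker1[OF t b] by blast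
      then obtain c where c: "c \<in> Hom T (Sh T 1 \<sigma>I) (Sh T 1 \<sigma>)" "b' = c \<cdot> \<alpha>" using pre by blast
      have "b = c \<cdot> (\<alpha> \<cdot> g)" using b' c th by (simp add: in_hom_iff comp_assoc)
      then show "b = Zero T \<sigma>' (Sh T 1 \<sigma>)"
        using triangle_comp_zero2[OF t] c th by (simp add: in_hom_iff)
    qed (use So in auto)
    then show ?thesis using True by simp
  qed
  have s'_s': "orth \<sigma>' (Sh T k \<sigma>')" if k: "k > 0" for k
    using mid[OF t sIsh[OF s'_s[OF k] So(1)] orth_mid_left[OF t Ash[OF sI] AA[OF k]] So(1)] .
  have sumsh: "orth Q (Sh T k S)" if "orth Q (Sh T k \<sigma>')" "orth Q (Sh T k \<sigma>)" "Q \<in> Ob T" for Q k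
    using direct_sumD(2)[OF S, of "Sh T (- k) Q"] that orth_sh_right[of Q _ k] So by simp
  have rigid: "S \<in> perp T S {0<..}"
    unfolding perp_iff_sh
    using So direct_sumD(1)[OF S] sumsh s_s' s'_s ss s'_s' by auto
  have closed: "closed_under_coproducts U T (perp T S {0<..})"
    unfolding closed_under_coproducts_def
  proof (intro allI impI)
    fix I :: "'u set" and X C \<kappa>
    assume a: "small U I \<and> (\<forall>i\<in>I. X i \<in> perp T S {0<..}) \<and> is_coproduct T I X C \<kappa>"
    then have c: "is_coproduct T I X C \<kappa>" by blast
    have CO: "C \<in> Ob T" using coproduct_ob[OF c] .
    have "X i \<in> perp T \<sigma> {0<..}" if "i \<in> I" for i
      using a that direct_sumD(4)[OF S] unfolding perp_iff_sh by blast
    then have C: "C \<in> perp T \<sigma> {0<..}" using cl a unfolding closed_under_coproducts_def by blast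
    have "orth S (Sh T k C)" if k: "k > 0" for k
    proof (rule direct_sumD(1)[OF S])
      show sC: "orth \<sigma> (Sh T k C)" using C k unfolding perp_iff_sh by simp
      show "orth \<sigma>' (Sh T k C)"
      proof (rule orthI)
        fix b assume b: "b \<in> Hom T \<sigma>' (Sh T k C)"
        have "b \<cdot> f = Zero T \<sigma>I (Sh T k C)" using orthD[OF sIleft[OF sC]] comp_hom th(1) b by blast
        then obtain b' where b': "b' \<in> Hom T A (Sh T k C)" "b = b' \<cdot> g" using weak_coker1[OF t b] by blast
        have "b' \<cdot> g = Zero T \<sigma>' (Sh T k C)"
        proof (rule compact_zero[OF comp _ coproduct_shift[OF c, of k] th(2) _ b'(1)])
          show "small U I" using a by blast
          fix i e assume i: "i \<in> I" and e: "e \<in> Hom T A (Sh T k (X i))"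
          have "orth S (Sh T k (X i))" using a i k unfolding perp_iff_sh by simp
          then show "e \<cdot> g = Zero T \<sigma>' (Sh T k (X i))"
            using orthD[OF direct_sumD(3)[OF S]] comp_hom[OF th(2) e] by blast
        qed
        then show "b = Zero T \<sigma>' (Sh T k C)" using b'(2) by simp
      qed (use So CO in auto)
    qed
    then show "C \<in> perp T S {0<..}" using CO unfolding perp_iff_sh by simp
  qed
  have gens: "zero_object T X" if X: "X \<in> perp T S UNIV" for X
  proof -
    have XO: "X \<in> Ob T" and SX: "orth S (Sh T k X)" for k using X unfolding perp_iff_sh by auto
    have "X \<in> perp T \<sigma> UNIV" using direct_sumD(4)[OF S SX] XO unfolding perp_iff_sh by simp
    then have YX: "orth B X" if "B \<in> perp T \<omega> UNIV" for B using gen that by blast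
    have YXk: "orth B (Sh T k X)" if "B \<in> perp T \<omega> UNIV" for B k
      using YX[OF PY[OF that]] orth_sh_right[of B X k] XO that sub by auto
    have AX: "orth A (Sh T k X)" for k
      using orth_cone_left[OF t direct_sumD(3)[OF S SX] YXk[OF PY[OF sI]]] .
    have "orth \<omega> (Sh T k X)" for k
      by (rule orth_cocone_left[OF tA AX]) (use YXk[OF Z, of "1 + k"] XO in simp)
    then have "X \<in> perp T \<omega> UNIV" using XO unfolding perp_iff_sh by simp
    then show ?thesis using orth_self_zero_object[OF YX] by blast
  qed
  show ?thesis by (rule silting_criterion[OF U ls hc rigid closed gens])
qed

section \<open>Silting objects in full subcategories and recollements\<close>

lemma orth_bij:
  assumes "bij_betw b (Hom T X Y) (Hom T X' Y')" "X \<in> Ob T" "Y \<in> Ob T" "X' \<in> Ob T" "Y' \<in> Ob T"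
  shows "orth X Y \<longleftrightarrow> orth X' Y'"
proof -
  have "orth P Q \<longleftrightarrow> (\<exists>a. Hom T P Q = {a})" if "P \<in> Ob T" "Q \<in> Ob T" for P Q
    using zero_hom[OF that] unfolding orth_def by auto
  moreover have "(\<exists>a. Hom T X Y = {a}) \<longleftrightarrow> (\<exists>a. Hom T X' Y' = {a})"
    using assms(1) bij_betw_same_card[OF assms(1)] by (metis card_1_singleton_iff One_nat_def)
  ultimately show ?thesis using assms by blast
qed

lemma perp_full_sub:
  assumes "X \<in> B" "\<And>Z n. Z \<in> B \<Longrightarrow> Sh T n Z \<in> B" "B \<subseteq> Ob T"
  shows "perp (full_sub T B) X I = perp T X I \<inter> B"
  unfolding perp_def using assms hom_full_sub[of X B _ T] by auto

lemma right_adjoint_orth: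
  assumes adj: "adjoint_pair (full_sub T B) T inclusion R" and fR: "is_functor T (full_sub T B) R"
    and B: "B \<subseteq> Ob T" and Z: "Z \<in> B" and X: "X \<in> Ob T"
  shows "orth Z X \<longleftrightarrow> orth Z (fob R X)"
proof -
  have RX: "fob R X \<in> B" using fR X unfolding is_functor_def by simp
  obtain b where "bij_betw b (Hom T Z X) (Hom (full_sub T B) Z (fob R X))"
    using adj Z X unfolding adjoint_pair_def inclusion_def by auto
  then have "bij_betw b (Hom T Z X) (Hom T Z (fob R X))" using hom_full_sub Z RX by metis
  then show ?thesis using orth_bij B Z X RX by blast
qed

text \<open>
  By definition the t-structure of a silting object \<open>\<sigma>\<close> provides a triangle \<open>M \<rightarrow> \<sigma> \<rightarrow> V\<close> with \<open>M\<close> in the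
  aisle and \<open>Hom(\<sigma>, V) = 0\<close>. So \<open>\<sigma>\<close> is a retract of \<open>M\<close> and lies in the aisle itself.
\<close>

lemma silting_rigid:
  assumes sil: "silting (full_sub T B) \<sigma>" and B: "B \<subseteq> Ob T" "\<And>Z n. Z \<in> B \<Longrightarrow> Sh T n Z \<in> B"
  shows "\<sigma> \<in> perp T \<sigma> {0<..}"
proof -
  let ?Y = "full_sub T B"
  have s: "\<sigma> \<in> B" using sil unfolding silting_def by simp
  have "torsion_pair ?Y (perp ?Y \<sigma> {0<..}) (perp ?Y \<sigma> {..0})"
    using sil unfolding silting_def t_structure_def by blast
  then obtain M V f g h where M: "M \<in> perp ?Y \<sigma> {0<..}" and V: "V \<in> perp ?Y \<sigma> {..0}"
    and t: "triangle ?Y M \<sigma> V f g h" using s unfolding torsion_pair_def by fastforce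
  have p: "perp ?Y \<sigma> J = perp T \<sigma> J \<inter> B" for J
    by (rule perp_full_sub) (use s B in auto)
  have MV: "M \<in> B" "V \<in> B" using M V p by auto
  have t': "triangle T M \<sigma> V f g h"
    using t MV s B hom_full_sub[of _ B _ T] unfolding triangle_def candidate_triangle_def
    by (auto simp: full_sub_def Let_def)
  note th = triangle_hom[OF t']
  have "orth \<sigma> (Sh T 0 V)" using V unfolding p Int_iff perp_iff_sh by blast
  then have "orth \<sigma> V" using th by simp
  then have "g = Zero T \<sigma> V" using orthD th by blast
  then have "g \<cdot> Ide T \<sigma> = Zero T \<sigma> V" using th by (simp add: in_hom_iff)
  then obtain b where b: "b \<in> Hom T \<sigma> M" "Ide T \<sigma> = f \<cdot> b"
    using weak_ker1[OF t' ide_hom[OF th(5)]] by blast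
  have "orth (Sh T (- k) \<sigma>) \<sigma>" if "k > 0" for k
    using orth_retract_right[OF b(1) th(1) b(2)[symmetric]] M that
    unfolding p Int_iff perp_iff[OF th(5)] by simp
  then show ?thesis using perp_iff th by auto
qed

lemma silting_generates:
  assumes sil: "silting (full_sub T B) \<sigma>" and B: "B \<subseteq> Ob T" "\<And>Z n. Z \<in> B \<Longrightarrow> Sh T n Z \<in> B"
    and R: "R \<in> B" "R \<in> perp T \<sigma> UNIV"
  shows "zero_object T R"
proof -
  let ?Y = "full_sub T B"
  have s: "\<sigma> \<in> B" using sil unfolding silting_def by simp
  have p: "perp ?Y \<sigma> J = perp T \<sigma> J \<inter> B" for J
    by (rule perp_full_sub) (use s B in auto)
  have "torsion_pair ?Y (perp ?Y \<sigma> {0<..}) (perp ?Y \<sigma> {..0})"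
    using sil unfolding silting_def t_structure_def by blast
  moreover have "R \<in> perp ?Y \<sigma> {0<..}" "R \<in> perp ?Y \<sigma> {..0}"
    using R unfolding p by (auto simp: perp_def)
  ultimately have "Hom ?Y R R = {Zero ?Y R R}" unfolding torsion_pair_def by blast
  then have "orth R R" unfolding orth_def hom_full_sub[OF R(1) R(1)] by simp
  then show ?thesis by (rule orth_self_zero_object)
qed

text \<open>
  For adjoint functors \<open>j\<^sub>! \<stileturn> j\<^sup>* \<stileturn> j\<^sub>*\<close> with \<open>j\<^sub>!\<close> the inclusion of a full subcategory there is a canonical
  map \<open>u\<close> from \<open>\<omega> = j\<^sub>!\<omega>\<close> to \<open>j\<^sub>*\<omega>\<close>, which induces bijections on maps from objects of the subcategory.
  The unit \<open>\<eta>\<close> of \<open>j\<^sub>! \<stileturn> j\<^sup>*\<close> is invertible with inverse \<open>\<theta>\<close>, and \<open>u\<close> is adjoint to \<open>\<theta> \<omega>\<close>.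
\<close>

lemma adjoint_triple_unit:
  fixes LS :: "'o set" and jl ju :: "('o, 'm, 'o, 'm) functr"
  defines "L \<equiv> full_sub T LS"
  assumes LS: "LS \<subseteq> Ob T" and w: "\<omega> \<in> LS"
    and adj1: "adjoint_pair L T inclusion ju" and adj2: "adjoint_pair T L ju jl"
    and fu: "is_functor T L ju" and fl: "is_functor L T jl"
  obtains u where "u \<in> Hom T \<omega> (fob jl \<omega>)"
    "\<And>M. M \<in> LS \<Longrightarrow> bij_betw (\<lambda>a. u \<cdot> a) (Hom T M \<omega>) (Hom T M (fob jl \<omega>))"
proof -
  let ?J = "fob ju"
  have HL: "Hom L X Y = Hom T X Y" if "X \<in> LS" "Y \<in> LS" for X Y
    unfolding L_def using hom_full_sub that .
  have J: "?J X \<in> LS" "far ju (Ide T X) = Ide T (?J X)" if "X \<in> Ob T" for X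
    using fu that unfolding is_functor_def L_def by auto
  have JH: "far ju a \<in> Hom T (?J X) (?J Y)" if "a \<in> Hom T X Y" for a X Y
    using fu that HL J hom_ob[OF that] unfolding is_functor_def by metis
  have jl: "far jl (Ide T \<omega>) = Ide T (fob jl \<omega>)" "fob jl \<omega> \<in> Ob T"
    using fl w unfolding is_functor_def L_def by auto
  have wO: "\<omega> \<in> Ob T" using w LS by blast
  obtain \<Phi> where \<Phi>0: "\<forall>X\<in>LS. \<forall>Y\<in>Ob T. bij_betw (\<Phi> X Y) (Hom T X Y) (Hom T X (?J Y))"
    "\<forall>X'\<in>LS. \<forall>X\<in>LS. \<forall>Y\<in>Ob T. \<forall>Y'\<in>Ob T. \<forall>a\<in>Hom T X' X. \<forall>b\<in>Hom T Y Y'. \<forall>h\<in>Hom T X Y.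
      \<Phi> X' Y' (b \<cdot> (h \<cdot> a)) = far ju b \<cdot> (\<Phi> X Y h \<cdot> a)"
    using adj1 HL J(1) unfolding adjoint_pair_def inclusion_def L_def by auto
  have \<Phi>: "\<And>X Y. X \<in> LS \<Longrightarrow> Y \<in> Ob T \<Longrightarrow> bij_betw (\<Phi> X Y) (Hom T X Y) (Hom T X (?J Y))"
    "\<And>X' X Y Y' a b h. X' \<in> LS \<Longrightarrow> X \<in> LS \<Longrightarrow> Y \<in> Ob T \<Longrightarrow> Y' \<in> Ob T \<Longrightarrow> a \<in> Hom T X' X \<Longrightarrow>
      b \<in> Hom T Y Y' \<Longrightarrow> h \<in> Hom T X Y \<Longrightarrow> \<Phi> X' Y' (b \<cdot> (h \<cdot> a)) = far ju b \<cdot> (\<Phi> X Y h \<cdot> a)"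
    using \<Phi>0 by blast+
  obtain \<Psi> where \<Psi>0:
    "\<forall>X\<in>Ob T. \<forall>N\<in>LS. bij_betw (\<Psi> X N) (Hom T (?J X) N) (Hom T X (fob jl N))"
    "\<forall>X'\<in>Ob T. \<forall>X\<in>Ob T. \<forall>N\<in>LS. \<forall>N'\<in>LS. \<forall>a\<in>Hom T X' X. \<forall>b\<in>Hom T N N'. \<forall>h\<in>Hom T (?J X) N.
      \<Psi> X' N' (b \<cdot> (h \<cdot> far ju a)) = far jl b \<cdot> (\<Psi> X N h \<cdot> a)"
    using adj2 HL J(1) unfolding adjoint_pair_def L_def by auto
  have \<Psi>: "\<And>X N. X \<in> Ob T \<Longrightarrow> N \<in> LS \<Longrightarrow> bij_betw (\<Psi> X N) (Hom T (?J X) N) (Hom T X (fob jl N))"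
    "\<And>X' X N N' a b h. X' \<in> Ob T \<Longrightarrow> X \<in> Ob T \<Longrightarrow> N \<in> LS \<Longrightarrow> N' \<in> LS \<Longrightarrow> a \<in> Hom T X' X \<Longrightarrow>
      b \<in> Hom T N N' \<Longrightarrow> h \<in> Hom T (?J X) N \<Longrightarrow> \<Psi> X' N' (b \<cdot> (h \<cdot> far ju a)) = far jl b \<cdot> (\<Psi> X N h \<cdot> a)"
    using \<Psi>0 by blast+
  define \<eta> where "\<eta> M = \<Phi> M M (Ide T M)" for M
  have \<eta>: "\<eta> M \<in> Hom T M (?J M)" if "M \<in> LS" for M
    unfolding \<eta>_def using bij_betwE[OF \<Phi>(1)] ide_hom that LS by blast
  have \<Phi>\<eta>: "\<Phi> M' M a = \<eta> M \<cdot> a" if "M \<in> LS" "M' \<in> LS" "a \<in> Hom T M' M" for M M' a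
  proof -
    have o: "M \<in> Ob T" "M' \<in> Ob T" using that LS by auto
    have "\<eta> M \<cdot> a \<in> Hom T M' (?J M)" using comp_hom \<eta> that by blast
    then show ?thesis
      using \<Phi>(2)[OF that(2,1) o(1) o(1) that(3) ide_hom[OF o(1)] ide_hom[OF o(1)]] that(3) o
        J(2)[OF o(1)] unfolding \<eta>_def[symmetric] by (simp add: in_hom_iff)
  qed
  have nat: "far ju b \<cdot> \<eta> M = \<eta> N \<cdot> b" if "M \<in> LS" "N \<in> LS" "b \<in> Hom T M N" for M N b
  proof -
    have o: "M \<in> Ob T" "N \<in> Ob T" using that LS by auto
    have "\<Phi> M N (b \<cdot> (Ide T M \<cdot> Ide T M)) = far ju b \<cdot> (\<eta> M \<cdot> Ide T M)"
      unfolding \<eta>_def using \<Phi>(2)[OF that(1,1) o(1,2) ide_hom[OF o(1)] that(3) ide_hom[OF o(1)]] .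
    then show ?thesis using \<Phi>\<eta>[OF that(2,1,3)] \<eta>[OF that(1)] that(3) o by (simp add: in_hom_iff)
  qed
  have "\<exists>\<theta>. \<theta> \<in> Hom T (?J M) M \<and> \<eta> M \<cdot> \<theta> = Ide T (?J M) \<and> \<theta> \<cdot> \<eta> M = Ide T M" if M: "M \<in> LS" for M
  proof -
    have o: "M \<in> Ob T" "?J M \<in> LS" "?J M \<in> Ob T" using M LS J(1) by auto
    have "Ide T (?J M) \<in> \<Phi> (?J M) M ` Hom T (?J M) M"
      using \<Phi>(1)[OF o(2,1)] ide_hom[OF o(3)] unfolding bij_betw_def by blast
    then obtain \<theta> where \<theta>: "\<theta> \<in> Hom T (?J M) M" "\<eta> M \<cdot> \<theta> = Ide T (?J M)"
      using \<Phi>\<eta>[OF M o(2)] by auto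
    have c: "\<theta> \<cdot> \<eta> M \<in> Hom T M M" using comp_hom \<theta> \<eta> M by blast
    have "\<Phi> M M (\<theta> \<cdot> \<eta> M) = (\<eta> M \<cdot> \<theta>) \<cdot> \<eta> M"
      using \<Phi>\<eta>[OF M M c] \<theta>(1) \<eta>[OF M] by (simp add: in_hom_iff comp_assoc)
    also have "\<dots> = \<Phi> M M (Ide T M)" using \<theta>(2) \<eta>[OF M] by (simp add: in_hom_iff \<eta>_def)
    finally have "\<theta> \<cdot> \<eta> M = Ide T M"
      using \<Phi>(1)[OF M o(1)] c ide_hom[OF o(1)] unfolding bij_betw_def inj_on_def by blast
    then show ?thesis using \<theta> by blast
  qed
  then obtain \<theta> where \<theta>: "\<And>M. M \<in> LS \<Longrightarrow> \<theta> M \<in> Hom T (?J M) M"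
    "\<And>M. M \<in> LS \<Longrightarrow> \<eta> M \<cdot> \<theta> M = Ide T (?J M)" "\<And>M. M \<in> LS \<Longrightarrow> \<theta> M \<cdot> \<eta> M = Ide T M" by metis
  define u where "u = \<Psi> \<omega> \<omega> (\<theta> \<omega>)"
  have u: "u \<in> Hom T \<omega> (fob jl \<omega>)" unfolding u_def using bij_betwE[OF \<Psi>(1)] wO w \<theta>(1) by blast
  have key: "u \<cdot> a = \<Psi> M \<omega> (a \<cdot> \<theta> M)" if M: "M \<in> LS" and a: "a \<in> Hom T M \<omega>" for M a
  proof -
    have MO: "M \<in> Ob T" using M LS by blast
    note \<theta>M = \<theta>(1)[OF M] and \<theta>w = \<theta>(1)[OF w] and \<eta>M = \<eta>[OF M] and \<eta>w = \<eta>[OF w]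
    have ja: "far ju a \<in> Hom T (?J M) (?J \<omega>)" using JH a .
    have "far ju a = far ju a \<cdot> (\<eta> M \<cdot> \<theta> M)" unfolding \<theta>(2)[OF M] using ja by (simp add: in_hom_iff)
    also have "\<dots> = (\<eta> \<omega> \<cdot> a) \<cdot> \<theta> M"
      unfolding nat[OF M w a, symmetric] using ja \<eta>M \<theta>M by (simp add: in_hom_iff comp_assoc)
    finally have "\<theta> \<omega> \<cdot> far ju a = (\<theta> \<omega> \<cdot> \<eta> \<omega>) \<cdot> (a \<cdot> \<theta> M)"
      using \<theta>w \<eta>w a \<theta>M by (simp add: in_hom_iff comp_assoc)
    then have e: "\<theta> \<omega> \<cdot> far ju a = a \<cdot> \<theta> M" unfolding \<theta>(3)[OF w] using a \<theta>M by (simp add: in_hom_iff)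
    have "\<Psi> M \<omega> (Ide T \<omega> \<cdot> (\<theta> \<omega> \<cdot> far ju a)) = Ide T (fob jl \<omega>) \<cdot> (u \<cdot> a)"
      using \<Psi>(2)[OF MO wO w w a ide_hom[OF wO] \<theta>w] unfolding u_def jl(1) .
    then show ?thesis unfolding e using a \<theta>M u wO by (simp add: in_hom_iff)
  qed
  have "bij_betw (\<lambda>a. u \<cdot> a) (Hom T M \<omega>) (Hom T M (fob jl \<omega>))" if M: "M \<in> LS" for M
  proof (rule bij_betw_imageI)
    have MO: "M \<in> Ob T" using M LS by blast
    note \<theta>M = \<theta>(1)[OF M] and \<eta>M = \<eta>[OF M] and b = \<Psi>(1)[OF MO w]
    have canc: "(a \<cdot> \<theta> M) \<cdot> \<eta> M = a" if "a \<in> Hom T M \<omega>" for a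
      using that \<theta>M \<eta>M \<theta>(3)[OF M] by (simp add: in_hom_iff comp_assoc)
    show "inj_on (\<lambda>a. u \<cdot> a) (Hom T M \<omega>)"
    proof (rule inj_onI)
      fix a a' assume a: "a \<in> Hom T M \<omega>" "a' \<in> Hom T M \<omega>" "u \<cdot> a = u \<cdot> a'"
      then have "\<Psi> M \<omega> (a \<cdot> \<theta> M) = \<Psi> M \<omega> (a' \<cdot> \<theta> M)" using key[OF M] by simp
      then have "a \<cdot> \<theta> M = a' \<cdot> \<theta> M"
        using b comp_hom[OF \<theta>M] a unfolding bij_betw_def inj_on_def by blast
      then show "a = a'" using canc a by metis
    qed
    show "(\<lambda>a. u \<cdot> a) ` Hom T M \<omega> = Hom T M (fob jl \<omega>)"
    proof
      show "(\<lambda>a. u \<cdot> a) ` Hom T M \<omega> \<subseteq> Hom T M (fob jl \<omega>)" using comp_hom u by blast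
      show "Hom T M (fob jl \<omega>) \<subseteq> (\<lambda>a. u \<cdot> a) ` Hom T M \<omega>"
      proof
        fix f assume "f \<in> Hom T M (fob jl \<omega>)"
        then obtain h where h: "h \<in> Hom T (?J M) \<omega>" "f = \<Psi> M \<omega> h"
          using b unfolding bij_betw_def by blast
        have a: "h \<cdot> \<eta> M \<in> Hom T M \<omega>" using comp_hom \<eta>M h by blast
        have "(h \<cdot> \<eta> M) \<cdot> \<theta> M = h" using h \<theta>M \<eta>M \<theta>(2)[OF M] by (simp add: in_hom_iff comp_assoc)
        then have "f = u \<cdot> (h \<cdot> \<eta> M)" using key[OF M a] h by simp
        then show "f \<in> (\<lambda>a. u \<cdot> a) ` Hom T M \<omega>" using a by blast
      qed
    qed
  qed
  then show thesis using that u by blast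
qed

lemma cone_in_perp:
  assumes t: "triangle T X A Z u z v" and Q: "Q \<in> Ob T"
    and bij: "\<And>n. bij_betw (\<lambda>a. u \<cdot> a) (Hom T (Sh T n Q) X) (Hom T (Sh T n Q) A)"
  shows "Z \<in> perp T Q UNIV"
proof -
  note h = triangle_hom[OF t]
  have "orth (Sh T n Q) Z" for n
  proof (rule orthI)
    fix y assume y: "y \<in> Hom T (Sh T n Q) Z"
    have vy: "v \<cdot> y \<in> Hom T (Sh T n Q) (Sh T 1 X)" using comp_hom y h by blast
    then obtain y' where y': "y' \<in> Hom T (Sh T (n - 1) Q) X" "v \<cdot> y = ShA T 1 y'"
      using sha_surj[of "v \<cdot> y" 1 "Sh T (n - 1) Q" X] Q h by auto
    have "ShA T 1 (u \<cdot> y') = (ShA T 1 u \<cdot> v) \<cdot> y"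
      using y' y h Q by (simp add: in_hom_iff sha_comp comp_assoc)
    also have "\<dots> = ShA T 1 (Zero T (Sh T (n - 1) Q) A)"
      using triangle_comp_zero3[OF t] y h Q by (simp add: in_hom_iff)
    finally have "u \<cdot> y' = Zero T (Sh T (n - 1) Q) A"
      by (rule sha_inj[rotated 2]) (use y' h Q in \<open>auto simp: in_hom_iff\<close>)
    also have "\<dots> = u \<cdot> Zero T (Sh T (n - 1) Q) X" using h Q by (simp add: in_hom_iff)
    finally have "y' = Zero T (Sh T (n - 1) Q) X"
      using bij[of "n - 1"] y'(1) zero_hom[of "Sh T (n - 1) Q" X] h Q
      unfolding bij_betw_def inj_on_def by auto
    then have "v \<cdot> y = Zero T (Sh T n Q) (Sh T 1 X)" using y' h Q by simp
    then obtain b where b: "b \<in> Hom T (Sh T n Q) A" "y = z \<cdot> b" using weak_ker2[OF t y] by blast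
    then obtain a where a: "a \<in> Hom T (Sh T n Q) X" "b = u \<cdot> a"
      using bij[of n] unfolding bij_betw_def by blast
    have "y = (z \<cdot> u) \<cdot> a" using a b h by (simp add: in_hom_iff comp_assoc)
    then show "y = Zero T (Sh T n Q) Z" using triangle_comp_zero1[OF t] a h by (simp add: in_hom_iff)
  qed (use Q h in auto)
  then show ?thesis using perp_iff[OF Q] h by blast
qed

end

theorem theorem2p16:
  fixes U :: "'u set"
    and D Y L :: "('o, 'm) tricat"
    and \<omega> \<sigma> \<sigma>I \<sigma>' S :: 'o
    and i_upstar i_lostar i_upshriek j_loshriek j_upstar j_lostar :: "('o, 'm, 'o, 'm) functr"
    and I :: "'i set" and \<iota> :: "'i \<Rightarrow> 'm"
    and \<alpha> f g :: 'm
  assumes "universe U"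
    and "well_generated U D"
    and "partial_silting U D \<omega>"
    and "Y = full_sub D (perp D \<omega> UNIV)"
    and "L = full_sub D (Loc U D \<omega>)"
    and "recollement Y D L i_upstar i_lostar i_upshriek j_loshriek j_upstar j_lostar"
    and "i_lostar = inclusion"
    and "j_loshriek = inclusion"
    and "silting Y \<sigma>"
    and "finite I"
    and "is_coproduct Y I (\<lambda>_. \<sigma>) \<sigma>I \<iota>"
    and "preenvelope D (add_closure D (Sh D 1 (fob i_lostar \<sigma>)))
           (fob j_lostar \<omega>) (Sh D 1 (fob i_lostar \<sigma>I)) \<alpha>"
    and "closed_under_coproducts U D (perp D (fob i_lostar \<sigma>) {0<..})"
    and "\<forall>k\<ge>2. Hom D (fob j_lostar \<omega>) (Sh D k (fob i_lostar \<sigma>)) =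
           {Zero D (fob j_lostar \<omega>) (Sh D k (fob i_lostar \<sigma>))}"
    and "compact_object U D (fob j_lostar \<omega>)"
    and "triangle D (fob i_lostar \<sigma>I) \<sigma>' (fob j_lostar \<omega>) f g \<alpha>"
    and "is_direct_sum D \<sigma>' (fob i_lostar \<sigma>) S"
  shows "silting D S"
proof -
  let ?B = "perp D \<omega> UNIV" and ?LS = "Loc U D \<omega>" and ?A = "fob j_lostar \<omega>"
  have D: "triangulated_category D" "locally_small U D" "has_coproducts U D"
    using assms(2) unfolding well_generated_def by blast+
  interpret triangulated D by unfold_locales (rule D(1))
  have incl: "fob i_lostar = (\<lambda>X. X)" using assms(7) unfolding inclusion_def by simp
  have w: "\<omega> \<in> perp D \<omega> {0<..}" using assms(3) unfolding partial_silting_def by blast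
  then have wO: "\<omega> \<in> Ob D" unfolding perp_def by blast
  have B: "?B \<subseteq> Ob D" "\<And>Z n. Z \<in> ?B \<Longrightarrow> Sh D n Z \<in> ?B"
    using perp_UNIV_sh[OF wO] unfolding perp_def by blast+
  note sil = assms(9)[unfolded assms(4)]
  have s: "\<sigma> \<in> ?B" using sil unfolding silting_def by simp
  note rec = assms(6)[unfolded assms(4,5,7,8) recollement_def triangle_functor_def]
  have adjoints: "adjoint_pair (full_sub D ?B) D inclusion i_upshriek"
    "is_functor D (full_sub D ?B) i_upshriek"
    "adjoint_pair (full_sub D ?LS) D inclusion j_upstar"
    "adjoint_pair D (full_sub D ?LS) j_upstar j_lostar"
    "is_functor D (full_sub D ?LS) j_upstar" "is_functor (full_sub D ?LS) D j_lostar"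
    "is_functor (full_sub D ?LS) D inclusion"
    "\<forall>X\<in>?LS. zero_object (full_sub D ?B) (fob i_upshriek (fob j_lostar X))"
    using rec by simp_all
  have LS: "?LS \<subseteq> Ob D" using adjoints(7) unfolding is_functor_def inclusion_def by auto
  have wL: "Sh D n \<omega> \<in> ?LS" for n unfolding Loc_def localizing_def by blast
  then have wL0: "\<omega> \<in> ?LS" using wL[of 0] wO by simp
  note adj = right_adjoint_orth[OF adjoints(1,2) B(1)]
  have AO: "?A \<in> Ob D" using triangle_hom[OF assms(16)] by blast
  have YA: "orth Z ?A" if Z: "Z \<in> ?B" for Z
  proof -
    let ?R = "fob i_upshriek ?A"
    have z: "zero_object (full_sub D ?B) ?R" using adjoints(8) wL0 by blast
    then have R: "?R \<in> ?B" unfolding zero_object_def by simp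
    have "\<exists>!f. f \<in> Hom (full_sub D ?B) Z ?R" using z Z unfolding zero_object_def by simp
    then have "\<exists>!f. f \<in> Hom D Z ?R" unfolding hom_full_sub[OF Z R] .
    then have "orth Z ?R" using zero_hom[of Z ?R] Z R B(1) by (intro orthI) blast+
    then show ?thesis using adj[OF Z AO] by blast
  qed
  obtain u where u: "u \<in> Hom D \<omega> ?A"
    "\<And>M. M \<in> ?LS \<Longrightarrow> bij_betw (\<lambda>a. u \<cdot>\<^bsub>D\<^esub> a) (Hom D M \<omega>) (Hom D M ?A)"
    by (rule adjoint_triple_unit[OF LS wL0 adjoints(3-6)]) blast
  obtain Z z v where Z: "triangle D \<omega> ?A Z u z v" using ex_cone[OF u(1)] .
  have ZB: "Z \<in> ?B" by (rule cone_in_perp[OF Z wO u(2)[OF wL]])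
  have gen: "orth M X" if X: "X \<in> perp D \<sigma> UNIV" and M: "M \<in> ?B" for X M
  proof -
    let ?R = "fob i_upshriek X"
    have sO: "\<sigma> \<in> Ob D" using s B(1) by blast
    have XO: "X \<in> Ob D" and "\<forall>i. orth (Sh D (- i) \<sigma>) X" using X unfolding perp_iff[OF sO] by auto
    then have sX: "orth (Sh D n \<sigma>) X" for n by (metis minus_minus)
    have R: "?R \<in> ?B" using adjoints(2) XO unfolding is_functor_def by simp
    have "orth (Sh D n \<sigma>) ?R" for n using adj[OF B(2)[OF s] XO] sX by blast
    then have "?R \<in> perp D \<sigma> UNIV" using R B(1) unfolding perp_iff[OF sO] by blast
    then have "zero_object D ?R" using silting_generates[OF sil B R] by blast
    then have "orth M ?R" using zero_object_orth(2) M B(1) by blast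
    then show ?thesis using adj[OF M XO] by blast
  qed
  have pre: "\<exists>c\<in>Hom D (Sh D 1 \<sigma>I) (Sh D 1 \<sigma>). b = c \<cdot>\<^bsub>D\<^esub> \<alpha>" if "b \<in> Hom D ?A (Sh D 1 \<sigma>)" for b
    using assms(12) that add_closure.base[of "Sh D 1 \<sigma>" D] unfolding preenvelope_def incl by blast
  show ?thesis
  proof (rule silting_extension[OF assms(1) D(2,3) w YA Z ZB s silting_rigid[OF sil B] gen assms(10)])
    show "is_coproduct (full_sub D ?B) I (\<lambda>_. \<sigma>) \<sigma>I \<iota>" using assms(4,11) by simp
    show "closed_under_coproducts U D (perp D \<sigma> {0<..})" using assms(13) unfolding incl .
    show "orth ?A (Sh D k \<sigma>)" if "k \<ge> 2" for k using assms(14) that unfolding incl orth_def by blast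
    show "triangle D \<sigma>I \<sigma>' ?A f g \<alpha>" "is_direct_sum D \<sigma>' \<sigma> S" using assms(16,17) unfolding incl by auto
  qed (use pre assms(15) in blast)+
qed

end
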